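(* Let $\mathbb{K}$ be a field, $R=\mathbb{K}[x_1,\dots,x_n]$, and let $f_1,\dots,f_c\in R$ with $c\le n$. Consider the following algorithm. Start with the ideal $J:=\langle 0\rangle$ of $R$ and the empty set of ideals $\mathcal{K}:=\varnothing$. For $k=1,\dots,c$ successively do: set $H:=J:f_k^\infty$; replace $\mathcal{K}$ by $\mathcal{K}\cup\{J:H\}$; replace $J$ by $H+\langle f_k\rangle$; then, for each $K\in\mathcal{K}$ in turn, replace $J$ by $J:K^\infty$. Finally return $J$. Then the algorithm terminates and outputs an ideal $J$ such that $V(J)$ is the nondegenerate locus of $f_1,\dots,f_c$.
   Context: $\overline{\mathbb{K}}$ is an algebraic closure of $\mathbb{K}$, and for an ideal $J\subseteq R$, $V(J)\subseteq\overline{\mathbb{K}}^n$ denotes its zero set. The nondegenerate locus of $f_1,\dots,f_c$ is the union of those $\mathbb{K}$-irreducible components of $V(\langle f_1,\dots,f_c\rangle)$ that have codimension exactly $c$ (the empty set if there are none). For ideals $I,J\subseteq R$: $I:J=\{p\in R\mid pJ\subseteq I\}$, and $I:J^\infty=\bigcup_{k\ge 0}(I:J^k)$ is the saturation of $I$ by $J$; for $f\in R$, $I:f^\infty=I:\langle f\rangle^\infty$. It is assumed that algorithms computing $J:K$ and $J:K^\infty$ from generators of $J$ and $K$ are available. *)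

theory Defs
  imports
    "HOL-Algebra.Ideal_Product"
    "HOL-Algebra.Algebraic_Closure_Type"
    "HOL-Library.Poly_Mapping"
    "HOL-Library.Extended_Nat"
    "HOL-Library.FuncSet"
begin

text \<open>
  Polynomials in countably many variables over a field are finitely supported maps from
  exponent vectors to coefficients, with the convolution product of \<^theory>\<open>HOL-Library.Poly_Mapping\<close>.
  The ring in the variables with indices \<open>1, \<dots>, n\<close> is the subring with the carrier below;
  \<open>n = 0\<close> is allowed.
\<close>

type_synonym 'k mpoly = "(nat \<Rightarrow>\<^sub>0 nat) \<Rightarrow>\<^sub>0 'k"

definition mpoly_ring :: "nat \<Rightarrow> 'k::field mpoly ring" where
  "mpoly_ring n =
     \<lparr>carrier = {p. \<forall>m \<in> Poly_Mapping.keys p. Poly_Mapping.keys m \<subseteq> {1..n}},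
      monoid.mult = (*), one = 1, zero = 0, add = (+)\<rparr>"

lemma cring_mpoly_ring: "cring (mpoly_ring n :: 'k::field mpoly ring)"
proof (rule cringI)
  let ?R = "mpoly_ring n :: 'k mpoly ring"
  have neg: "- p \<in> carrier ?R" if "p \<in> carrier ?R" for p
    using that by (auto simp: mpoly_ring_def)
  have add: "p + q \<in> carrier ?R" if pq: "p \<in> carrier ?R" "q \<in> carrier ?R" for p q
  proof -
    have "Poly_Mapping.keys m \<subseteq> {1..n}" if "m \<in> Poly_Mapping.keys (p + q)" for m
      using that pq Poly_Mapping.keys_add[of p q] by (auto simp: mpoly_ring_def)
    then show ?thesis by (simp add: mpoly_ring_def)
  qed
  have mult: "p * q \<in> carrier ?R" if pq: "p \<in> carrier ?R" "q \<in> carrier ?R" for p q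
  proof -
    have "Poly_Mapping.keys m \<subseteq> {1..n}" if m: "m \<in> Poly_Mapping.keys (p * q)" for m
    proof -
      obtain a b where ab: "m = a + b" "a \<in> Poly_Mapping.keys p" "b \<in> Poly_Mapping.keys q"
        using m Poly_Mapping.keys_mult[of p q] by blast
      have "Poly_Mapping.keys a \<subseteq> {1..n}" "Poly_Mapping.keys b \<subseteq> {1..n}"
        using ab(2,3) pq by (auto simp: mpoly_ring_def)
      then show ?thesis
        using Poly_Mapping.keys_add[of a b] ab(1) by blast
    qed
    then show ?thesis by (simp add: mpoly_ring_def)
  qed
  have R: "x \<oplus>\<^bsub>?R\<^esub> y = x + y" "x \<otimes>\<^bsub>?R\<^esub> y = x * y" "\<zero>\<^bsub>?R\<^esub> = 0" "\<one>\<^bsub>?R\<^esub> = 1" for x y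
    by (simp_all add: mpoly_ring_def)
  have zero: "0 \<in> carrier ?R" and one: "1 \<in> carrier ?R"
    by (simp_all add: mpoly_ring_def)
  show "abelian_group ?R"
  proof (rule abelian_groupI, unfold R)
    fix p assume "p \<in> carrier ?R"
    then show "\<exists>q\<in>carrier ?R. q + p = 0"
      using neg by (intro bexI[of _ "- p"]) simp_all
  qed (use add zero in \<open>simp_all add: add.assoc add.commute\<close>)
  show "Group.comm_monoid ?R"
    by (rule comm_monoidI, unfold R) (use mult one in \<open>simp_all add: mult.assoc mult.commute\<close>)
  show "(x \<oplus>\<^bsub>?R\<^esub> y) \<otimes>\<^bsub>?R\<^esub> z = x \<otimes>\<^bsub>?R\<^esub> z \<oplus>\<^bsub>?R\<^esub> y \<otimes>\<^bsub>?R\<^esub> z" for x y z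
    unfolding R by (rule distrib_right)
qed


section \<open>The Zariski topology over the ground field\<close>

definition poly_eval :: "'k::field mpoly \<Rightarrow> (nat \<Rightarrow> 'k alg_closure) \<Rightarrow> 'k alg_closure" where
  "poly_eval p x =
     (\<Sum>m \<in> Poly_Mapping.keys p. to_ac (Poly_Mapping.lookup p m) *
        (\<Prod>i \<in> Poly_Mapping.keys m. x i ^ Poly_Mapping.lookup m i))"

definition affine_space :: "nat \<Rightarrow> (nat \<Rightarrow> 'k::field alg_closure) set" where
  "affine_space n = {1..n} \<rightarrow>\<^sub>E UNIV"

definition zero_set :: "nat \<Rightarrow> 'k::field mpoly set \<Rightarrow> (nat \<Rightarrow> 'k alg_closure) set" where
  "zero_set n J = {x \<in> affine_space n. \<forall>p \<in> J. poly_eval p x = 0}"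

text \<open>
  Closed sets are cut out by polynomials over \<open>'k\<close>, whereas the points have coordinates
  in the algebraic closure.
\<close>

definition K_closed :: "nat \<Rightarrow> (nat \<Rightarrow> 'k::field alg_closure) set \<Rightarrow> bool" where
  "K_closed n Z \<longleftrightarrow> (\<exists>J. ideal J (mpoly_ring n :: 'k mpoly ring) \<and> Z = zero_set n J)"

definition K_irreducible :: "nat \<Rightarrow> (nat \<Rightarrow> 'k::field alg_closure) set \<Rightarrow> bool" where
  "K_irreducible n Z \<longleftrightarrow> K_closed n Z \<and> Z \<noteq> {} \<and>
     (\<forall>A B. K_closed n A \<and> K_closed n B \<and> Z = A \<union> B \<longrightarrow> Z = A \<or> Z = B)"

definition K_irreducible_component ::
  "nat \<Rightarrow> (nat \<Rightarrow> 'k::field alg_closure) set \<Rightarrow> (nat \<Rightarrow> 'k alg_closure) set \<Rightarrow> bool" where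
  "K_irreducible_component n V Z \<longleftrightarrow> K_irreducible n Z \<and> Z \<subseteq> V \<and>
     (\<forall>Y. K_irreducible n Y \<and> Z \<subseteq> Y \<and> Y \<subseteq> V \<longrightarrow> Y = Z)"

text \<open>
  Krull dimension: the supremum of the lengths \<open>m\<close> of chains \<open>Z\<^sub>0 \<subset> \<dots> \<subset> Z\<^sub>m\<close> of irreducible
  closed subsets. The value on the empty set, which has no irreducible components, is irrelevant.
\<close>

definition K_dim :: "nat \<Rightarrow> (nat \<Rightarrow> 'k::field alg_closure) set \<Rightarrow> enat" where
  "K_dim n Z = Sup {enat m | m. \<exists>C.
     (\<forall>i\<le>m. K_irreducible n (C i) \<and> C i \<subseteq> Z) \<and> (\<forall>i<m. C i \<subset> C (Suc i))}"

definition K_codim :: "nat \<Rightarrow> (nat \<Rightarrow> 'k::field alg_closure) set \<Rightarrow> enat" where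
  "K_codim n Z = enat n - K_dim n Z"

definition nondegenerate_locus ::
  "nat \<Rightarrow> nat \<Rightarrow> (nat \<Rightarrow> 'k::field mpoly) \<Rightarrow> (nat \<Rightarrow> 'k alg_closure) set" where
  "nondegenerate_locus n c f =
     \<Union> {Z. K_irreducible_component n
              (zero_set n (genideal (mpoly_ring n) (f ` {1..c}))) Z \<and>
            K_codim n Z = enat c}"


section \<open>Ideal quotients and saturation\<close>

definition ideal_quotient :: "('a, 'b) ring_scheme \<Rightarrow> 'a set \<Rightarrow> 'a set \<Rightarrow> 'a set" where
  "ideal_quotient R I J = {p \<in> carrier R. \<forall>q \<in> J. p \<otimes>\<^bsub>R\<^esub> q \<in> I}"

definition saturation :: "('a, 'b) ring_scheme \<Rightarrow> 'a set \<Rightarrow> 'a set \<Rightarrow> 'a set" where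
  "saturation R I J = (\<Union>k::nat. ideal_quotient R I (J [^]\<^bsub>ideals_set R\<^esub> k))"


section \<open>The algorithm\<close>

text \<open>
  Small-step semantics. \<open>Outer k J \<K>\<close> is the state at the head of the \<open>k\<close>-th round of the
  outer loop; \<open>Inner k J \<K> P\<close> is a state inside the inner loop of round \<open>k\<close>, where \<open>P\<close> contains
  those members of \<open>\<K>\<close> that have not been processed yet. The order in which the inner loop runs
  through \<open>\<K>\<close> is left open, so the relation is nondeterministic. The operations
  \<open>J : K\<close> and \<open>J : K\<^sup>\<infinity>\<close> are available as primitives.
\<close>

datatype 'a state =
    Outer nat "'a set" "'a set set"
  | Inner nat "'a set" "'a set set" "'a set set"
  | Returned "'a set"

inductive step ::
  "('a, 'b) ring_scheme \<Rightarrow> nat \<Rightarrow> (nat \<Rightarrow> 'a) \<Rightarrow> 'a state \<Rightarrow> 'a state \<Rightarrow> bool"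
  for R c f where
    round: "\<lbrakk>k \<le> c; H = saturation R J (genideal R {f k});
             \<K>' = insert (ideal_quotient R J H) \<K>\<rbrakk>
      \<Longrightarrow> step R c f (Outer k J \<K>) (Inner k (H <+>\<^bsub>R\<^esub> genideal R {f k}) \<K>' \<K>')"
  | saturate: "K \<in> P \<Longrightarrow> step R c f (Inner k J \<K> P) (Inner k (saturation R J K) \<K> (P - {K}))"
  | next_round: "step R c f (Inner k J \<K> {}) (Outer (Suc k) J \<K>)"
  | return: "c < k \<Longrightarrow> step R c f (Outer k J \<K>) (Returned J)"

definition initial_state :: "('a, 'b) ring_scheme \<Rightarrow> 'a state" where
  "initial_state R = Outer 1 (genideal R {\<zero>\<^bsub>R\<^esub>}) {}"

definition terminates :: "('s \<Rightarrow> 's \<Rightarrow> bool) \<Rightarrow> 's \<Rightarrow> bool" where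
  "terminates r s \<longleftrightarrow> (\<nexists>S :: nat \<Rightarrow> 's. S 0 = s \<and> (\<forall>i. r (S i) (S (Suc i))))"

end

theory Submission
  imports Defs
begin

text \<open>
  Let \<open>J\<^sub>k\<close> be the ideal after round \<open>k\<close>. Four properties are preserved by every operation.
  A prime containing \<open>J\<^sub>k\<close> has dimension at most \<open>n - k\<close>, because a prime containing
  \<open>J : f\<^sub>k\<^sup>\<infinity>\<close> and \<open>f\<^sub>k\<close> properly contains a prime over \<open>J\<close>. A prime containing \<open>f\<^sub>1, \<dots>, f\<^sub>k\<close>
  contains \<open>J\<^sub>k\<close> or a member of \<open>\<K>\<close>. A minimal prime of the ideal contains no member of \<open>\<K>\<close> that
  has been processed. Finally, at a component \<open>P\<close> of codimension \<open>c\<close>, \<open>J\<^sub>k\<close> and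
  \<open>\<langle>f\<^sub>1, \<dots>, f\<^sub>k\<rangle>\<close> have the same localization and no member of \<open>\<K>\<close> lies in \<open>P\<close>. The first three
  properties with the height theorem show that every component of the output is nondegenerate,
  the last one that every nondegenerate component survives.

  The last property rests on the fact that \<open>f\<^sub>1, \<dots>, f\<^sub>c\<close> is a regular sequence at \<open>P\<close>. The polynomials
  relating the remaining variables to a transcendence basis modulo \<open>P\<close> form a regular sequence of
  length \<open>n - dim P\<close> at \<open>P\<close>, so the Koszul homology of any \<open>f\<^sub>1, \<dots>, f\<^sub>m\<close> having \<open>P\<close> as a
  minimal prime vanishes above degree \<open>m - (n - dim P)\<close>. This yields both the height theorem
  \<open>n - dim P \<le> m\<close> and, in the case of equality, regularity.
\<close>

section \<open>Ideals, primes and local membership\<close>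

text \<open>The zero set of \<open>J : H\<close> is the locus where \<open>f_k\<close> is a zero
  divisor modulo \<open>J\<close>, so where the equation fails to cut properly. Pieces of later
  ideals inside this locus can have the expected dimension without being components of the system,
  and each round can create new ones; this is why every later ideal is saturated by all of
  \<open>\<K>\<close> again. The obstacle is that this locus is not determined by the zero set of
  \<open>J\<close>: an embedded prime of \<open>J\<close> that contains \<open>f_k\<close> and lies
  in \<open>P\<close> would place the component of \<open>P\<close> inside it, and the saturation
  would delete a nondegenerate component. An invariant about zero sets is therefore too weak;
  \<open>J\<close> has to be known as an ideal locally at \<open>P\<close>, and regularity of the
  sequence is what rules out such embedded primes. No quotient ring or local ring is formed. A ring
  is a subset of a type, a congruence is membership of a difference, and an identity in the local
  ring at \<open>P\<close> is expressed by a multiplier outside \<open>P\<close>.\<close>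

locale carrier_ring =
  fixes C :: "'a::comm_ring_1 set"
  assumes zero_C [simp]: "0 \<in> C" and one_C [simp]: "1 \<in> C"
    and add_C [simp]: "a \<in> C \<Longrightarrow> b \<in> C \<Longrightarrow> a + b \<in> C"
    and mult_C [simp]: "a \<in> C \<Longrightarrow> b \<in> C \<Longrightarrow> a * b \<in> C"
    and uminus_C [simp]: "a \<in> C \<Longrightarrow> - a \<in> C"
begin

lemma diff_C [simp]: "a \<in> C \<Longrightarrow> b \<in> C \<Longrightarrow> a - b \<in> C"
  using add_C[of a "- b"] by simp

lemma power_C [simp]: "a \<in> C \<Longrightarrow> a ^ k \<in> C"
  by (induction k) auto

lemma sum_C: "(\<And>i. i \<in> A \<Longrightarrow> g i \<in> C) \<Longrightarrow> (\<Sum>i\<in>A. g i) \<in> C"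
  by (induction A rule: infinite_finite_induct) auto

definition idl :: "'a set \<Rightarrow> bool" where
  "idl I \<longleftrightarrow> I \<subseteq> C \<and> 0 \<in> I \<and> (\<forall>a\<in>I. \<forall>b\<in>I. a + b \<in> I) \<and> (\<forall>a\<in>I. \<forall>r\<in>C. r * a \<in> I)"

lemma idlI:
  assumes "I \<subseteq> C" "0 \<in> I" "\<And>a b. a \<in> I \<Longrightarrow> b \<in> I \<Longrightarrow> a + b \<in> I"
    "\<And>a r. a \<in> I \<Longrightarrow> r \<in> C \<Longrightarrow> r * a \<in> I"
  shows "idl I"
  using assms unfolding idl_def by blast

lemma idlD:
  assumes "idl I"
  shows "\<And>a. a \<in> I \<Longrightarrow> a \<in> C" "0 \<in> I" "\<And>a b. a \<in> I \<Longrightarrow> b \<in> I \<Longrightarrow> a + b \<in> I"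
    "\<And>a r. a \<in> I \<Longrightarrow> r \<in> C \<Longrightarrow> r * a \<in> I" "\<And>a r. a \<in> I \<Longrightarrow> r \<in> C \<Longrightarrow> a * r \<in> I"
    "\<And>a. a \<in> I \<Longrightarrow> - a \<in> I" "\<And>a b. a \<in> I \<Longrightarrow> b \<in> I \<Longrightarrow> a - b \<in> I"
proof -
  show 1: "\<And>a. a \<in> I \<Longrightarrow> a \<in> C" "0 \<in> I" "\<And>a b. a \<in> I \<Longrightarrow> b \<in> I \<Longrightarrow> a + b \<in> I"
    "\<And>a r. a \<in> I \<Longrightarrow> r \<in> C \<Longrightarrow> r * a \<in> I"
    using assms unfolding idl_def by blast+
  then show "\<And>a r. a \<in> I \<Longrightarrow> r \<in> C \<Longrightarrow> a * r \<in> I"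
    by (simp add: mult.commute)
  show 2: "- a \<in> I" if "a \<in> I" for a
    using 1(4)[OF that, of "-1"] by simp
  show "\<And>a b. a \<in> I \<Longrightarrow> b \<in> I \<Longrightarrow> a - b \<in> I"
    using 1(3) 2 by (metis add_uminus_conv_diff)
qed

lemma idl_sum: "idl I \<Longrightarrow> (\<And>i. i \<in> A \<Longrightarrow> g i \<in> I) \<Longrightarrow> (\<Sum>i\<in>A. g i) \<in> I"
  by (induction A rule: infinite_finite_induct) (auto simp: idlD)

lemma idl_C: "idl C"
  by (rule idlI) auto

lemma idl_0: "idl {0}"
  by (rule idlI) auto

lemma idl_add_cancel: "idl I \<Longrightarrow> a - b \<in> I \<Longrightarrow> a \<in> I \<longleftrightarrow> b \<in> I"
  using idlD(3)[of I "a - b" b] idlD(7)[of I a "a - b"] by auto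

lemma idl_colon:
  assumes "idl I" "x \<in> C"
  shows "idl {a \<in> C. x * a \<in> I}"
proof (rule idlI)
  fix a r assume "a \<in> {a \<in> C. x * a \<in> I}" "r \<in> C"
  then show "r * a \<in> {a \<in> C. x * a \<in> I}"
    using idlD(4)[OF assms(1), of "x * a" r] by (simp add: mult.left_commute)
qed (use assms idlD[OF assms(1)] in \<open>auto simp: distrib_left\<close>)

definition gen :: "'a set \<Rightarrow> 'a set" where
  "gen U = {a. \<forall>I. idl I \<and> U \<subseteq> I \<longrightarrow> a \<in> I}"

lemma gen_superset: "U \<subseteq> gen U"
  unfolding gen_def by blast

lemma gen_minimal: "idl I \<Longrightarrow> U \<subseteq> I \<Longrightarrow> gen U \<subseteq> I"
  unfolding gen_def by blast

lemma idl_gen: "U \<subseteq> C \<Longrightarrow> idl (gen U)"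
proof (rule idlI)
  assume "U \<subseteq> C"
  then show "gen U \<subseteq> C" using idl_C unfolding gen_def by blast
qed (auto simp: gen_def idlD)

lemma gen_mono: "U \<subseteq> Y \<Longrightarrow> gen U \<subseteq> gen Y"
  unfolding gen_def by blast

lemma gen_idl: "idl I \<Longrightarrow> gen I = I"
  by (meson gen_minimal gen_superset order_refl subset_antisym)

lemma gen_insert:
  assumes "idl I" "x \<in> C"
  shows "gen (insert x I) = {i + r * x | i r. i \<in> I \<and> r \<in> C}" (is "_ = ?S")
proof
  note [simp] = idlD[OF assms(1)]
  have mem: "i + r * x \<in> ?S" if "i \<in> I" "r \<in> C" for i r
    using that by blast
  have "idl ?S"
  proof (rule idlI)
    show "?S \<subseteq> C" using assms by auto
    show "0 \<in> ?S" using mem[of 0 0] by simp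
    fix a b assume "a \<in> ?S" "b \<in> ?S"
    then obtain i r j q where *: "a = i + r * x" "b = j + q * x" "i \<in> I" "r \<in> C" "j \<in> I" "q \<in> C"
      by blast
    have "a + b = (i + j) + (r + q) * x" using * by (simp add: algebra_simps)
    moreover have "i + j \<in> I" "r + q \<in> C" using * by simp_all
    ultimately show "a + b \<in> ?S" by blast
  next
    fix a s assume "a \<in> ?S" "s \<in> C"
    then obtain i r where *: "a = i + r * x" "i \<in> I" "r \<in> C"
      by blast
    have "s * a = s * i + (s * r) * x" using * by (simp add: algebra_simps)
    moreover have "s * i \<in> I" "s * r \<in> C" using * \<open>s \<in> C\<close> by simp_all
    ultimately show "s * a \<in> ?S" by blast
  qed
  moreover have "insert x I \<subseteq> ?S"
    using mem[of 0 1] mem[of _ 0] by auto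
  ultimately show "gen (insert x I) \<subseteq> ?S"
    by (rule gen_minimal)
  have "idl (gen (insert x I))"
    using assms by (intro idl_gen) auto
  then show "?S \<subseteq> gen (insert x I)"
    using gen_superset[of "insert x I"] idlD(3,4) by blast
qed

lemma gen_gen_Un: "U \<subseteq> C \<Longrightarrow> Y \<subseteq> C \<Longrightarrow> gen (gen U \<union> Y) = gen (U \<union> Y)"
proof (intro equalityI gen_minimal idl_gen)
  assume UY: "U \<subseteq> C" "Y \<subseteq> C"
  then show "U \<union> Y \<subseteq> C" by blast
  show "gen U \<union> Y \<subseteq> gen (U \<union> Y)"
    using gen_mono[of U "U \<union> Y"] gen_superset[of "U \<union> Y"] by blast
  show "gen U \<union> Y \<subseteq> C" using UY gen_minimal[OF idl_C] by blast
  show "U \<union> Y \<subseteq> gen (gen U \<union> Y)"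
    using gen_superset[of U] gen_superset[of "gen U \<union> Y"] by blast
qed

lemma gen_Un_zero: "U \<subseteq> C \<Longrightarrow> gen ({0} \<union> U) = gen U"
  using gen_superset[of U] gen_superset[of "{0} \<union> U"] idl_gen[of U] idl_gen[of "{0} \<union> U"]
  by (intro equalityI gen_minimal) (auto simp: idlD)

definition prm :: "'a set \<Rightarrow> bool" where
  "prm P \<longleftrightarrow> idl P \<and> 1 \<notin> P \<and> (\<forall>a\<in>C. \<forall>b\<in>C. a * b \<in> P \<longrightarrow> a \<in> P \<or> b \<in> P)"

lemma prmD:
  assumes "prm P"
  shows "idl P" "1 \<notin> P" "\<And>a b. a \<in> C \<Longrightarrow> b \<in> C \<Longrightarrow> a * b \<in> P \<Longrightarrow> a \<in> P \<or> b \<in> P"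
  using assms unfolding prm_def by blast+

lemma prm_mult_iff: "prm P \<Longrightarrow> a \<in> C \<Longrightarrow> b \<in> C \<Longrightarrow> a * b \<in> P \<longleftrightarrow> a \<in> P \<or> b \<in> P"
  using prmD idlD(4,5) by metis

lemma prm_power: "prm P \<Longrightarrow> a \<in> C \<Longrightarrow> a ^ k \<in> P \<Longrightarrow> a \<in> P"
proof (induction k)
  case 0
  then show ?case using prmD(2) by simp
next
  case (Suc k)
  then show ?case using prmD(3)[of P a "a ^ k"] by auto
qed

text \<open>For a prime \<open>P\<close> this is the contraction to \<open>C\<close> of the ideal
  that \<open>I\<close> generates in the local ring at \<open>P\<close>.\<close>

definition loc :: "'a set \<Rightarrow> 'a set \<Rightarrow> 'a set" where
  "loc P I = {a \<in> C. \<exists>s \<in> C - P. s * a \<in> I}"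

lemma locI: "a \<in> C \<Longrightarrow> s \<in> C \<Longrightarrow> s \<notin> P \<Longrightarrow> s * a \<in> I \<Longrightarrow> a \<in> loc P I"
  unfolding loc_def by blast

lemma locE:
  assumes "a \<in> loc P I"
  obtains s where "a \<in> C" "s \<in> C" "s \<notin> P" "s * a \<in> I"
  using assms unfolding loc_def by blast

lemma loc_C: "loc P I \<subseteq> C"
  unfolding loc_def by blast

lemma loc_mono: "I \<subseteq> J \<Longrightarrow> loc P I \<subseteq> loc P J"
  unfolding loc_def by blast

lemma idl_loc:
  assumes P: "prm P" and I: "idl I"
  shows "idl (loc P I)"
proof (rule idlI)
  show "loc P I \<subseteq> C" by (rule loc_C)
  show "0 \<in> loc P I" by (rule locI[of _ 1]) (use P I in \<open>auto simp: prmD idlD\<close>)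
next
  fix a b assume "a \<in> loc P I" "b \<in> loc P I"
  then obtain s t where s: "a \<in> C" "s \<in> C" "s \<notin> P" "s * a \<in> I" "b \<in> C" "t \<in> C" "t \<notin> P" "t * b \<in> I"
    by (elim locE) blast
  have "(s * t) * (a + b) = t * (s * a) + s * (t * b)" by (simp add: algebra_simps)
  then have "(s * t) * (a + b) \<in> I" using s idlD[OF I] by simp
  then show "a + b \<in> loc P I" by (intro locI[of _ "s * t"]) (use s prmD(3)[OF P] in auto)
next
  fix a r assume "a \<in> loc P I" and r: "r \<in> C"
  then obtain s where s: "a \<in> C" "s \<in> C" "s \<notin> P" "s * a \<in> I"
    by (elim locE)
  have "s * (r * a) = r * (s * a)" by (simp add: algebra_simps)
  then have "s * (r * a) \<in> I" using s r idlD(4)[OF I] by metis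
  then show "r * a \<in> loc P I" using s r by (intro locI[of _ s]) auto
qed

lemma loc_superset: "prm P \<Longrightarrow> idl I \<Longrightarrow> I \<subseteq> loc P I"
  by (auto intro!: locI[of _ 1] simp: prmD idlD)

lemma loc_loc: "prm P \<Longrightarrow> loc P (loc P I) \<subseteq> loc P I"
proof
  fix a assume P: "prm P" and "a \<in> loc P (loc P I)"
  then obtain s t where "a \<in> C" "s \<in> C" "s \<notin> P" "t \<in> C" "t \<notin> P" "t * (s * a) \<in> I"
    by (elim locE) blast
  then show "a \<in> loc P I"
    using prmD(3)[OF P] by (intro locI[of _ "t * s"]) (auto simp: mult.assoc)
qed

lemma loc_cancel: "prm P \<Longrightarrow> a \<in> C \<Longrightarrow> s \<in> C \<Longrightarrow> s \<notin> P \<Longrightarrow> s * a \<in> loc P I \<Longrightarrow> a \<in> loc P I"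
  using loc_loc locI by blast

lemma loc_subset_prm: "prm P \<Longrightarrow> I \<subseteq> P \<Longrightarrow> loc P I \<subseteq> P"
  using prmD(3) by (auto elim!: locE)

definition minimal_over :: "'a set \<Rightarrow> 'a set \<Rightarrow> bool" where
  "minimal_over I P \<longleftrightarrow> prm P \<and> I \<subseteq> P \<and> (\<forall>Q. prm Q \<and> I \<subseteq> Q \<and> Q \<subseteq> P \<longrightarrow> Q = P)"

end

section \<open>Noetherian rings: primes avoiding families, uniform denominators, Krull's
  intersection theorem\<close>

locale noetherian_carrier_ring = carrier_ring +
  assumes maximal_ideal_exists:
    "F \<noteq> {} \<Longrightarrow> (\<And>I. I \<in> F \<Longrightarrow> idl I) \<Longrightarrow> \<exists>M\<in>F. \<forall>I\<in>F. M \<subseteq> I \<longrightarrow> I = M"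
begin

text \<open>The classical argument that an ideal maximal among those missing a multiplicative set is
  prime, with sets in place of elements: if \<open>a\<close> and \<open>b\<close> lie outside
  \<open>P\<close>, members of \<open>\<M>\<close> lie in \<open>(a) + P\<close> and in
  \<open>(b) + P\<close>, and a third member inside their products falls into \<open>P\<close> once
  \<open>a * b\<close> does. Sets serve the saturation by ideals with several generators, the
  maximality clause serves the Nullstellensatz.\<close>

lemma prime_avoiding:
  assumes I: "idl I"
    and \<M>: "\<M> \<noteq> {}" "\<And>U. U \<in> \<M> \<Longrightarrow> U \<subseteq> C"
      "\<And>U Y. U \<in> \<M> \<Longrightarrow> Y \<in> \<M> \<Longrightarrow> (\<exists>Z\<in>\<M>. Z \<subseteq> {x * y | x y. x \<in> U \<and> y \<in> Y})"
      "\<And>U. U \<in> \<M> \<Longrightarrow> \<not> U \<subseteq> I"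
  obtains P where "prm P" "I \<subseteq> P" "\<And>U. U \<in> \<M> \<Longrightarrow> \<not> U \<subseteq> P"
    "\<And>Q. idl Q \<Longrightarrow> P \<subset> Q \<Longrightarrow> \<exists>U\<in>\<M>. U \<subseteq> Q"
proof -
  let ?F = "{Q. idl Q \<and> I \<subseteq> Q \<and> (\<forall>U\<in>\<M>. \<not> U \<subseteq> Q)}"
  have "\<exists>M\<in>?F. \<forall>I\<in>?F. M \<subseteq> I \<longrightarrow> I = M"
    by (rule maximal_ideal_exists) (use I \<M>(4) in auto)
  then obtain P where PF: "P \<in> ?F" and maxF: "\<forall>I\<in>?F. P \<subseteq> I \<longrightarrow> I = P"
    by (elim bexE)
  have nP: "\<not> U \<subseteq> P" if "U \<in> \<M>" for U
    using PF that by simp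
  have P: "idl P" "I \<subseteq> P"
    using PF by simp_all
  have max: "\<exists>U\<in>\<M>. U \<subseteq> Q" if Q: "idl Q" "P \<subset> Q" for Q
  proof (rule ccontr)
    assume "\<not> (\<exists>U\<in>\<M>. U \<subseteq> Q)"
    then have "Q \<in> ?F" using Q P(2) by auto
    then show False using maxF Q(2) by auto
  qed
  have "prm P"
    unfolding prm_def
  proof (intro conjI ballI impI)
    show "idl P" by fact
    show "1 \<notin> P"
    proof
      assume "1 \<in> P"
      then have "C \<subseteq> P" using idlD(4)[OF P(1), of 1] by auto
      moreover obtain U where "U \<in> \<M>" using \<M>(1) by auto
      ultimately show False using \<M>(2) nP by (meson subset_trans)
    qed
    fix a b assume ab: "a \<in> C" "b \<in> C" "a * b \<in> P"
    show "a \<in> P \<or> b \<in> P"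
    proof (rule ccontr)
      assume "\<not> (a \<in> P \<or> b \<in> P)"
      then have n: "P \<subset> gen (insert a P)" "P \<subset> gen (insert b P)"
        using gen_superset[of "insert a P"] gen_superset[of "insert b P"] by auto
      have "idl (gen (insert a P))" "idl (gen (insert b P))"
        using ab idlD(1)[OF P(1)] by (auto intro!: idl_gen)
      then obtain U Y where UY: "U \<in> \<M>" "Y \<in> \<M>" "U \<subseteq> gen (insert a P)" "Y \<subseteq> gen (insert b P)"
        using max[OF _ n(1)] max[OF _ n(2)] by auto
      obtain Z where Z: "Z \<in> \<M>" "Z \<subseteq> {x * y | x y. x \<in> U \<and> y \<in> Y}"
        using \<M>(3)[OF UY(1,2)] by (elim bexE)
      have "Z \<subseteq> P"
      proof
        fix z assume "z \<in> Z"
        then obtain x y where z: "z = x * y" "x \<in> U" "y \<in> Y" using Z(2) by auto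
        then have "x \<in> gen (insert a P)" "y \<in> gen (insert b P)" "y \<in> C"
          using UY(3,4) \<M>(2)[OF UY(2)] by auto
        then obtain i r j q where *: "x = i + r * a" "i \<in> P" "r \<in> C" "y = j + q * b" "j \<in> P" "q \<in> C"
          unfolding gen_insert[OF P(1) ab(1)] gen_insert[OF P(1) ab(2)] by auto
        have "z = i * y + (r * a) * j + (r * q) * (a * b)"
          unfolding z(1) *(1,4) by (simp add: algebra_simps)
        moreover have "i * y \<in> P" using idlD(5)[OF P(1)] * \<open>y \<in> C\<close> by simp
        moreover have "(r * a) * j \<in> P" "(r * q) * (a * b) \<in> P"
          using idlD(4)[OF P(1)] * ab by simp_all
        ultimately show "z \<in> P" using idlD(3)[OF P(1)] by simp
      qed
      then show False using Z nP by simp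
    qed
  qed
  then show thesis using that[of P] P nP max by simp
qed

lemma prime_avoiding_elements:
  assumes I: "idl I" and M: "M \<subseteq> C" "1 \<in> M" "\<And>x y. x \<in> M \<Longrightarrow> y \<in> M \<Longrightarrow> x * y \<in> M" "M \<inter> I = {}"
  obtains P where "prm P" "I \<subseteq> P" "P \<inter> M = {}" "\<And>Q. idl Q \<Longrightarrow> P \<subset> Q \<Longrightarrow> Q \<inter> M \<noteq> {}"
proof -
  let ?\<M> = "(\<lambda>x. {x}) ` M"
  have ne: "?\<M> \<noteq> {}" and sub: "\<And>U. U \<in> ?\<M> \<Longrightarrow> U \<subseteq> C" and nI: "\<And>U. U \<in> ?\<M> \<Longrightarrow> \<not> U \<subseteq> I"
    using M(1,2,4) by auto
  have mul: "\<exists>Z\<in>?\<M>. Z \<subseteq> {x * y |x y. x \<in> U \<and> y \<in> Y}" if UY: "U \<in> ?\<M>" "Y \<in> ?\<M>" for U Y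
  proof -
    obtain x y where "U = {x}" "Y = {y}" "x \<in> M" "y \<in> M" using UY by blast
    then show ?thesis using M(3)[of x y] by auto
  qed
  obtain P where P: "prm P" "I \<subseteq> P" "\<And>U. U \<in> ?\<M> \<Longrightarrow> \<not> U \<subseteq> P"
    "\<And>Q. idl Q \<Longrightarrow> P \<subset> Q \<Longrightarrow> \<exists>U\<in>?\<M>. U \<subseteq> Q"
    using prime_avoiding[OF I ne sub mul nI] by metis
  have "P \<inter> M = {}" using P(3) by auto
  moreover have "Q \<inter> M \<noteq> {}" if "idl Q" "P \<subset> Q" for Q
    using P(4)[OF that] by auto
  ultimately show thesis using that P(1,2) by blast
qed

text \<open>In the local ring at \<open>P\<close> the radical of \<open>I\<close> is
  \<open>P\<close>. If no power of \<open>g\<close> became a member, a prime over \<open>I\<close>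
  missing all \<open>s * g ^ N\<close> with \<open>s\<close> outside \<open>P\<close> would lie in
  \<open>P\<close> and omit \<open>g\<close>.\<close>

lemma minimal_over_nilpotent:
  assumes P: "minimal_over I P" and I: "idl I" and g: "g \<in> P"
  shows "\<exists>N. g ^ N \<in> loc P I"
proof (rule ccontr)
  assume no: "\<nexists>N. g ^ N \<in> loc P I"
  have pP: "prm P" and IP: "I \<subseteq> P" using P unfolding minimal_over_def by auto
  have gC: "g \<in> C" using idlD(1)[OF prmD(1)[OF pP] g] .
  let ?M = "{s * g ^ N | s N. s \<in> C \<and> s \<notin> P}"
  have "?M \<inter> I = {}"
    using no gC by (auto simp: loc_def)
  then obtain Q where Q: "prm Q" "I \<subseteq> Q" "Q \<inter> ?M = {}"
  proof (rule prime_avoiding_elements[OF I, rotated 3])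
    show "?M \<subseteq> C" using gC by auto
    have "1 * g ^ 0 \<in> ?M" using prmD(2)[OF pP] one_C by blast
    then show "1 \<in> ?M" by simp
    fix x y assume "x \<in> ?M" "y \<in> ?M"
    then obtain s N t M where *: "x = s * g ^ N" "y = t * g ^ M" "s \<in> C" "s \<notin> P" "t \<in> C" "t \<notin> P"
      by blast
    then show "x * y \<in> ?M"
      using prmD(3)[OF pP] by (auto intro!: exI[of _ "s * t"] exI[of _ "N + M"] simp: power_add)
  qed
  have "1 * g ^ 1 \<in> ?M" using prmD(2)[OF pP] one_C by blast
  then have "g \<notin> Q" using Q by auto
  moreover have "Q \<subseteq> P"
  proof
    fix s assume s: "s \<in> Q"
    then have "s * g ^ 0 \<notin> ?M" using Q by auto
    then show "s \<in> P" using s idlD(1)[OF prmD(1)[OF Q(1)]] by blast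
  qed
  ultimately show False using P Q g unfolding minimal_over_def by blast
qed

text \<open>One denominator serves the whole ideal: the quotient of \<open>I\<close> by
  \<open>s * t\<close> contains those by \<open>s\<close> and by \<open>t\<close>, so a maximal
  quotient by an element outside \<open>P\<close> contains all others.\<close>

lemma loc_eq_colon:
  assumes P: "prm P" and I: "idl I"
  obtains s where "s \<in> C" "s \<notin> P" "\<And>a. a \<in> loc P I \<Longrightarrow> s * a \<in> I"
proof -
  define col where "col s = {a \<in> C. s * a \<in> I}" for s
  have "\<exists>M\<in>col ` (C - P). \<forall>I\<in>col ` (C - P). M \<subseteq> I \<longrightarrow> I = M"
  proof (rule maximal_ideal_exists)
    show "col ` (C - P) \<noteq> {}" using prmD(2)[OF P] one_C by blast
    fix J assume "J \<in> col ` (C - P)"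
    then obtain s where s: "J = col s" "s \<in> C" by blast
    then show "idl J" unfolding col_def by (simp add: idl_colon[OF I])
  qed
  then obtain s where s: "s \<in> C" "s \<notin> P" and max: "\<And>t. t \<in> C \<Longrightarrow> t \<notin> P \<Longrightarrow> col s \<subseteq> col t \<Longrightarrow> col t = col s"
    by auto
  have "s * a \<in> I" if a: "a \<in> loc P I" for a
  proof -
    obtain t where t: "a \<in> C" "t \<in> C" "t \<notin> P" "t * a \<in> I" using a by (elim locE)
    have "(s * t) * b = t * (s * b)" "(s * t) * b = s * (t * b)" for b by (simp_all add: ac_simps)
    then have "s * t * b \<in> I" if "s * b \<in> I \<or> t * b \<in> I" for b
      using that idlD(4)[OF I] s(1) t(2) by metis
    then have "col s \<subseteq> col (s * t)" "a \<in> col (s * t)"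
      using t s by (auto simp: col_def)
    then show ?thesis
      using max[of "s * t"] s t prmD(3)[OF P] by (auto simp: col_def)
  qed
  then show thesis using that s by blast
qed

text \<open>Krull's intersection theorem for the powers of one element, locally modulo
  \<open>J\<close>. With a single element Nakayama's lemma is only invoked for cyclic modules, where
  it is an explicit computation.\<close>

lemma krull_intersection_power:
  assumes P: "prm P" and J: "idl J" and x: "x \<in> P"
    and a: "\<And>t::nat. a \<in> loc P (gen (insert (x ^ t) J))"
  shows "a \<in> loc P J"
proof -
  have xC: "x \<in> C" using x idlD(1)[OF prmD(1)[OF P]] by simp
  define J' where "J' t = {b \<in> C. x ^ t * b \<in> J}" for t :: nat
  have idlJ': "idl (J' t)" for t
    unfolding J'_def using xC by (simp add: idl_colon[OF J])
  have J'mono: "J' t \<subseteq> J' (t + k)" for t k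
  proof
    fix b assume "b \<in> J' t"
    then show "b \<in> J' (t + k)"
      using idlD(4)[OF J, of "x ^ t * b" "x ^ k"] xC by (simp add: J'_def power_add ac_simps)
  qed
  have "\<exists>M\<in>range J'. \<forall>I\<in>range J'. M \<subseteq> I \<longrightarrow> I = M"
    by (rule maximal_ideal_exists) (use idlJ' in auto)
  then obtain t0 where t0: "\<And>t. J' t0 \<subseteq> J' t \<Longrightarrow> J' t = J' t0" by auto
  define I where "I = J' t0"
  have I: "idl I" unfolding I_def by (rule idlJ')
  have cancel: "b \<in> I" if "b \<in> C" "x ^ k * b \<in> I" for b k
  proof -
    have "b \<in> J' (t0 + k)"
      using that by (auto simp: I_def J'_def power_add mult.assoc)
    then show ?thesis using t0[OF J'mono] unfolding I_def by blast
  qed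
  \<comment> \<open>The elements that, locally modulo \<open>I\<close>, lie in every power of
    \<open>(x)\<close>. Since the stable quotient makes \<open>x\<close> cancellable modulo
    \<open>I\<close>, dividing such an element by \<open>x\<close> gives another one.\<close>
  define N where "N = {b \<in> C. \<forall>t::nat. \<exists>s c. s \<in> C \<and> s \<notin> P \<and> c \<in> C \<and> s * b - x ^ t * c \<in> I}"
  have N_sub: "N \<subseteq> loc P I"
  proof (rule ccontr)
    assume "\<not> N \<subseteq> loc P I"
    define L where "L b = loc P (gen (insert b I))" for b
    define F where "F = L ` (N - loc P I)"
    have idlF: "idl (gen (insert b I))" if "b \<in> C" for b
      using that idlD(1)[OF I] by (intro idl_gen) auto
    have "\<exists>M\<in>F. \<forall>I\<in>F. M \<subseteq> I \<longrightarrow> I = M"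
    proof (rule maximal_ideal_exists)
      show "F \<noteq> {}" using \<open>\<not> N \<subseteq> loc P I\<close> by (auto simp: F_def)
      show "idl K" if "K \<in> F" for K
        using that idl_loc[OF P idlF] by (auto simp: F_def L_def N_def)
    qed
    \<comment> \<open>By maximality, the quotient \<open>b1\<close> of \<open>b\<close> by
      \<open>x\<close> generates locally the same ideal over \<open>I\<close> as
      \<open>b\<close>.\<close>
    then obtain b where b: "b \<in> N" "b \<notin> loc P I"
      and max: "\<forall>b'\<in>N - loc P I. L b \<subseteq> L b' \<longrightarrow>
        L b' = L b"
      unfolding F_def by auto
    obtain s b1 where b1: "s \<in> C" "s \<notin> P" "b1 \<in> C" "s * b - x * b1 \<in> I"
      using b(1) unfolding N_def by (auto dest: spec[of _ "1"])
    have bC: "b \<in> C" using b by (simp add: N_def)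
    have "b1 \<in> N"
      unfolding N_def
    proof (intro CollectI conjI allI)
      fix t :: nat
      obtain s' c where c: "s' \<in> C" "s' \<notin> P" "c \<in> C" "s' * b - x ^ Suc t * c \<in> I"
        using b(1) unfolding N_def by blast
      have "s * (s' * b - x ^ Suc t * c) - s' * (s * b - x * b1) \<in> I"
        using idlD(4,7)[OF I] c b1 by simp
      then have "x ^ 1 * (s' * b1 - x ^ t * (s * c)) \<in> I"
        by (simp add: algebra_simps)
      then show "\<exists>s c. s \<in> C \<and> s \<notin> P \<and> c \<in> C \<and> s * b1 - x ^ t * c \<in> I"
        using cancel[of "s' * b1 - x ^ t * (s * c)" 1] b1 c xC
        by (intro exI[of _ s'] exI[of _ "s * c"]) auto
    qed (fact b1)
    have b1loc: "b1 \<notin> loc P I"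
    proof
      assume "b1 \<in> loc P I"
      then have "x * b1 \<in> loc P I" using idlD(4)[OF idl_loc[OF P I]] xC by simp
      moreover have "s * b - x * b1 \<in> loc P I" using b1 loc_superset[OF P I] by auto
      ultimately have "s * b \<in> loc P I"
        using idl_add_cancel[OF idl_loc[OF P I], of "s * b" "x * b1"] by simp
      then show False using loc_cancel[OF P bC b1(1,2)] b(2) by simp
    qed
    have "b \<in> L b1"
    proof -
      have "(s * b - x * b1) + x * b1 \<in> gen (insert b1 I)"
        unfolding gen_insert[OF I b1(3)] using b1(4) xC by (intro CollectI exI conjI) (rule refl)
      then show ?thesis unfolding L_def using b1 bC by (intro locI[of _ s]) auto
    qed
    moreover have "I \<subseteq> L b1"
      using loc_superset[OF P idlF[OF b1(3)]] gen_superset[of "insert b1 I"] unfolding L_def by auto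
    ultimately have "gen (insert b I) \<subseteq> L b1"
      using idl_loc[OF P idlF[OF b1(3)]] unfolding L_def by (intro gen_minimal) auto
    then have "L b \<subseteq> L b1"
      unfolding L_def using loc_mono loc_loc[OF P] by (meson subset_trans)
    then have "L b1 = L b"
      using max \<open>b1 \<in> N\<close> b1loc by simp
    moreover have "b1 \<in> L b1"
      using loc_superset[OF P idlF[OF b1(3)]] gen_superset[of "insert b1 I"] unfolding L_def by auto
    ultimately obtain t where t: "t \<in> C" "t \<notin> P" "t * b1 \<in> gen (insert b I)"
      by (auto simp: L_def elim: locE)
    then obtain i r where ir: "t * b1 = i + r * b" "i \<in> I" "r \<in> C"
      unfolding gen_insert[OF I bC] by auto
    \<comment> \<open>Nakayama by hand: up to units \<open>b1\<close> is a multiple of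
      \<open>b\<close> and \<open>b\<close> equals \<open>x * b1\<close>, and
      \<open>s * t - r * x\<close> is outside \<open>P\<close> because \<open>x\<close> is in
      \<open>P\<close>.\<close>
    have "(s * t - r * x) * b1 = s * (t * b1) - r * x * b1"
      by (simp add: algebra_simps)
    also have "\<dots> = s * i + r * (s * b - x * b1)"
      unfolding ir(1) by (simp add: algebra_simps)
    also have "\<dots> \<in> I"
      using ir b1 idlD(3,4)[OF I] by simp
    finally have "(s * t - r * x) * b1 \<in> I" .
    moreover have "s * t - r * x \<notin> P"
    proof
      assume "s * t - r * x \<in> P"
      moreover have "r * x \<in> P" using x ir idlD(4)[OF prmD(1)[OF P]] by simp
      ultimately have "s * t \<in> P" using idl_add_cancel[OF prmD(1)[OF P], of "s * t" "r * x"] by simp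
      then show False using prmD(3)[OF P b1(1) t(1)] t b1 by simp
    qed
    ultimately have "b1 \<in> loc P I"
      using ir xC b1 t by (intro locI[of _ "s * t - r * x"]) auto
    then show False using b1loc by simp
  qed
  have aC: "a \<in> C" using a[of 0] loc_C by auto
  have step: "\<exists>s c. s \<in> C \<and> s \<notin> P \<and> c \<in> C \<and> s * a - x ^ t * c \<in> J" for t
  proof -
    obtain s where s: "s \<in> C" "s \<notin> P" "s * a \<in> gen (insert (x ^ t) J)" using a[of t] by (elim locE)
    then obtain i r where "s * a = i + r * x ^ t" "i \<in> J" "r \<in> C"
      using gen_insert[OF J, of "x ^ t"] xC by auto
    then show ?thesis using s by (intro exI[of _ s] exI[of _ r]) (auto simp: mult.commute)
  qed
  obtain s0 c0 where s0: "s0 \<in> C" "s0 \<notin> P" "c0 \<in> C" "s0 * a - x ^ t0 * c0 \<in> J"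
    using step by blast
  have "c0 \<in> N"
    unfolding N_def
  proof (intro CollectI conjI allI)
    fix t :: nat
    obtain s c where s: "s \<in> C" "s \<notin> P" "c \<in> C" "s * a - x ^ (t0 + t) * c \<in> J"
      using step by blast
    have "s0 * (s * a - x ^ (t0 + t) * c) - s * (s0 * a - x ^ t0 * c0) \<in> J"
      using s s0 idlD(4,7)[OF J] by simp
    then have "x ^ t0 * (s * c0 - x ^ t * (s0 * c)) \<in> J"
      by (simp add: algebra_simps power_add)
    then show "\<exists>s c. s \<in> C \<and> s \<notin> P \<and> c \<in> C \<and> s * c0 - x ^ t * c \<in> I"
      using s s0 xC by (intro exI[of _ s] exI[of _ "s0 * c"]) (simp add: I_def J'_def)
  qed (use s0 in auto)
  then have "c0 \<in> loc P I" using N_sub by auto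
  then have "x ^ t0 * c0 \<in> loc P J"
  proof -
    obtain s where "s \<in> C" "s \<notin> P" "s * c0 \<in> I" using \<open>c0 \<in> loc P I\<close> by (elim locE)
    then show ?thesis using xC s0
      by (intro locI[of _ s]) (auto simp: I_def J'_def mult.left_commute)
  qed
  moreover have "s0 * a - x ^ t0 * c0 \<in> loc P J" using s0 loc_superset[OF P J] by auto
  ultimately have "s0 * a \<in> loc P J"
    using idl_add_cancel[OF idl_loc[OF P J], of "s0 * a" "x ^ t0 * c0"] by simp
  then show ?thesis using loc_cancel[OF P aC] s0 by simp
qed

end


section \<open>The Koszul complex and regular sequences\<close>

text \<open>
  Koszul chains over \<open>fs\<close> are indexed by the subsets of \<open>fs\<close>, encoded as Boolean lists of the
  length of \<open>fs\<close>. The complex of \<open>f # fs\<close> is the mapping cone of multiplication by \<open>f\<close>.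
\<close>

fun kbd :: "'a::comm_ring_1 list \<Rightarrow> (bool list \<Rightarrow> 'a) \<Rightarrow> bool list \<Rightarrow> 'a" where
  "kbd [] z l = 0"
| "kbd (f # fs) z [] = 0"
| "kbd (f # fs) z (False # l) = kbd fs (\<lambda>l. z (False # l)) l + f * z (True # l)"
| "kbd (f # fs) z (True # l) = - kbd fs (\<lambda>l. z (True # l)) l"

lemma kbd_add: "kbd fs (\<lambda>l. y l + z l) l = kbd fs y l + kbd fs z l"
proof (induction fs arbitrary: y z l)
  case (Cons f fs)
  then show ?case
    by (cases l rule: list.exhaust; cases "hd l") (auto simp: algebra_simps)
qed simp

lemma kbd_smult: "kbd fs (\<lambda>l. c * z l) l = c * kbd fs z l"
proof (induction fs arbitrary: z l)
  case (Cons f fs)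
  then show ?case
    by (cases l rule: list.exhaust; cases "hd l") (auto simp: algebra_simps)
qed simp

lemma kbd_uminus: "kbd fs (\<lambda>l. - z l) l = - kbd fs z l"
  using kbd_smult[of fs "-1" z l] by simp

lemma kbd_diff: "kbd fs (\<lambda>l. y l - z l) l = kbd fs y l - kbd fs z l"
  using kbd_add[of fs y "\<lambda>l. - z l" l] by (simp add: kbd_uminus)

lemma kbd_0: "kbd fs (\<lambda>l. 0) l = 0"
  using kbd_smult[of fs 0 "\<lambda>l. 0" l] by simp

lemma kbd_kbd: "kbd fs (kbd fs z) l = 0"
proof (induction fs arbitrary: z l)
  case (Cons f fs)
  have "kbd (f # fs) (kbd (f # fs) z) (b # l') = 0" for b l'
    using Cons.IH by (cases b) (simp_all add: kbd_add kbd_smult kbd_uminus algebra_simps)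
  then show ?case by (cases l) auto
qed simp

text \<open>Exterior multiplication by the \<open>j\<close>-th basis vector; the sign changes with
  each basis vector that it passes.\<close>

fun khom :: "nat \<Rightarrow> (bool list \<Rightarrow> 'a::comm_ring_1) \<Rightarrow> bool list \<Rightarrow> 'a" where
  "khom j z [] = 0"
| "khom 0 z (b # l) = (if b then z (False # l) else 0)"
| "khom (Suc j) z (b # l) = (if b then - khom j (\<lambda>l. z (True # l)) l else khom j (\<lambda>l. z (False # l)) l)"

lemma khom_add: "khom j (\<lambda>l. y l + z l) l = khom j y l + khom j z l"
  by (induction j z l arbitrary: y rule: khom.induct) auto

lemma khom_0: "khom j (\<lambda>l. 0) l = 0"
  by (induction j "\<lambda>l::bool list. 0::'a" l rule: khom.induct) auto

lemma khom_smult: "khom j (\<lambda>l. c * z l) l = c * khom j z l"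
  by (induction j z l rule: khom.induct) (auto simp: algebra_simps)

lemma khom_uminus: "khom j (\<lambda>l. - z l) l = - khom j z l"
  using khom_smult[of j "-1" z l] by simp

text \<open>This makes multiplication by each member of \<open>fs\<close> null-homotopic, which is
  why the ideal of \<open>fs\<close> annihilates Koszul homology.\<close>

lemma khom_homotopy:
  assumes "j < length fs" "length l = length fs"
  shows "kbd fs (khom j z) l + khom j (kbd fs z) l = fs ! j * z l"
  using assms
proof (induction fs arbitrary: j z l)
  case (Cons f fs)
  obtain b l' where l: "l = b # l'" "length l' = length fs"
    using Cons.prems by (cases l) auto
  show ?case
  proof (cases j)
    case 0
    then show ?thesis using l by (cases b) (auto simp: kbd_0)
  next
    case (Suc i)
    then have "kbd fs (khom i y) l' + khom i (kbd fs y) l' = fs ! i * y l'" for y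
      using Cons.IH Cons.prems l by simp
    then show ?thesis using Suc l
      by (cases b) (simp_all add: khom_add khom_smult khom_uminus kbd_uminus algebra_simps)
  qed
qed simp

text \<open>Homogeneity of degree \<open>i\<close>. A chain is a total function, so its values on
  lists of the wrong length are forced to vanish.\<close>

definition kdeg :: "nat \<Rightarrow> nat \<Rightarrow> (bool list \<Rightarrow> 'a::comm_ring_1) \<Rightarrow> bool" where
  "kdeg n i z \<longleftrightarrow> (\<forall>l. z l \<noteq> 0 \<longrightarrow> length l = n \<and> length (filter id l) = i)"

lemma kdegD: "kdeg n i z \<Longrightarrow> z l \<noteq> 0 \<Longrightarrow> length l = n \<and> length (filter id l) = i"
  unfolding kdeg_def by simp

lemma filter_id_replicate: "filter id (replicate n False) = []"
  by (induction n) auto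

lemma kdeg_Cons:
  "kdeg (Suc n) i z \<Longrightarrow> kdeg n i (\<lambda>l. z (False # l))"
  "kdeg (Suc n) (Suc i) z \<Longrightarrow> kdeg n i (\<lambda>l. z (True # l))"
  "kdeg (Suc n) 0 z \<Longrightarrow> z (True # l') = 0"
  unfolding kdeg_def by (force, force, force)

lemma kdeg_kbd_0: "kdeg (length fs) 0 z \<Longrightarrow> kbd fs z l = 0"
proof (induction fs arbitrary: z l)
  case (Cons f fs)
  have "(\<lambda>l. z (True # l)) = (\<lambda>l. 0)"
    using kdeg_Cons(3) Cons.prems by fastforce
  then have "kbd (f # fs) z (b # l') = 0" for b l'
    using Cons.IH[of "\<lambda>l. z (False # l)"] kdeg_Cons(1)[of "length fs" 0 z] Cons.prems
      kdeg_Cons(3)[of "length fs" z l']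
    by (cases b) (simp_all add: kbd_0)
  then show ?case by (cases l) auto
qed simp

lemma kdeg_kbd: "kdeg (length fs) (Suc i) z \<Longrightarrow> kdeg (length fs) i (kbd fs z)"
proof (induction fs arbitrary: i z)
  case (Cons f fs)
  have F: "kdeg (length fs) i (kbd fs (\<lambda>l. z (False # l)))"
    using Cons.IH kdeg_Cons(1) Cons.prems by fastforce
  have T: "kdeg (length fs) i (\<lambda>l. z (True # l))"
    using kdeg_Cons(2) Cons.prems by fastforce
  have "length l = Suc (length fs) \<and> length (filter id l) = i" if nz: "kbd (f # fs) z l \<noteq> 0" for l
  proof (cases l)
    case Nil
    then show ?thesis using nz by simp
  next
    case (Cons b l')
    show ?thesis
    proof (cases b)
      case False
      then have "kbd fs (\<lambda>l. z (False # l)) l' \<noteq> 0 \<or> z (True # l') \<noteq> 0"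
        using nz Cons by auto
      then show ?thesis using F T Cons False unfolding kdeg_def by auto
    next
      case True
      then have nz': "kbd fs (\<lambda>l. z (True # l)) l' \<noteq> 0"
        using nz Cons by auto
      then obtain k where k: "i = Suc k"
        using kdeg_kbd_0[of fs "\<lambda>l. z (True # l)"] T by (cases i) auto
      then have "kdeg (length fs) k (kbd fs (\<lambda>l. z (True # l)))"
        using Cons.IH T by simp
      then show ?thesis using nz' k Cons True unfolding kdeg_def by auto
    qed
  qed
  then show ?case by (simp add: kdeg_def)
qed (simp add: kdeg_def)

lemma kdeg_khom: "j < n \<Longrightarrow> kdeg n i z \<Longrightarrow> kdeg n (Suc i) (khom j z)"
proof (induction j arbitrary: n i z)
  case 0
  show ?case
    unfolding kdeg_def
  proof (intro allI impI)
    fix l assume nz: "khom 0 z l \<noteq> 0"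
    then obtain l' where "l = True # l'" "z (False # l') \<noteq> 0" by (cases l) (auto split: if_splits)
    then show "length l = n \<and> length (filter id l) = Suc i"
      using kdegD[OF 0(2), of "False # l'"] by auto
  qed
next
  case (Suc j)
  then obtain m where n: "n = Suc m" "j < m" by (cases n) auto
  have F: "kdeg m (Suc i) (khom j (\<lambda>l. z (False # l)))"
    using Suc.IH[OF n(2)] kdeg_Cons(1) Suc.prems(2) n(1) by metis
  have T: "khom j (\<lambda>l. z (True # l)) l \<noteq> 0 \<Longrightarrow> length l = m \<and> length (filter id l) = i" for l
  proof (cases i)
    case 0
    then have "(\<lambda>l. z (True # l)) = (\<lambda>l. 0)" using kdeg_Cons(3)[of m z] Suc.prems(2) n(1) by auto
    then show "khom j (\<lambda>l. z (True # l)) l \<noteq> 0 \<Longrightarrow> ?thesis" by (simp add: khom_0)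
  next
    case i: (Suc i')
    then have "kdeg m i (khom j (\<lambda>l. z (True # l)))"
      using Suc.IH[OF n(2)] kdeg_Cons(2) Suc.prems(2) n(1) by metis
    then show "khom j (\<lambda>l. z (True # l)) l \<noteq> 0 \<Longrightarrow> ?thesis" by (rule kdegD)
  qed
  show ?case
    unfolding kdeg_def
  proof (intro allI impI)
    fix l assume nz: "khom (Suc j) z l \<noteq> 0"
    then obtain b l' where l: "l = b # l'" by (cases l) auto
    show "length l = n \<and> length (filter id l) = Suc i"
      using nz T[of l'] kdegD[OF F, of l'] n(1) by (cases b) (simp_all add: l)
  qed
qed

section \<open>Koszul chains with coefficients in the ring, and null classes modulo an ideal\<close>

context carrier_ring
begin

lemma kbd_mem: "idl I \<Longrightarrow> set fs \<subseteq> C \<Longrightarrow> (\<And>l. z l \<in> I) \<Longrightarrow> kbd fs z l \<in> I"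
  by (induction fs z l rule: kbd.induct) (simp_all add: idlD)

lemma khom_mem: "idl I \<Longrightarrow> (\<And>l. z l \<in> I) \<Longrightarrow> khom j z l \<in> I"
  by (induction j z l rule: khom.induct) (auto simp: idlD)

lemma kbd_mem_gen:
  assumes "set fs \<subseteq> C" "\<And>l. z l \<in> C"
  shows "kbd fs z l \<in> gen (set fs)"
proof -
  have "kbd fs z l \<in> J" if "idl J" "set fs \<subseteq> J" for J
    using that assms
  proof (induction fs z l rule: kbd.induct)
    case (3 f fs z l)
    then show ?case by (simp add: idlD)
  qed (simp_all add: idlD)
  then show ?thesis
    using idl_gen[OF assms(1)] gen_superset by simp
qed

definition kchain :: "nat \<Rightarrow> nat \<Rightarrow> (bool list \<Rightarrow> 'a) \<Rightarrow> bool" where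
  "kchain n i z \<longleftrightarrow> kdeg n i z \<and> (\<forall>l. z l \<in> C)"

lemma kchain_0: "kchain n i (\<lambda>l. 0)"
  by (simp add: kchain_def kdeg_def)

lemma kchain_add: "kchain n i y \<Longrightarrow> kchain n i z \<Longrightarrow> kchain n i (\<lambda>l. y l + z l)"
  unfolding kchain_def kdeg_def by (metis add_0 add_C)

lemma kchain_smult: "kchain n i z \<Longrightarrow> c \<in> C \<Longrightarrow> kchain n i (\<lambda>l. c * z l)"
  unfolding kchain_def kdeg_def by (metis mult_zero_right mult_C)

lemma kchain_unit: "kchain n 0 (\<lambda>l. if l = replicate n False then 1 else 0)"
  by (auto simp: kchain_def kdeg_def filter_id_replicate)

text \<open>Triviality of the class of \<open>z\<close> in the Koszul homology of degree
  \<open>i\<close> with coefficients modulo \<open>I\<close>.\<close>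

definition knull :: "'a list \<Rightarrow> nat \<Rightarrow> 'a set \<Rightarrow> (bool list \<Rightarrow> 'a) \<Rightarrow> bool" where
  "knull fs i I z \<longleftrightarrow> (\<exists>w. kchain (length fs) (Suc i) w \<and> (\<forall>l. z l - kbd fs w l \<in> I))"

text \<open>The multipliers that make the class of \<open>z\<close> trivial form an ideal. Members
  of \<open>I\<close> kill the chain itself, and for members of \<open>fs\<close> the bounding chain
  is \<open>khom j z\<close>. Applied to the unit chain of degree 0, the lemma turns ideal
  membership into explicit coefficients.\<close>

lemma knull_mult_gen:
  assumes I: "idl I" and fs: "set fs \<subseteq> C" and z: "kchain (length fs) i z" "\<And>l. kbd fs z l \<in> I"
    and a: "a \<in> gen (I \<union> set fs)"
  shows "knull fs i I (\<lambda>l. a * z l)"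
proof -
  let ?A = "{a \<in> C. knull fs i I (\<lambda>l. a * z l)}"
  have zC: "z l \<in> C" for l using z(1) by (simp add: kchain_def)
  have "idl ?A"
  proof (rule idlI)
    show "0 \<in> ?A"
      unfolding knull_def using idlD(2)[OF I]
      by (intro CollectI conjI exI[of _ "\<lambda>l. 0"]) (simp_all add: kbd_0 kchain_0)
  next
    fix a b assume "a \<in> ?A" "b \<in> ?A"
    then have ab: "a \<in> C" "b \<in> C" "knull fs i I (\<lambda>l. a * z l)" "knull fs i I (\<lambda>l. b * z l)" by simp_all
    then obtain v w where *: "a \<in> C" "b \<in> C" "kchain (length fs) (Suc i) v" "kchain (length fs) (Suc i) w"
      and vw: "\<forall>l. a * z l - kbd fs v l \<in> I" "\<forall>l. b * z l - kbd fs w l \<in> I"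
      unfolding knull_def by (elim exE conjE)
    have "(a + b) * z l - kbd fs (\<lambda>l. v l + w l) l \<in> I" for l
      using idlD(3)[OF I vw(1)[rule_format, of l] vw(2)[rule_format, of l]] by (simp add: kbd_add algebra_simps)
    then have "knull fs i I (\<lambda>l. (a + b) * z l)"
      unfolding knull_def using kchain_add[OF *(3,4)] by (intro exI conjI allI)
    then show "a + b \<in> ?A" using *(1,2) by simp
  next
    fix a r assume "a \<in> ?A" and r: "r \<in> C"
    then have a: "a \<in> C" "knull fs i I (\<lambda>l. a * z l)" by simp_all
    then obtain v where *: "a \<in> C" "kchain (length fs) (Suc i) v" and v: "\<forall>l. a * z l - kbd fs v l \<in> I"
      unfolding knull_def by (elim exE conjE)
    have "(r * a) * z l - kbd fs (\<lambda>l. r * v l) l \<in> I" for l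
      using idlD(4)[OF I v[rule_format, of l] r] by (simp add: kbd_smult algebra_simps)
    then have "knull fs i I (\<lambda>l. (r * a) * z l)"
      unfolding knull_def using kchain_smult[OF *(2) r] by (intro exI conjI allI)
    then show "r * a \<in> ?A" using *(1) r by simp
  qed auto
  moreover have "I \<union> set fs \<subseteq> ?A"
  proof
    fix a assume "a \<in> I \<union> set fs"
    then consider "a \<in> I" | "a \<in> set fs" by auto
    then show "a \<in> ?A"
    proof cases
      case 1
      then have "a * z l \<in> I" for l using idlD(5)[OF I] zC by simp
      then have "knull fs i I (\<lambda>l. a * z l)"
        unfolding knull_def by (intro exI[of _ "\<lambda>l. 0"]) (simp add: kbd_0 kchain_0)
      then show ?thesis using 1 idlD(1)[OF I] by simp
    next
      case 2
      then obtain j where j: "j < length fs" "a = fs ! j" by (auto simp: in_set_conv_nth)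
      have kc: "kchain (length fs) (Suc i) (khom j z)"
        using z(1) kdeg_khom[OF j(1), of i z] khom_mem[OF idl_C, of z j]
        unfolding kchain_def by simp
      have "a * z l - kbd fs (khom j z) l \<in> I" for l
      proof (cases "length l = length fs")
        case True
        have "a * z l - kbd fs (khom j z) l = khom j (kbd fs z) l"
          unfolding j(2) khom_homotopy[OF j(1) True, of z, symmetric] by simp
        then show ?thesis using khom_mem[OF I, of "kbd fs z" j l] z(2) by simp
      next
        case False
        have "z l = 0" using z(1) False unfolding kchain_def kdeg_def by metis
        moreover have "kdeg (length fs) i (kbd fs (khom j z))"
          using kdeg_kbd[of fs i "khom j z"] kc unfolding kchain_def by (elim conjE)
        then have "kbd fs (khom j z) l = 0" using False unfolding kdeg_def by metis
        ultimately show ?thesis using idlD(2)[OF I] by simp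
      qed
      then have "knull fs i I (\<lambda>l. a * z l)" unfolding knull_def using kc by (intro exI conjI allI)
      then show ?thesis using 2 fs by auto
    qed
  qed
  ultimately have "gen (I \<union> set fs) \<subseteq> ?A" by (rule gen_minimal)
  then show ?thesis using a by auto
qed

text \<open>Regularity in the local ring at \<open>P\<close> modulo \<open>I\<close>. The premise
  \<open>a * g \<in> I\<close> carries no denominator because one can be absorbed into
  \<open>a\<close>.\<close>

primrec regular :: "'a set \<Rightarrow> 'a set \<Rightarrow> 'a list \<Rightarrow> bool" where
  "regular P I [] \<longleftrightarrow> True"
| "regular P I (g # gs) \<longleftrightarrow> g \<in> P \<and> (\<forall>a\<in>C. a * g \<in> I \<longrightarrow> a \<in> loc P I) \<and> regular P (gen (insert g I)) gs"

end

section \<open>Depth sensitivity of the Koszul complex\<close>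

context noetherian_carrier_ring
begin

text \<open>In the long exact sequence of multiplication by \<open>g\<close> modulo
  \<open>I\<close>, vanishing in degree \<open>i + 1\<close> modulo \<open>(g, I)\<close> makes
  \<open>g\<close> injective on homology of degree \<open>i\<close>. A class killed by a power of
  \<open>g\<close> is then zero; the induction strips one factor at a time.\<close>

lemma koszul_vanishing_step:
  assumes P: "prm P" and I: "idl I" and fs: "set fs \<subseteq> C" and g: "g \<in> P" "\<And>a. a \<in> C \<Longrightarrow> a * g \<in> I \<Longrightarrow> a \<in> loc P I"
    and V: "\<And>w. kchain (length fs) (Suc i) w \<Longrightarrow> (\<And>l. kbd fs w l \<in> gen (insert g I)) \<Longrightarrow>
      \<exists>s \<in> C - P. knull fs (Suc i) (gen (insert g I)) (\<lambda>l. s * w l)"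
    and z: "kchain (length fs) i z" and s: "s \<in> C - P" "knull fs i I (\<lambda>l. s * g ^ N * z l)"
  shows "\<exists>s \<in> C - P. knull fs i I (\<lambda>l. s * z l)"
  using s
proof (induction N arbitrary: s)
  case 0
  then show ?case by auto
next
  case (Suc N)
  have gC: "g \<in> C" using g idlD(1)[OF prmD(1)[OF P]] by simp
  have zC: "z l \<in> C" for l using z by (simp add: kchain_def)
  define z' where "z' l = s * g ^ N * z l" for l
  have z': "kchain (length fs) i z'"
    unfolding z'_def using kchain_smult[OF z, of "s * g ^ N"] gC Suc.prems(1) by simp
  obtain w where w: "kchain (length fs) (Suc i) w" and w': "\<forall>l. s * g ^ Suc N * z l - kbd fs w l \<in> I"
    using Suc.prems(2) unfolding knull_def by (elim exE conjE)
  have "s * g ^ Suc N * z l = g * z' l" for l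
    by (simp add: z'_def mult_ac)
  then have wI: "g * z' l - kbd fs w l \<in> I" for l
    using w'[rule_format, of l] by simp
  have IJ: "gen (insert g I) = {i + r * g |i r. i \<in> I \<and> r \<in> C}"
    by (rule gen_insert[OF I gC])
  have idlJ: "idl (gen (insert g I))"
    using gC idlD(1)[OF I] by (intro idl_gen) auto
  have gJ: "g \<in> gen (insert g I)" "I \<subseteq> gen (insert g I)"
    using gen_superset[of "insert g I"] by auto
  have kw: "kbd fs w l \<in> gen (insert g I)" for l
  proof -
    have "g * z' l \<in> gen (insert g I)"
      using idlD(5)[OF idlJ gJ(1)] z' by (simp add: kchain_def)
    then show ?thesis
      using idl_add_cancel[OF idlJ, of "g * z' l" "kbd fs w l"] wI[of l] gJ(2) by auto
  qed
  obtain s1 where s1: "s1 \<in> C" "s1 \<notin> P" and "knull fs (Suc i) (gen (insert g I)) (\<lambda>l. s1 * w l)"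
    using V[OF w kw] by auto
  then obtain u where u: "kchain (length fs) (Suc (Suc i)) u"
    and uJ: "\<forall>l. s1 * w l - kbd fs u l \<in> gen (insert g I)"
    unfolding knull_def by (elim exE conjE)
  \<comment> \<open>Modulo \<open>(g, I)\<close> the chain \<open>w\<close> is a cycle, so
    \<open>s1 * w\<close> is a boundary up to \<open>D\<close>, and \<open>D\<close> is
    \<open>g\<close> times a chain \<open>v\<close> modulo \<open>I\<close>. After applying the
    differential and cancelling \<open>g\<close>, the chain \<open>v\<close> bounds
    \<open>s1 * z'\<close> locally.\<close>
  define D where "D l = s1 * w l - kbd fs u l" for l
  have Ddeg: "kdeg (length fs) (Suc i) D"
    unfolding kdeg_def
  proof (intro allI impI)
    fix l assume "D l \<noteq> 0"
    then have "w l \<noteq> 0 \<or> kbd fs u l \<noteq> 0" by (auto simp: D_def)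
    then show "length l = length fs \<and> length (filter id l) = Suc i"
      using w u kdegD[of _ _ w l] kdegD[OF kdeg_kbd, of fs "Suc i" u l]
      unfolding kchain_def by fast
  qed
  \<comment> \<open>Choosing \<open>v = 0\<close> wherever \<open>D l = 0\<close> keeps the quotient
    homogeneous of degree \<open>i + 1\<close>.\<close>
  have "\<exists>v. v \<in> C \<and> D l - g * v \<in> I \<and> (D l = 0 \<longrightarrow> v = 0)" for l
  proof (cases "D l = 0")
    case True
    then show ?thesis using idlD(2)[OF I] by (intro exI[of _ 0]) simp
  next
    case False
    obtain i r where "D l = i + r * g" "i \<in> I" "r \<in> C"
      using uJ[rule_format, of l] unfolding D_def IJ by blast
    then show ?thesis using False by (intro exI[of _ r]) (simp add: mult.commute)
  qed
  then have "\<exists>v. \<forall>l. v l \<in> C \<and> D l - g * v l \<in> I \<and> (D l = 0 \<longrightarrow> v l = 0)"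
    by (intro choice allI)
  then obtain v where v: "\<And>l. v l \<in> C" "\<And>l. D l - g * v l \<in> I" "\<And>l. D l = 0 \<Longrightarrow> v l = 0"
    by auto
  have vch: "kchain (length fs) (Suc i) v"
    using v(1,3) Ddeg unfolding kchain_def kdeg_def by metis
  have "z' l * s1 - kbd fs v l \<in> loc P I" for l
  proof -
    have "kbd fs (\<lambda>l. D l - g * v l) l \<in> I"
      by (intro kbd_mem[OF I fs] v(2))
    then have 1: "s1 * kbd fs w l - g * kbd fs v l \<in> I"
      unfolding D_def kbd_diff kbd_smult kbd_kbd by simp
    have "s1 * (g * z' l - kbd fs w l) \<in> I"
      using idlD(4)[OF I wI] s1 by simp
    then have "s1 * (g * z' l - kbd fs w l) + (s1 * kbd fs w l - g * kbd fs v l) \<in> I"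
      using idlD(3)[OF I] 1 by simp
    then have "(z' l * s1 - kbd fs v l) * g \<in> I"
      by (simp add: algebra_simps)
    moreover have "z' l * s1 - kbd fs v l \<in> C"
      using z' s1(1) kbd_mem[OF idl_C fs, of v l] v(1) by (simp add: kchain_def)
    ultimately show ?thesis using g(2) by simp
  qed
  moreover obtain s2 where s2: "s2 \<in> C" "s2 \<notin> P" "\<And>a. a \<in> loc P I \<Longrightarrow> s2 * a \<in> I"
    using loc_eq_colon[OF P I] by auto
  ultimately have *: "s2 * (z' l * s1 - kbd fs v l) \<in> I" for l by simp
  have "s2 * s1 * s * g ^ N * z l - kbd fs (\<lambda>l. s2 * v l) l \<in> I" for l
  proof -
    have "s2 * s1 * s * g ^ N * z l - kbd fs (\<lambda>l. s2 * v l) l = s2 * (z' l * s1 - kbd fs v l)"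
      unfolding kbd_smult z'_def by (simp add: algebra_simps)
    then show ?thesis using *[of l] by simp
  qed
  then have "knull fs i I (\<lambda>l. (s2 * s1 * s) * g ^ N * z l)"
    unfolding knull_def using kchain_smult[OF vch s2(1)] by (intro exI conjI allI)
  moreover have "s2 * s1 * s \<in> C - P"
    using s1 s2 Suc.prems(1) by (simp add: prm_mult_iff[OF P])
  ultimately show ?case by (intro Suc.IH)
qed

text \<open>Each element of \<open>gs\<close> is traded for one homological degree, and beyond the
  length of \<open>fs\<close> there are no chains. The nilpotency hypothesis provides the power of
  \<open>g\<close> that annihilates homology, as the induction step requires.\<close>

lemma koszul_vanishing:
  assumes P: "prm P" and fs: "set fs \<subseteq> C"
    and "idl I" "regular P I gs" "length fs < i + length gs"
    and "\<And>g. g \<in> P \<Longrightarrow> \<exists>N. g ^ N \<in> loc P (gen (I \<union> set fs))"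
    and "kchain (length fs) i z" "\<And>l. kbd fs z l \<in> I"
  shows "\<exists>s \<in> C - P. knull fs i I (\<lambda>l. s * z l)"
  using assms(3-)
proof (induction gs arbitrary: I i z)
  case Nil
  have "z l = 0" for l
  proof (rule ccontr)
    assume "z l \<noteq> 0"
    then have "length l = length fs" "length (filter id l) = i"
      using Nil.prems(5) kdegD unfolding kchain_def by blast+
    then show False using Nil.prems(3) length_filter_le[of id l] by simp
  qed
  then have "knull fs i I (\<lambda>l. 1 * z l)"
    unfolding knull_def using idlD(2)[OF Nil.prems(1)] by (intro exI[of _ "\<lambda>l. 0"]) (simp add: kbd_0 kchain_0)
  moreover have "1 \<in> C - P" using prmD(2)[OF P] by simp
  ultimately show ?case by blast
next
  case (Cons g gs)
  note I = Cons.prems(1)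
  have g: "g \<in> P" "\<And>a. a \<in> C \<Longrightarrow> a * g \<in> I \<Longrightarrow> a \<in> loc P I" and reg: "regular P (gen (insert g I)) gs"
    using Cons.prems(2) by auto
  have gC: "g \<in> C" using g idlD(1)[OF prmD(1)[OF P]] by simp
  have idlJ: "idl (gen (insert g I))"
    using gC idlD(1)[OF I] by (intro idl_gen) auto
  have "loc P (gen (I \<union> set fs)) \<subseteq> loc P (gen (gen (insert g I) \<union> set fs))"
    using gen_superset[of "insert g I"] by (intro loc_mono gen_mono) auto
  then have nil: "\<exists>N. h ^ N \<in> loc P (gen (gen (insert g I) \<union> set fs))" if "h \<in> P" for h
    using Cons.prems(4)[OF that] by auto
  obtain N where "g ^ N \<in> loc P (gen (I \<union> set fs))"
    using Cons.prems(4)[OF g(1)] by auto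
  then obtain s where s: "s \<in> C" "s \<notin> P" "s * g ^ N \<in> gen (I \<union> set fs)"
    by (elim locE)
  have "knull fs i I (\<lambda>l. s * g ^ N * z l)"
    by (rule knull_mult_gen[OF I fs Cons.prems(5,6) s(3)])
  moreover have "\<exists>s \<in> C - P. knull fs (Suc i) (gen (insert g I)) (\<lambda>l. s * w l)"
    if "kchain (length fs) (Suc i) w" "\<And>l. kbd fs w l \<in> gen (insert g I)" for w
    using Cons.prems(3) by (intro Cons.IH[OF idlJ reg _ nil that]) auto
  ultimately show ?case
    using s(1,2) by (intro koszul_vanishing_step[OF P I fs g _ Cons.prems(5), of s N]) simp_all
qed

text \<open>The homology of degree 0 is the local ring modulo \<open>I\<close> and
  \<open>fs\<close>, nonzero since both lie in \<open>P\<close>. A regular sequence longer than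
  \<open>fs\<close> would make it vanish.\<close>

lemma regular_length_le:
  assumes P: "prm P" and fs: "set fs \<subseteq> P" and I: "idl I" "I \<subseteq> P" and gs: "regular P I gs"
    and nil: "\<And>g. g \<in> P \<Longrightarrow> \<exists>N. g ^ N \<in> loc P (gen (I \<union> set fs))"
  shows "length gs \<le> length fs"
proof (rule ccontr)
  assume "\<not> length gs \<le> length fs"
  have fsC: "set fs \<subseteq> C" using fs idlD(1)[OF prmD(1)[OF P]] by auto
  let ?z = "\<lambda>l. if l = replicate (length fs) False then 1 else 0"
  have "kbd fs ?z l \<in> I" for l
    using kdeg_kbd_0[of fs ?z l] kchain_unit idlD(2)[OF I(1)] by (simp add: kchain_def)
  then have "\<exists>s \<in> C - P. knull fs 0 I (\<lambda>l. s * ?z l)"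
    using \<open>\<not> length gs \<le> length fs\<close>
    by (intro koszul_vanishing[OF P fsC I(1) gs _ nil kchain_unit]) simp_all
  then obtain s where s: "s \<in> C" "s \<notin> P" and "knull fs 0 I (\<lambda>l. s * ?z l)"
    by auto
  then obtain w where w: "kchain (length fs) (Suc 0) w" and sI: "\<forall>l. s * ?z l - kbd fs w l \<in> I"
    unfolding knull_def by (elim exE conjE)
  have "kbd fs w (replicate (length fs) False) \<in> P"
    using kbd_mem_gen[OF fsC, of w] w gen_minimal[OF prmD(1)[OF P] fs] by (auto simp: kchain_def)
  moreover have "s - kbd fs w (replicate (length fs) False) \<in> P"
    using sI[rule_format, of "replicate (length fs) False"] I(2) by auto
  ultimately have "s \<in> P"
    using idl_add_cancel[OF prmD(1)[OF P], of s "kbd fs w (replicate (length fs) False)"] by simp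
  then show False using s(2) by simp
qed

text \<open>A relation \<open>a * f \<in> gen (I \<union> set fs)\<close> is a cycle of degree 1
  with coefficient \<open>a\<close> at the basis vector of \<open>f\<close>. For equal lengths it is
  locally a boundary modulo \<open>I\<close>, and the coefficient of a boundary at that vector lies
  in the ideal of \<open>fs\<close>.\<close>

lemma regular_nonzerodivisor:
  assumes P: "prm P" and fs: "set (f # fs) \<subseteq> P" and I: "idl I" and gs: "regular P I gs"
    and nil: "\<And>g. g \<in> P \<Longrightarrow> \<exists>N. g ^ N \<in> loc P (gen (I \<union> set (f # fs)))"
    and len: "length gs = length (f # fs)"
    and a: "a \<in> C" "a * f \<in> gen (I \<union> set fs)"
  shows "a \<in> loc P (gen (I \<union> set fs))"
proof -
  have fsC: "set (f # fs) \<subseteq> C" "set fs \<subseteq> C" "f \<in> C" using fs idlD(1)[OF prmD(1)[OF P]] by auto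
  let ?d = "\<lambda>l. if l = replicate (length fs) False then 1 else 0"
  have d0: "kbd fs ?d l = 0" for l
    using kdeg_kbd_0[of fs ?d l] kchain_unit by (simp add: kchain_def)
  \<comment> \<open>Writes \<open>a * f\<close> as a combination of \<open>fs\<close> modulo
    \<open>I\<close>; the chain \<open>w\<close> of degree 1 holds the coefficients.\<close>
  have "knull fs 0 I (\<lambda>l. a * f * ?d l)"
    by (rule knull_mult_gen[OF I fsC(2) kchain_unit _ a(2)]) (simp add: d0 idlD[OF I])
  then obtain w where w: "kchain (length fs) (Suc 0) w" "\<forall>l. a * f * ?d l - kbd fs w l \<in> I"
    unfolding knull_def by (elim exE conjE)
  define z where "z l = (case l of [] \<Rightarrow> 0 | b # l \<Rightarrow> if b then a * ?d l else - w l)" for l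
  have z_simps: "z [] = 0" "z (True # l) = a * ?d l" "z (False # l) = - w l" for l
    by (simp_all add: z_def)
  have "kchain (length (f # fs)) 1 z"
    unfolding kchain_def kdeg_def
  proof (intro conjI allI impI)
    fix l :: "bool list"
    have wd: "w l \<noteq> 0 \<Longrightarrow> length l = length fs \<and> length (filter id l) = Suc 0" for l
      using w kdegD[of "length fs" "Suc 0" w l] by (simp add: kchain_def)
    have dd: "?d l \<noteq> 0 \<Longrightarrow> length l = length fs \<and> length (filter id l) = 0" for l
      by (auto simp: filter_id_replicate split: if_splits)
    show "z l \<in> C"
      using a w by (auto simp: z_def kchain_def split: list.splits)
    show "length l = length (f # fs)" "length (filter id l) = 1" if "z l \<noteq> 0"
      using that wd dd by (cases l; cases "hd l"; auto simp: z_simps split: if_splits)+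
  qed
  moreover have "kbd (f # fs) z l \<in> I" for l
  proof (cases l)
    case Nil
    then show ?thesis using idlD(2)[OF I] by simp
  next
    case (Cons b l')
    have "kbd fs (\<lambda>l. a * ?d l) l' = 0" by (subst kbd_smult) (simp add: d0)
    moreover have "- kbd fs w l' + f * (a * ?d l') \<in> I"
      using w(2)[rule_format, of l'] by (simp only: mult.left_commute[of f] mult.assoc diff_conv_add_uminus add.commute)
    ultimately show ?thesis
      using Cons idlD(2)[OF I] by (cases b) (simp_all only: kbd.simps z_simps kbd_uminus minus_zero)
  qed
  ultimately have "\<exists>s \<in> C - P. knull (f # fs) 1 I (\<lambda>l. s * z l)"
    using len by (intro koszul_vanishing[OF P fsC(1) I gs _ nil]) simp_all
  then obtain s where s: "s \<in> C" "s \<notin> P" and "knull (f # fs) 1 I (\<lambda>l. s * z l)"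
    by auto
  then obtain w' where w': "kchain (length (f # fs)) (Suc 1) w'"
    and sI: "\<forall>l. s * z l - kbd (f # fs) w' l \<in> I"
    unfolding knull_def by (elim exE conjE)
  define FF where "FF = replicate (length fs) False"
  let ?K = "gen (I \<union> set fs)"
  have idlK: "idl ?K" using idl_gen[of "I \<union> set fs"] fsC idlD(1)[OF I] by auto
  have "s * a + kbd fs (\<lambda>l. w' (True # l)) FF \<in> ?K"
    using sI[rule_format, of "True # FF"] gen_superset[of "I \<union> set fs"] by (auto simp: z_simps FF_def)
  moreover have "kbd fs (\<lambda>l. w' (True # l)) FF \<in> ?K"
    using kbd_mem_gen[OF fsC(2), of "\<lambda>l. w' (True # l)" FF] w' gen_mono[of "set fs" "I \<union> set fs"]
    by (auto simp: kchain_def)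
  ultimately have "s * a + kbd fs (\<lambda>l. w' (True # l)) FF - kbd fs (\<lambda>l. w' (True # l)) FF \<in> ?K"
    by (rule idlD(7)[OF idlK])
  then have "s * a \<in> ?K" by simp
  then show ?thesis using a(1) s by (intro locI)
qed

text \<open>To remove the elements one at a time their exponents must be independent. The common
  exponent \<open>T\<close> is large enough for any prescribed pair \<open>t0\<close>,
  \<open>t\<close>, so the hypothesis with equal exponents suffices.\<close>

lemma krull_intersection_powers:
  assumes P: "prm P" and xs: "set xs \<subseteq> P"
    and "idl J" "\<And>t. a \<in> loc P (gen (J \<union> (\<lambda>x. x ^ Suc t) ` set xs))"
  shows "a \<in> loc P J"
  using assms(2-)
proof (induction xs arbitrary: J)
  case Nil
  then show ?case by (simp add: gen_idl)
next
  case (Cons x xs)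
  have PC: "P \<subseteq> C" using idlD(1)[OF prmD(1)[OF P]] by auto
  have xC: "x \<in> C" "set xs \<subseteq> C" using Cons.prems(1) PC by auto
  have JC: "J \<subseteq> C" using idlD(1)[OF Cons.prems(2)] by auto
  show ?case
  proof (rule krull_intersection_power[OF P Cons.prems(2), of x])
    show "x \<in> P" using Cons.prems by simp
    fix t0 :: nat
    let ?J = "gen (insert (x ^ t0) J)"
    have idlJ: "idl ?J" using xC JC by (intro idl_gen) auto
    show "a \<in> loc P ?J"
    proof (rule Cons.IH)
      show "set xs \<subseteq> P" "idl ?J" using Cons.prems idlJ by auto
      fix t :: nat
      let ?K = "gen (?J \<union> (\<lambda>x. x ^ Suc t) ` set xs)"
      have "?J \<union> (\<lambda>x. x ^ Suc t) ` set xs \<subseteq> C"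
        using xC idlD(1)[OF idlJ] by auto
      then have idlK: "idl ?K" by (rule idl_gen)
      define T where "T = max t t0"
      have 1: "x ^ t0 \<in> ?K" "J \<subseteq> ?K" "\<And>y. y \<in> set xs \<Longrightarrow> y ^ Suc t \<in> ?K"
        using gen_superset[of "?J \<union> (\<lambda>x. x ^ Suc t) ` set xs"] gen_superset[of "insert (x ^ t0) J"]
        by auto
      have "x ^ Suc T \<in> ?K"
      proof -
        have "x ^ Suc T = x ^ (Suc T - t0) * x ^ t0" by (simp add: T_def flip: power_add)
        then show ?thesis using idlD(4)[OF idlK 1(1)] xC by simp
      qed
      moreover have "y ^ Suc T \<in> ?K" if "y \<in> set xs" for y
      proof -
        have "y ^ Suc T = y ^ (T - t) * y ^ Suc t" by (simp add: T_def flip: power_add power_Suc)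
        then show ?thesis using idlD(4)[OF idlK 1(3)[OF that]] xC that by auto
      qed
      ultimately have "gen (J \<union> (\<lambda>x. x ^ Suc T) ` set (x # xs)) \<subseteq> ?K"
        using 1(2) by (intro gen_minimal[OF idlK]) auto
      then show "a \<in> loc P ?K"
        using Cons.prems(3)[of T] loc_mono by blast
    qed
  qed
qed

text \<open>
  The Koszul argument only shows that \<open>f\<close> is a nonzerodivisor modulo all other members of the
  sequence. Replacing those after \<open>f\<close> by arbitrarily high powers removes them.
\<close>

lemma regular_nonzerodivisor_prefix:
  assumes P: "minimal_over (gen (set (xs @ f # ys))) P" and gs: "regular P {0} gs"
    and len: "length gs = length (xs @ f # ys)"
    and a: "a \<in> C" "a * f \<in> loc P (gen (set xs))"
  shows "a \<in> loc P (gen (set xs))"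
proof -
  have pP: "prm P" and sub: "set xs \<subseteq> P" "f \<in> P" "set ys \<subseteq> P"
    using P gen_superset[of "set (xs @ f # ys)"] by (auto simp: minimal_over_def)
  have PC: "P \<subseteq> C" using idlD(1)[OF prmD(1)[OF pP]] by auto
  have C: "set xs \<subseteq> C" "f \<in> C" "set ys \<subseteq> C" using sub PC by auto
  obtain s where s: "s \<in> C" "s \<notin> P" "s * (a * f) \<in> gen (set xs)"
    using a(2) by (elim locE)
  have "a \<in> loc P (gen (gen (set xs) \<union> (\<lambda>x. x ^ Suc t) ` set ys))" for t
  proof -
    define fs where "fs = xs @ map (\<lambda>x. x ^ Suc t) ys"
    have fsC: "set fs \<subseteq> C" "set (f # fs) \<subseteq> C" using C by (auto simp: fs_def)
    have fsP: "set (f # fs) \<subseteq> P"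
      using sub C by (auto simp: fs_def intro!: idlD(5)[OF prmD(1)[OF pP]])
    \<comment> \<open>Positive powers of the members of \<open>ys\<close> lie in the same primes as
      the members themselves, so \<open>P\<close> stays minimal and the Koszul argument applies to
      every \<open>t\<close>.\<close>
    have min: "minimal_over (gen ({0} \<union> set (f # fs))) P"
      unfolding minimal_over_def gen_Un_zero[OF fsC(2)]
    proof (intro conjI allI impI)
      show "gen (set (f # fs)) \<subseteq> P" using fsP by (intro gen_minimal prmD(1) pP)
      fix Q assume Q: "prm Q \<and> gen (set (f # fs)) \<subseteq> Q \<and> Q \<subseteq> P"
      then have *: "set (f # fs) \<subseteq> Q" and pQ: "prm Q" using gen_superset[of "set (f # fs)"] by auto
      have "y \<in> Q" if "y \<in> set ys" for y
        using * prm_power[OF pQ, of y "Suc t"] C(3) that unfolding fs_def by auto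
      then have "set (xs @ f # ys) \<subseteq> Q"
        using * by (auto simp: fs_def)
      then have "gen (set (xs @ f # ys)) \<subseteq> Q" using Q prmD(1) by (intro gen_minimal) auto
      then show "Q = P" using P Q by (simp add: minimal_over_def)
    qed (fact pP)
    have "s * a \<in> loc P (gen ({0} \<union> set fs))"
    proof (rule regular_nonzerodivisor[OF pP fsP idl_0 gs])
      show "\<exists>N. g ^ N \<in> loc P (gen ({0} \<union> set (f # fs)))" if "g \<in> P" for g
        using that fsC by (intro minimal_over_nilpotent[OF min] idl_gen) auto
      show "length gs = length (f # fs)" using len by (simp add: fs_def)
      show "s * a \<in> C" using s a by simp
      show "s * a * f \<in> gen ({0} \<union> set fs)"
        using s(3) gen_mono[of "set xs" "{0} \<union> set fs"] by (auto simp: fs_def mult.assoc)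
    qed
    then have "a \<in> loc P (gen (set fs))"
      using loc_cancel[OF pP a(1) s(1,2)] gen_Un_zero[OF fsC(1)] by simp
    moreover have "gen (set fs) \<subseteq> gen (gen (set xs) \<union> (\<lambda>x. x ^ Suc t) ` set ys)"
      using gen_superset[of "set xs"] by (intro gen_mono) (auto simp: fs_def)
    ultimately show ?thesis by (rule subsetD[OF loc_mono, rotated])
  qed
  then show ?thesis
    by (rule krull_intersection_powers[OF pP sub(3) idl_gen[OF C(1)]])
qed

end


section \<open>Univariate polynomials over a subring\<close>

context carrier_ring
begin

definition upoly :: "'a poly set" where
  "upoly = {q. \<forall>k. coeff q k \<in> C}"

lemma upolyD: "q \<in> upoly \<Longrightarrow> coeff q k \<in> C"
  by (simp add: upoly_def)

lemma upoly_0 [simp]: "0 \<in> upoly" and upoly_1 [simp]: "1 \<in> upoly"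
  by (simp_all add: upoly_def coeff_1)

lemma upoly_add [simp]: "p \<in> upoly \<Longrightarrow> q \<in> upoly \<Longrightarrow> p + q \<in> upoly"
  and upoly_diff [simp]: "p \<in> upoly \<Longrightarrow> q \<in> upoly \<Longrightarrow> p - q \<in> upoly"
  and upoly_uminus [simp]: "p \<in> upoly \<Longrightarrow> - p \<in> upoly"
  and upoly_smult [simp]: "c \<in> C \<Longrightarrow> p \<in> upoly \<Longrightarrow> smult c p \<in> upoly"
  by (simp_all add: upoly_def)

lemma upoly_mult [simp]: "p \<in> upoly \<Longrightarrow> q \<in> upoly \<Longrightarrow> p * q \<in> upoly"
  by (simp add: upoly_def coeff_mult sum_C)

lemma upoly_monom [simp]: "c \<in> C \<Longrightarrow> monom c k \<in> upoly"
  by (simp add: upoly_def)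

lemma upoly_pCons [simp]: "c \<in> C \<Longrightarrow> q \<in> upoly \<Longrightarrow> pCons c q \<in> upoly"
  by (simp add: upoly_def coeff_pCons split: nat.split)

lemma poly_mem: "q \<in> upoly \<Longrightarrow> x \<in> C \<Longrightarrow> poly q x \<in> C"
  by (simp add: poly_altdef sum_C upolyD)

lemma degree_less_of_coeff_0:
  "degree q \<le> n \<Longrightarrow> coeff q n = 0 \<Longrightarrow> n > 0 \<Longrightarrow> degree q < n"
  using leading_coeff_0_iff[of q] by (cases "degree q = n") auto

text \<open>Multiplying the dividend by the leading coefficient of \<open>u\<close> takes the place
  of dividing by it.\<close>

lemma pseudo_division:
  assumes u: "u \<in> upoly" "degree u > 0" and q: "q \<in> upoly"
  shows "\<exists>N s r. s \<in> upoly \<and> r \<in> upoly \<and> smult (lead_coeff u ^ N) q = s * u + r \<and> degree r < degree u"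
  using q
proof (induction "degree q" arbitrary: q rule: less_induct)
  case less
  let ?l = "lead_coeff u"
  have lC: "?l \<in> C" using u upolyD by auto
  show ?case
  proof (cases "degree q < degree u")
    case True
    then show ?thesis using less.prems by (intro exI[of _ 0] exI[of _ q]) simp
  next
    case False
    define m where "m = monom (lead_coeff q) (degree q - degree u)"
    define q' where "q' = smult ?l q - m * u"
    have m: "m \<in> upoly" unfolding m_def using upolyD[OF less.prems] by simp
    have "degree m \<le> degree q - degree u" unfolding m_def by (rule degree_monom_le)
    then have "degree (m * u) \<le> degree q"
      using degree_mult_le[of m u] False by linarith
    then have "degree q' \<le> degree q"
      unfolding q'_def by (intro degree_diff_le) (simp_all add: degree_smult_le)
    moreover have "coeff q' (degree q) = 0"
      using False by (simp add: q'_def m_def coeff_monom_mult)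
    ultimately have "degree q' < degree q"
      using False u(2) by (intro degree_less_of_coeff_0) linarith+
    moreover have "q' \<in> upoly" unfolding q'_def using less.prems m u lC by simp
    ultimately obtain N s r where IH: "s \<in> upoly" "r \<in> upoly"
      "smult (?l ^ N) q' = s * u + r" "degree r < degree u"
      using less.hyps by blast
    have "smult (?l ^ Suc N) q = smult (?l ^ N) q' + smult (?l ^ N) m * u"
      by (simp add: q'_def smult_diff_right mult.commute)
    also have "\<dots> = (s + smult (?l ^ N) m) * u + r"
      by (simp add: IH(3) algebra_simps)
    finally have eq: "smult (?l ^ Suc N) q = (s + smult (?l ^ N) m) * u + r" .
    show ?thesis
      by (intro exI[of _ "Suc N"] exI[of _ "s + smult (?l ^ N) m"] exI[of _ r] conjI eq IH)
         (use IH(1) m lC in simp)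
  qed
qed

text \<open>Were the leading coefficient of \<open>u\<close> a unit, \<open>q\<close> itself would
  vanish modulo \<open>I\<close>. Without inverting it, each leading term of \<open>q\<close> is
  removed at the price of one more factor.\<close>

lemma coeffs_mult_cancel:
  assumes I: "idl I" and u: "u \<in> upoly" and q: "q \<in> upoly" and qu: "\<And>k. coeff (q * u) k \<in> I"
  shows "\<exists>N. \<forall>k. lead_coeff u ^ N * coeff q k \<in> I"
  using q qu
proof (induction "degree q" arbitrary: q rule: less_induct)
  case less
  let ?l = "lead_coeff u" and ?D = "degree q"
  have lC: "?l \<in> C" using u upolyD by auto
  have qC: "coeff q k \<in> C" for k using less.prems upolyD by simp
  have top: "?l * lead_coeff q \<in> I"
    using less.prems(2)[of "?D + degree u"] by (simp add: coeff_mult_degree_sum mult.commute)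
  define q' where "q' = smult ?l (q - monom (lead_coeff q) ?D)"
  have q'C: "q' \<in> upoly" unfolding q'_def using less.prems lC qC by simp
  have coeff_q': "coeff q' k = (if k = ?D then 0 else ?l * coeff q k)" for k
    by (simp add: q'_def)
  have "\<exists>N. \<forall>k. ?l ^ N * coeff q' k \<in> I"
  proof (cases "?D = 0")
    case True
    then have "coeff q' k = 0" for k
      using coeff_q' coeff_eq_0[of q k] by auto
    then show ?thesis using idlD(2)[OF I] by simp
  next
    case False
    have "degree q' \<le> ?D"
      by (rule degree_le) (simp add: coeff_q' coeff_eq_0)
    then have "degree q' < ?D"
      using False coeff_q'[of ?D] by (intro degree_less_of_coeff_0) simp_all
    moreover have "coeff (q' * u) k \<in> I" for k
    proof -
      have "q' * u = smult ?l (q * u) - monom (?l * lead_coeff q) ?D * u"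
        by (simp add: q'_def smult_diff_right left_diff_distrib smult_monom)
      then have "coeff (q' * u) k = ?l * coeff (q * u) k -
          (if k < ?D then 0 else ?l * lead_coeff q * coeff u (k - ?D))"
        by (simp add: coeff_monom_mult)
      moreover have "?l * coeff (q * u) k \<in> I" using less.prems(2)[of k] lC by (intro idlD(4)[OF I])
      moreover have "?l * lead_coeff q * coeff u (k - ?D) \<in> I"
        using top upolyD[OF u] by (rule idlD(5)[OF I])
      ultimately show ?thesis using idlD(2,7)[OF I] by simp
    qed
    ultimately show ?thesis using less.hyps q'C by blast
  qed
  then obtain N where N: "\<And>k. ?l ^ N * coeff q' k \<in> I" by auto
  have "?l ^ Suc N * coeff q k \<in> I" for k
  proof (cases "k = ?D")
    case True
    have "?l ^ N * (?l * lead_coeff q) \<in> I" using top power_C[OF lC] by (rule idlD(4)[OF I])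
    then show ?thesis using True by (simp add: mult_ac)
  next
    case False
    then show ?thesis using N[of k] by (simp add: coeff_q' mult_ac)
  qed
  then show ?case by blast
qed

end


section \<open>Multivariate polynomials\<close>

abbreviation lookup where "lookup \<equiv> Poly_Mapping.lookup"
abbreviation keys where "keys \<equiv> Poly_Mapping.keys"
abbreviation single where "single \<equiv> Poly_Mapping.single"

definition PR :: "nat set \<Rightarrow> 'k::field mpoly set" where
  "PR T = {p. \<forall>m \<in> keys p. keys m \<subseteq> T}"

definition var :: "nat \<Rightarrow> 'k::field mpoly" where
  "var i = single (single i 1) 1"

definition const :: "'k::field \<Rightarrow> 'k mpoly" where
  "const c = single 0 c"

lemma carrier_mpoly_ring: "carrier (mpoly_ring n) = PR {1..n}"
  by (simp add: mpoly_ring_def PR_def)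

lemma PR_mono: "S \<subseteq> T \<Longrightarrow> PR S \<subseteq> PR T"
  unfolding PR_def by blast

interpretation PR: carrier_ring "PR T :: 'k::field mpoly set" for T
proof
  fix a b :: "'k mpoly"
  assume ab: "a \<in> PR T" "b \<in> PR T"
  show "a + b \<in> PR T"
    using ab Poly_Mapping.keys_add[of a b] unfolding PR_def by blast
  show "a * b \<in> PR T"
    unfolding PR_def
  proof (intro CollectI ballI)
    fix m assume "m \<in> keys (a * b)"
    then obtain k l where "m = k + l" "k \<in> keys a" "l \<in> keys b"
      using Poly_Mapping.keys_mult[of a b] by blast
    then show "keys m \<subseteq> T"
      using Poly_Mapping.keys_add[of k l] ab unfolding PR_def by blast
  qed
qed (simp_all add: PR_def)

lemma const_PR [simp]: "const c \<in> PR T"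
  by (simp add: const_def PR_def)

lemma var_PR: "i \<in> T \<Longrightarrow> var i \<in> PR T"
  by (simp add: var_def PR_def)

lemma const_0 [simp]: "const 0 = 0" and const_1 [simp]: "const 1 = 1"
  and const_add: "const (a + b) = const a + const b" and const_mult: "const (a * b) = const a * const b"
  by (simp_all add: const_def single_add mult_single)

lemma const_eq_0_iff [simp]: "const c = 0 \<longleftrightarrow> c = 0"
  unfolding const_def by (metis lookup_single_eq lookup_zero single_zero)

lemma sum_singles: "p = (\<Sum>m\<in>keys p. single m (lookup p m))"
proof (rule poly_mapping_eqI)
  fix k
  show "lookup p k = lookup (\<Sum>m\<in>keys p. single m (lookup p m)) k"
    by (auto simp: lookup_sum lookup_single when_def sum.delta' in_keys_iff)
qed

definition mon :: "(nat \<Rightarrow> 'b::comm_ring_1) \<Rightarrow> (nat \<Rightarrow>\<^sub>0 nat) \<Rightarrow> 'b" where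
  "mon x m = (\<Prod>i\<in>keys m. x i ^ lookup m i)"

lemma mon_superset: "finite A \<Longrightarrow> keys m \<subseteq> A \<Longrightarrow> mon x m = (\<Prod>i\<in>A. x i ^ lookup m i)"
  unfolding mon_def by (rule prod.mono_neutral_left) (auto simp: in_keys_iff)

lemma mon_0 [simp]: "mon x 0 = 1"
  by (simp add: mon_def)

lemma mon_add: "mon x (k + l) = mon x k * mon x l"
proof -
  let ?A = "keys k \<union> keys l"
  have "mon x (k + l) = (\<Prod>i\<in>?A. x i ^ lookup (k + l) i)"
    using Poly_Mapping.keys_add[of k l] by (intro mon_superset) auto
  also have "\<dots> = (\<Prod>i\<in>?A. x i ^ lookup k i) * (\<Prod>i\<in>?A. x i ^ lookup l i)"
    by (simp add: lookup_add power_add prod.distrib)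
  also have "\<dots> = mon x k * mon x l"
    using mon_superset[of ?A k x] mon_superset[of ?A l x] by simp
  finally show ?thesis .
qed

text \<open>The coefficient map and the target ring are left open: the same construction gives
  evaluation at points, the univariate view in one variable and base change to the algebraic
  closure.\<close>

definition peval :: "('k::field \<Rightarrow> 'b::comm_ring_1) \<Rightarrow> (nat \<Rightarrow> 'b) \<Rightarrow> 'k mpoly \<Rightarrow> 'b" where
  "peval h x p = (\<Sum>m\<in>keys p. h (lookup p m) * mon x m)"

lemma poly_eval_eq_peval: "poly_eval p x = peval to_ac x p"
  unfolding poly_eval_def peval_def mon_def by simp

locale coeff_hom =
  fixes h :: "'k::field \<Rightarrow> 'b::comm_ring_1"
  assumes hom_0 [simp]: "h 0 = 0" and hom_1 [simp]: "h 1 = 1"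
    and hom_add: "h (a + b) = h a + h b" and hom_mult: "h (a * b) = h a * h b"
begin

lemma peval_superset: "finite A \<Longrightarrow> keys p \<subseteq> A \<Longrightarrow> peval h x p = (\<Sum>m\<in>A. h (lookup p m) * mon x m)"
  unfolding peval_def by (rule sum.mono_neutral_left) (auto simp: in_keys_iff)

lemma peval_0 [simp]: "peval h x 0 = 0"
  by (simp add: peval_def)

lemma peval_add: "peval h x (p + q) = peval h x p + peval h x q"
proof -
  let ?A = "keys p \<union> keys q"
  have "peval h x (p + q) = (\<Sum>m\<in>?A. h (lookup (p + q) m) * mon x m)"
    using Poly_Mapping.keys_add[of p q] by (intro peval_superset) auto
  also have "\<dots> = (\<Sum>m\<in>?A. h (lookup p m) * mon x m) + (\<Sum>m\<in>?A. h (lookup q m) * mon x m)"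
    by (simp add: lookup_add hom_add distrib_right sum.distrib)
  also have "\<dots> = peval h x p + peval h x q"
    using peval_superset[of ?A p x] peval_superset[of ?A q x] by simp
  finally show ?thesis .
qed

lemma peval_single: "peval h x (single m c) = h c * mon x m"
  using peval_superset[of "{m}" "single m c" x] by simp

lemma peval_sum: "peval h x (\<Sum>i\<in>A. g i) = (\<Sum>i\<in>A. peval h x (g i))"
  by (induction A rule: infinite_finite_induct) (simp_all add: peval_add)

lemma peval_const [simp]: "peval h x (const c) = h c"
  by (simp add: const_def peval_single)

lemma peval_1 [simp]: "peval h x 1 = 1"
  using peval_const[of x 1] by simp

lemma peval_var [simp]: "peval h x (var i) = x i"
  by (simp add: var_def peval_single mon_def)

lemma peval_mult: "peval h x (p * q) = peval h x p * peval h x q"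
proof -
  have "p * q = (\<Sum>k\<in>keys p. \<Sum>l\<in>keys q. single (k + l) (lookup p k * lookup q l))"
    by (subst sum_singles[of p], subst sum_singles[of q]) (simp add: sum_product mult_single)
  then have "peval h x (p * q) = (\<Sum>k\<in>keys p. \<Sum>l\<in>keys q. (h (lookup p k) * mon x k) * (h (lookup q l) * mon x l))"
    by (simp add: peval_sum peval_single mon_add hom_mult mult_ac)
  also have "\<dots> = peval h x p * peval h x q"
    by (simp add: peval_def sum_product)
  finally show ?thesis .
qed

lemma peval_uminus: "peval h x (- p) = - peval h x p"
  using peval_add[of x "- p" p] by (simp add: eq_neg_iff_add_eq_0)

lemma peval_diff: "peval h x (p - q) = peval h x p - peval h x q"
  using peval_add[of x p "- q"] by (simp add: peval_uminus)

lemma peval_power: "peval h x (p ^ k) = peval h x p ^ k"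
  by (induction k) (simp_all add: peval_mult)

end

interpretation const: coeff_hom const
  by unfold_locales (simp_all add: const_add const_mult)

interpretation to_ac: coeff_hom "to_ac :: 'k::field \<Rightarrow> 'k alg_closure"
  by unfold_locales simp_all

lemma var_power: "var i ^ k = single (single i k) 1"
  by (induction k) (simp_all add: var_def mult_single flip: single_add)

lemma mon_var: "mon var m = single m 1"
proof -
  have "(\<Prod>i\<in>A. single (single i (f i)) 1) =
      (single (\<Sum>i\<in>A. single i (f i)) 1 :: 'a mpoly)" for A and f :: "nat \<Rightarrow> nat"
    by (induction A rule: infinite_finite_induct) (simp_all add: mult_single)
  then show ?thesis
    unfolding mon_def var_power using sum_singles[of m] by simp
qed

lemma peval_var_id: "peval const var p = p"
proof -
  have "peval const var p = (\<Sum>m\<in>keys p. single m (lookup p m))"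
    by (simp add: peval_def mon_var const_def mult_single)
  then show ?thesis using sum_singles[of p] by simp
qed

lemma PR_induct [consumes 1, case_names const var add mult]:
  fixes p :: "'k::field mpoly"
  assumes p: "p \<in> PR T"
    and const: "\<And>c. Q (const c)" and var: "\<And>i. i \<in> T \<Longrightarrow> Q (var i)"
    and add: "\<And>p q. Q p \<Longrightarrow> Q q \<Longrightarrow> Q (p + q)" and mult: "\<And>p q. Q p \<Longrightarrow> Q q \<Longrightarrow> Q (p * q)"
  shows "Q p"
proof -
  have Q0: "Q 0" and Q1: "Q 1" using const[of 0] const[of 1] by simp_all
  have pow: "Q (q ^ k)" if "Q q" for q k
    by (induction k) (simp_all add: Q1 mult that)
  have prod: "Q (\<Prod>i\<in>A. g i)" if "\<And>i. i \<in> A \<Longrightarrow> Q (g i)" for A :: "nat set" and g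
    using that by (induction A rule: infinite_finite_induct) (simp_all add: Q1 mult)
  have sum: "Q (\<Sum>i\<in>A. g i)" if "\<And>i. i \<in> A \<Longrightarrow> Q (g i)" for A :: "(nat \<Rightarrow>\<^sub>0 nat) set" and g
    using that by (induction A rule: infinite_finite_induct) (simp_all add: Q0 add)
  have "Q (peval const var p)"
    unfolding peval_def mon_def
  proof (intro sum mult const prod pow)
    fix m i assume "m \<in> keys p" "i \<in> keys m"
    then show "Q (var i)" using p var unfolding PR_def by blast
  qed
  then show ?thesis by (simp add: peval_var_id)
qed

lemma peval_cong_PR:
  assumes "coeff_hom h" "p \<in> PR T" "\<And>i. i \<in> T \<Longrightarrow> x i = y i"
  shows "peval h x p = peval h y p"
proof -
  interpret coeff_hom h by fact
  show ?thesis using assms(2)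
    by (induction rule: PR_induct) (simp_all add: assms(3) peval_add peval_mult)
qed

section \<open>Multivariate polynomials as univariate ones over the other variables\<close>

definition uni :: "nat \<Rightarrow> 'k::field mpoly \<Rightarrow> 'k mpoly poly" where
  "uni i = peval (\<lambda>c. [:const c:]) (\<lambda>j. if j = i then [:0, 1:] else [:var j:])"

interpretation pconst: coeff_hom "\<lambda>c::'k::field. [:const c:]"
  by unfold_locales (simp_all add: const_add const_mult one_pCons)

lemma uni_add: "uni i (p + q) = uni i p + uni i q"
  and uni_mult: "uni i (p * q) = uni i p * uni i q"
  and uni_uminus: "uni i (- p) = - uni i p"
  and uni_diff: "uni i (p - q) = uni i p - uni i q"
  and uni_0 [simp]: "uni i 0 = 0" and uni_1 [simp]: "uni i 1 = 1"
  by (simp_all add: uni_def pconst.peval_add pconst.peval_mult pconst.peval_uminus pconst.peval_diff)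

lemma uni_const: "uni i (const c) = [:const c:]" and uni_var: "uni i (var j) = (if j = i then [:0, 1:] else [:var j:])"
  by (simp_all add: uni_def)

lemma uni_id:
  assumes "p \<in> PR T" "i \<notin> T"
  shows "uni i p = [:p:]"
  using assms(1)
proof (induction rule: PR_induct)
  case (var j)
  then show ?case using assms(2) by (auto simp: uni_var)
qed (simp_all add: uni_const uni_add uni_mult)

lemma PR_UNIV: "p \<in> PR UNIV"
  by (simp add: PR_def)

lemma poly_uni: "poly (uni i p) (var i) = p"
  using PR_UNIV[of p]
  by (induction rule: PR_induct) (simp_all add: uni_const uni_add uni_mult uni_var)

lemma uni_eq_0_iff [simp]: "uni i p = 0 \<longleftrightarrow> p = 0"
  using poly_uni[of i p] by auto

lemma uni_upoly:
  assumes "p \<in> PR (insert i T)"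
  shows "uni i p \<in> carrier_ring.upoly (PR (T - {i}))"
  using assms
proof (induction rule: PR_induct)
  case (var j)
  then show ?case by (auto simp: uni_var var_PR)
qed (simp_all add: uni_const uni_add uni_mult)

section \<open>Hilbert's basis theorem\<close>

text \<open>A monotone subsequence that does not increase is decreasing, hence constant from its
  minimum on.\<close>

lemma nat_incseq_subseq: "\<exists>r::nat \<Rightarrow> nat. strict_mono r \<and> incseq (\<lambda>k. s (r k))" for s :: "nat \<Rightarrow> nat"
proof -
  obtain r :: "nat \<Rightarrow> nat" where r: "strict_mono r" "monoseq (\<lambda>k. s (r k))"
    using seq_monosub[of s] by auto
  show ?thesis
  proof (cases "incseq (\<lambda>k. s (r k))")
    case False
    then have dec: "s (r l) \<le> s (r k)" if "k \<le> l" for k l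
      using r(2) that unfolding monoseq_def incseq_def by blast
    define N where "N = (ARG_MIN (\<lambda>k. s (r k)) k. True)"
    have "s (r N) \<le> s (r k)" for k
      unfolding N_def by (rule arg_min_nat_le) simp
    then have "s (r (N + k)) = s (r N)" for k
      using dec[of N "N + k"] by (simp add: antisym)
    then have "incseq (\<lambda>k. s (r (N + k)))" by (simp add: incseq_def)
    moreover have "strict_mono (\<lambda>k. r (N + k))"
      using r(1) by (simp add: strict_mono_def)
    ultimately show ?thesis by blast
  qed (use r in blast)
qed

text \<open>Passing to nondecreasing subsequences one coordinate at a time makes all exponents
  monotone simultaneously; any two members of the result then compare.\<close>

lemma dickson:
  fixes m :: "nat \<Rightarrow> (nat \<Rightarrow>\<^sub>0 nat)"
  assumes "finite T" "\<And>k. keys (m k) \<subseteq> T"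
  shows "\<exists>i j. i < j \<and> (\<forall>t. lookup (m i) t \<le> lookup (m j) t)"
proof -
  have "\<exists>r::nat \<Rightarrow> nat. strict_mono r \<and> (\<forall>t\<in>T. incseq (\<lambda>k. lookup (m (r k)) t))"
    using assms(1)
  proof (induction T)
    case empty
    show ?case by (intro exI[of _ id]) (simp add: strict_mono_def)
  next
    case (insert t T)
    then obtain r :: "nat \<Rightarrow> nat" where r: "strict_mono r" "\<forall>t\<in>T. incseq (\<lambda>k. lookup (m (r k)) t)"
      by auto
    obtain q :: "nat \<Rightarrow> nat" where q: "strict_mono q" "incseq (\<lambda>k. lookup (m (r (q k))) t)"
      using nat_incseq_subseq[of "\<lambda>k. lookup (m (r k)) t"] by auto
    have "strict_mono (\<lambda>k. r (q k))" using r q by (simp add: strict_mono_def)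
    moreover have "incseq (\<lambda>k. lookup (m (r (q k))) t')" if "t' \<in> T" for t'
    proof -
      have "q k \<le> q l" if "k \<le> l" for k l
        using q(1) that by (simp add: strict_mono_less_eq)
      then show ?thesis using r(2) that unfolding incseq_def by simp
    qed
    ultimately show ?case using q(2) by (intro exI[of _ "\<lambda>k. r (q k)"] conjI) simp_all
  qed
  then obtain r :: "nat \<Rightarrow> nat" where r: "strict_mono r" "\<And>t. t \<in> T \<Longrightarrow> incseq (\<lambda>k. lookup (m (r k)) t)"
    by auto
  have "r 0 < r 1" using r(1) by (simp add: strict_mono_def)
  moreover have "lookup (m (r 0)) t \<le> lookup (m (r 1)) t" for t
  proof (cases "t \<in> T")
    case True
    then show ?thesis using r(2)[of t] unfolding incseq_def by simp
  next
    case False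
    then have "t \<notin> keys (m (r 0))" using assms(2) by blast
    then show ?thesis by (simp add: in_keys_iff)
  qed
  ultimately show ?thesis by blast
qed

text \<open>The order on exponent vectors is lexicographic, so the first nonzero coordinate
  decides.\<close>

lemma monomial_nonneg: "0 \<le> (d :: nat \<Rightarrow>\<^sub>0 nat)"
proof (cases "d = 0")
  case False
  then obtain k0 where "lookup d k0 \<noteq> 0"
    by (metis lookup_zero poly_mapping_eqI)
  define k where "k = (LEAST k. lookup d k \<noteq> 0)"
  have "lookup d k \<noteq> 0" unfolding k_def by (rule LeastI) fact
  moreover have "lookup d k' = 0" if "k' < k" for k'
    using not_less_Least[of k' "\<lambda>k. lookup d k \<noteq> 0"] that unfolding k_def by blast
  ultimately have "0 < d"
    by (transfer fixing: k) (auto simp: less_fun_def intro!: exI[of _ k])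
  then show ?thesis by simp
qed simp

text \<open>In a descending sequence Dickson's lemma finds an earlier vector dividing a later one,
  and divisibility forces the opposite order. The restriction to finitely many variables matters:
  the unit vectors form an infinite descending sequence.\<close>

lemma wf_monomials:
  assumes "finite T"
  shows "wf {(a, b :: nat \<Rightarrow>\<^sub>0 nat). a < b \<and> keys a \<subseteq> T \<and> keys b \<subseteq> T}" (is "wf ?R")
  unfolding wf_iff_no_infinite_down_chain
proof
  assume "\<exists>m. \<forall>i. (m (Suc i), m i) \<in> ?R"
  then obtain m where "\<forall>i. (m (Suc i), m i) \<in> ?R" ..
  then have m: "\<And>i. m (Suc i) < m i" "\<And>i. keys (m i) \<subseteq> T"
    by auto
  obtain i j where ij: "i < j" "\<And>t. lookup (m i) t \<le> lookup (m j) t"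
    using dickson[OF assms m(2)] by blast
  have "m j = m i + (m j - m i)"
    by (rule poly_mapping_eqI) (simp add: lookup_add lookup_minus ij(2))
  then have "m i \<le> m j" using monomial_nonneg add_increasing2 by (metis order_refl)
  moreover have "m j < m i"
    using ij(1)
  proof (induction rule: strict_inc_induct)
    case (base i)
    then show ?case using m(1)[of i] by simp
  next
    case (step i)
    then show ?case using m(1)[of i] by simp
  qed
  ultimately show False by simp
qed

lemma lookup_single_mult:
  "lookup (single d c * p) (d + k) = c * lookup p k" for p :: "'k::field mpoly"
proof -
  have "single d c * p = (\<Sum>m\<in>keys p. single (d + m) (c * lookup p m))"
    by (subst sum_singles[of p]) (simp add: sum_distrib_left mult_single)
  then show ?thesis
    by (auto simp: lookup_sum lookup_single when_def sum.delta' in_keys_iff)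
qed

text \<open>A strictly ascending chain supplies \<open>f k\<close>, new at stage \<open>k\<close>
  and with a least leading monomial among the new elements. By Dickson's lemma one of these
  monomials divides a later one, and cancelling the latter leaves a new element with a smaller
  leading monomial.\<close>

theorem noetherian_PR:
  assumes T: "finite T"
  shows "noetherian_carrier_ring (PR T :: 'k::field mpoly set)"
proof (unfold_locales, rule ccontr)
  fix F :: "'k mpoly set set"
  assume F: "F \<noteq> {}" "\<And>I. I \<in> F \<Longrightarrow> PR.idl T I" and no: "\<not> (\<exists>M\<in>F. \<forall>I\<in>F. M \<subseteq> I \<longrightarrow> I = M)"
  have "\<exists>I. \<forall>k::nat. I k \<in> F \<and> I k \<subset> I (Suc k)"
    by (rule dependent_nat_choice) (use F no in auto)
  then obtain I :: "nat \<Rightarrow> 'k mpoly set" where "\<forall>k. I k \<in> F \<and> I k \<subset> I (Suc k)" ..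
  then have I: "\<And>k. I k \<in> F" "\<And>k. I k \<subset> I (Suc k)"
    by auto
  have idlI: "PR.idl T (I k)" for k using F(2) I(1) by blast
  have Imono: "I k \<subseteq> I l" if "k \<le> l" for k l
    using lift_Suc_mono_le[of I k l] I(2) that by blast
  define lm where "lm p = Max (keys p)" for p :: "'k mpoly"
  define D where "D k = I (Suc k) - I k" for k
  have D_ne: "p \<noteq> 0" if "p \<in> D k" for p k using that PR.idlD(2)[OF idlI] unfolding D_def by blast
  have D_PR: "p \<in> PR T" if "p \<in> D k" for p k using that PR.idlD(1)[OF idlI] unfolding D_def by blast
  have lm_keys: "lm p \<in> keys p" if "p \<noteq> 0" for p
    unfolding lm_def using that by (intro Max_in) (simp_all add: keys_eq_empty)
  have lm_T: "keys (lm p) \<subseteq> T" if "p \<in> D k" for p k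
    using lm_keys[OF D_ne[OF that]] D_PR[OF that] unfolding PR_def by blast
  have "\<exists>p. p \<in> D k \<and> (\<forall>q\<in>D k. \<not> lm q < lm p)" for k
  proof -
    obtain p0 where "p0 \<in> D k" using I(2)[of k] unfolding D_def by blast
    then have ne: "lm p0 \<in> lm ` D k" by simp
    obtain b where b: "b \<in> lm ` D k"
      "\<forall>a. (a, b) \<in> {(a, b). a < b \<and> keys a \<subseteq> T \<and> keys b \<subseteq> T} \<longrightarrow> a \<notin> lm ` D k"
      using wf_monomials[OF T, unfolded wf_eq_minimal, rule_format, OF ne] by (elim bexE)
    obtain p where p: "p \<in> D k" "b = lm p" using b(1) by blast
    have "\<not> lm q < lm p" if "q \<in> D k" for q
    proof
      assume "lm q < lm p"
      then have "lm q \<notin> lm ` D k" using b(2)[rule_format, of "lm q"] p(2) lm_T[OF p(1)] lm_T[OF that] by simp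
      then show False using that by simp
    qed
    then show ?thesis using p by blast
  qed
  then have "\<exists>f. \<forall>k. f k \<in> D k \<and> (\<forall>q\<in>D k. \<not> lm q < lm (f k))"
    by (intro choice allI)
  then obtain f where "\<forall>k. f k \<in> D k \<and> (\<forall>q\<in>D k. \<not> lm q < lm (f k))" ..
  then have f: "\<And>k. f k \<in> D k" "\<And>k q. q \<in> D k \<Longrightarrow> \<not> lm q < lm (f k)"
    by simp_all
  obtain i j where ij: "i < j" "\<And>t. lookup (lm (f i)) t \<le> lookup (lm (f j)) t"
    using dickson[OF T, of "\<lambda>k. lm (f k)"] lm_T[OF f(1)] by blast
  define d where "d = lm (f j) - lm (f i)"
  have lmj: "lm (f j) = d + lm (f i)"
    by (rule poly_mapping_eqI) (simp add: d_def lookup_add lookup_minus ij(2))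
  define c where "c = lookup (f j) (lm (f j)) / lookup (f i) (lm (f i))"
  have ci: "lookup (f i) (lm (f i)) \<noteq> 0" using lm_keys[OF D_ne[OF f(1)]] by (simp add: in_keys_iff)
  define s where "s = single d c * f i"
  define g where "g = f j - s"
  have "keys d \<subseteq> keys (lm (f j))"
  proof
    fix t assume "t \<in> keys d"
    then show "t \<in> keys (lm (f j))" by (simp add: d_def in_keys_iff lookup_minus)
  qed
  then have "single d c \<in> PR T"
    using lm_T[OF f(1)[of j]] unfolding PR_def by auto
  moreover have "f i \<in> I j" using f(1)[of i] Imono[of "Suc i" j] ij(1) unfolding D_def by auto
  ultimately have sI: "s \<in> I j" unfolding s_def using PR.idlD(4)[OF idlI] by blast
  have "g \<in> I (Suc j)"
    unfolding g_def using f(1)[of j] sI Imono[of j "Suc j"] unfolding D_def by (intro PR.idlD(7)[OF idlI]) auto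
  moreover have "g \<notin> I j"
  proof
    assume "g \<in> I j"
    then have "f j \<in> I j" using PR.idl_add_cancel[OF idlI, of "f j" s] sI by (simp add: g_def)
    then show False using f(1)[of j] unfolding D_def by blast
  qed
  ultimately have gD: "g \<in> D j" unfolding D_def by blast
  have le: "k \<le> lm (f j)" if "k \<in> keys g" for k
  proof -
    have "k \<in> keys (f j) \<or> k \<in> keys s"
      using that by (auto simp: g_def in_keys_iff lookup_minus)
    then show ?thesis
    proof
      assume "k \<in> keys (f j)"
      then show ?thesis unfolding lm_def by simp
    next
      assume "k \<in> keys s"
      then obtain l where l: "k = d + l" "l \<in> keys (f i)"
        using Poly_Mapping.keys_mult[of "single d c" "f i"] unfolding s_def
        by (auto split: if_splits)
      then have "l \<le> lm (f i)" unfolding lm_def by simp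
      then show ?thesis unfolding lmj l(1) by (rule add_left_mono)
    qed
  qed
  have "lookup s (lm (f j)) = c * lookup (f i) (lm (f i))"
    unfolding s_def lmj by (rule lookup_single_mult)
  then have "lookup g (lm (f j)) = 0"
    using ci by (simp add: g_def lookup_minus c_def)
  then have "lm g \<noteq> lm (f j)" using lm_keys[OF D_ne[OF gD]] by (auto simp: in_keys_iff)
  then have "lm g < lm (f j)" using le[OF lm_keys[OF D_ne[OF gD]]] by simp
  then show False using f(2)[OF gD] by blast
qed


section \<open>Transcendence bases modulo a prime ideal\<close>

interpretation NR: noetherian_carrier_ring "PR {1..n} :: 'k::field mpoly set" for n
  by (rule noetherian_PR) simp

abbreviation Rn :: "nat \<Rightarrow> 'k::field mpoly set" where "Rn n \<equiv> PR {1..n}"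
abbreviation idl where "idl n \<equiv> PR.idl {1..n}"
abbreviation gen where "gen n \<equiv> PR.gen {1..n}"
abbreviation prm where "prm n \<equiv> PR.prm {1..n}"
abbreviation loc where "loc n \<equiv> PR.loc {1..n}"
abbreviation minimal_over where "minimal_over n \<equiv> PR.minimal_over {1..n}"

text \<open>
  \<open>S\<close> indexes a transcendence basis, chosen among the variables, of the residue ring of \<open>P\<close>.
\<close>

locale prime_basis =
  fixes n :: nat and P :: "'k::field mpoly set" and S :: "nat set"
  assumes prm_P: "prm n P" and S_le: "S \<subseteq> {1..n}" and indep: "P \<inter> PR S = {0}"
    and dep: "\<And>y. y \<in> {1..n} - S \<Longrightarrow> \<exists>G \<in> P \<inter> PR (insert y S). G \<noteq> 0"
begin

lemma idl_P: "idl n P"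
  using PR.prmD(1)[OF prm_P] .

lemmas P_0 = PR.idlD(2)[OF idl_P]
  and P_add = PR.idlD(3)[OF idl_P]
  and P_mult = PR.idlD(4,5)[OF idl_P]
  and P_diff = PR.idlD(7)[OF idl_P]
  and P_cancel = PR.idl_add_cancel[OF idl_P]
  and P_prime = PR.prm_mult_iff[OF prm_P]

lemma C_I: "T \<subseteq> {1..n} \<Longrightarrow> p \<in> PR T \<Longrightarrow> p \<in> Rn n"
  using PR_mono by blast

lemma S_notin: "l \<in> PR S \<Longrightarrow> l \<noteq> 0 \<Longrightarrow> l \<notin> P"
  using indep by blast

lemma P_power: "a \<in> Rn n \<Longrightarrow> a \<notin> P \<Longrightarrow> a ^ N \<notin> P"
  using PR.prm_power[OF prm_P] by blast

text \<open>The residue ring of \<open>PR T\<close> becomes a field once the nonzero polynomials in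
  the basis variables are inverted; this expresses algebraicity over the basis.\<close>

definition invertible :: "nat set \<Rightarrow> bool" where
  "invertible T \<longleftrightarrow>
    (\<forall>b\<in>PR T. b \<notin> P \<longrightarrow> (\<exists>w\<in>PR T. \<exists>l\<in>PR S. l \<noteq> 0 \<and> b * w - l \<in> P))"

text \<open>Bounds denominators: a fraction \<open>a / u\<close> over the basis variables that is
  represented by an element of \<open>PR T\<close> modulo \<open>P\<close> has a power of
  \<open>g\<close> as denominator.\<close>

definition denominator :: "nat set \<Rightarrow> 'k mpoly \<Rightarrow> bool" where
  "denominator T g \<longleftrightarrow> g \<in> PR S \<and> g \<noteq> 0 \<and>
    (\<forall>u\<in>PR S. \<forall>a\<in>PR S. \<forall>h\<in>PR T. u * h - a \<in> P \<longrightarrow> (\<exists>N. \<exists>w\<in>PR S. g ^ N * a = u * w))"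

lemma invertible_base: "invertible S"
  unfolding invertible_def
proof (intro ballI impI)
  fix b assume b: "b \<in> PR S" "b \<notin> P"
  then have "b \<noteq> 0" using P_0 by auto
  then show "\<exists>w\<in>PR S. \<exists>l\<in>PR S. l \<noteq> 0 \<and> b * w - l \<in> P"
    using b P_0 by (intro bexI[of _ 1] bexI[of _ b]) simp_all
qed

lemma denominator_base: "denominator S 1"
  unfolding denominator_def
proof (intro conjI ballI impI)
  fix u a h :: "'k mpoly" assume *: "u \<in> PR S" "a \<in> PR S" "h \<in> PR S" "u * h - a \<in> P"
  then have "u * h - a \<in> P \<inter> PR S" by simp
  then have "u * h - a = 0" using indep by simp
  then show "\<exists>N. \<exists>w\<in>PR S. 1 ^ N * a = u * w" using * by auto
qed simp_all

context
  fixes T :: "nat set" and y :: nat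
  assumes T: "S \<subseteq> T" "T \<subseteq> {1..n}" and y: "y \<in> {1..n}" "y \<notin> T"
begin

private abbreviation (input) "U \<equiv> PR.upoly T :: 'k mpoly poly set"
private abbreviation (input) "ev q \<equiv> poly q (var y :: 'k mpoly)"

private lemma TC: "a \<in> PR T \<Longrightarrow> a \<in> Rn n"
  using T(2) by (rule C_I)

private lemma SC: "a \<in> PR S \<Longrightarrow> a \<in> Rn n"
  using S_le by (rule C_I)

private lemma SiT: "a \<in> PR S \<Longrightarrow> a \<in> PR T"
  using PR_mono[OF T(1)] by blast

private lemma yT_C: "a \<in> PR (insert y T) \<Longrightarrow> a \<in> Rn n"
  using T(2) y(1) by (intro C_I[of "insert y T"]) auto

private lemma ev_mem: "q \<in> U \<Longrightarrow> ev q \<in> PR (insert y T)"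
proof (rule PR.poly_mem)
  assume "q \<in> U"
  then show "q \<in> PR.upoly (insert y T)"
    using PR_mono[of T "insert y T"] unfolding PR.upoly_def by auto
qed (simp add: var_PR)

private lemma ev_C: "q \<in> U \<Longrightarrow> ev q \<in> Rn n"
  using ev_mem yT_C by blast

private lemma uni_U: "b \<in> PR (insert y T) \<Longrightarrow> uni y b \<in> U"
  using uni_upoly[of b y T] y(2) by simp

text \<open>Dropping leading terms with coefficient in \<open>P\<close> changes the value only by an
  element of \<open>P\<close>. In this way polynomials over \<open>PR T\<close> are treated as
  polynomials over the residue domain.\<close>

private lemma trim:
  assumes "q \<in> U" "coeff q k \<notin> P"
  shows "\<exists>q'\<in>U. lead_coeff q' \<notin> P \<and> degree q' \<le> degree q \<and> ev q - ev q' \<in> P"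
  using assms
proof (induction "degree q" arbitrary: q rule: less_induct)
  case less
  show ?case
  proof (cases "lead_coeff q \<in> P")
    case False
    then show ?thesis using less.prems P_0 by (intro bexI[of _ q]) simp_all
  next
    case True
    define q' where "q' = q - monom (lead_coeff q) (degree q)"
    have cq': "coeff q' i = (if i = degree q then 0 else coeff q i)" for i
      by (simp add: q'_def)
    have k: "k \<noteq> degree q" using True less.prems(2) by auto
    have "coeff q k \<noteq> 0" using less.prems(2) P_0 by auto
    then have "k < degree q" using k le_degree[of q k] by simp
    moreover have "degree q' \<le> degree q"
      by (rule degree_le) (simp add: cq' coeff_eq_0)
    ultimately have deg: "degree q' < degree q"
      using cq'[of "degree q"] by (intro PR.degree_less_of_coeff_0) simp_all
    have q'U: "q' \<in> U"
      unfolding q'_def using less.prems(1) PR.upolyD[OF less.prems(1)] by simp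
    have "coeff q' k \<notin> P" using cq' k less.prems(2) by simp
    then obtain q'' where q'': "q'' \<in> U" "lead_coeff q'' \<notin> P" "degree q'' \<le> degree q'" "ev q' - ev q'' \<in> P"
      using less.hyps[OF deg q'U] by auto
    have "ev q - ev q' = lead_coeff q * var y ^ degree q"
      by (simp add: q'_def poly_monom)
    also have "\<dots> \<in> P" using True y(1) by (intro P_mult(2)) (simp_all add: var_PR)
    finally have "ev q - ev q' + (ev q' - ev q'') \<in> P" using q''(4) by (rule P_add)
    then show ?thesis using q'' deg by (intro bexI[of _ q'']) simp_all
  qed
qed

text \<open>A minimal polynomial of the variable \<open>y\<close> over the residue ring of
  \<open>PR T\<close>. One exists because the relation supplied by \<open>dep\<close> has as its
  leading coefficient in \<open>y\<close> a nonzero polynomial in the basis variables, which avoids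
  \<open>P\<close>.\<close>

private lemma min_poly:
  obtains \<mu> where "\<mu> \<in> U" "lead_coeff \<mu> \<notin> P" "ev \<mu> \<in> P" "degree \<mu> > 0"
    "\<And>q k. q \<in> U \<Longrightarrow> degree q < degree \<mu> \<Longrightarrow> ev q \<in> P \<Longrightarrow> coeff q k \<in> P"
proof -
  let ?M = "\<lambda>m. m \<in> U \<and> lead_coeff m \<notin> P \<and> ev m \<in> P"
  obtain G where G: "G \<in> P" "G \<in> PR (insert y S)" "G \<noteq> 0"
    using dep[of y] y T(1) by blast
  have GU: "uni y G \<in> PR.upoly (S - {y})" using G(2) by (rule uni_upoly)
  have "PR (S - {y}) \<subseteq> (PR S :: 'k mpoly set)" by (rule PR_mono) auto
  then have lS: "coeff (uni y G) k \<in> PR S" for k using PR.upolyD[OF GU] by blast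
  have "?M (uni y G)"
  proof (intro conjI)
    show "uni y G \<in> U" using lS SiT unfolding PR.upoly_def by auto
    show "lead_coeff (uni y G) \<notin> P" using S_notin[OF lS] G(3) by simp
    show "ev (uni y G) \<in> P" using G(1) by (simp add: poly_uni)
  qed
  then obtain \<mu> where \<mu>: "?M \<mu>" and min: "\<And>m. ?M m \<Longrightarrow> degree \<mu> \<le> degree m"
    using ex_has_least_nat[of ?M _ degree] by auto
  have "degree \<mu> > 0"
  proof (rule ccontr)
    assume "\<not> degree \<mu> > 0"
    then obtain c where "\<mu> = [:c:]" using degree_eq_zeroE by blast
    then show False using \<mu> by simp
  qed
  moreover have "coeff q k \<in> P" if q: "q \<in> U" "degree q < degree \<mu>" "ev q \<in> P" for q k
  proof (rule ccontr)
    assume "coeff q k \<notin> P"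
    then obtain q' where q': "q' \<in> U" "lead_coeff q' \<notin> P" "degree q' \<le> degree q" "ev q - ev q' \<in> P"
      using trim[OF q(1)] by blast
    then have "ev q' \<in> P" using P_cancel[of "ev q" "ev q'"] q(3) by simp
    then show False using min[of q'] q' q(2) by simp
  qed
  ultimately show thesis using that \<mu> by blast
qed

text \<open>A Euclidean argument against the minimal polynomial \<open>\<mu>\<close>: a multiple of
  \<open>b\<close> outside \<open>P\<close> of least degree in \<open>y\<close> is constant in
  \<open>y\<close>, since otherwise dividing \<open>\<mu>\<close> by it would leave a smaller
  multiple or factor \<open>\<mu>\<close>. The constant is inverted by the hypothesis on
  \<open>T\<close>.\<close>

lemma invertible_insert:
  assumes inv: "invertible T"
  shows "invertible (insert y T)"
  unfolding invertible_def
proof (intro ballI impI)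
  fix b assume b: "b \<in> PR (insert y T)" "b \<notin> P"
  obtain \<mu> where \<mu>: "\<mu> \<in> U" "lead_coeff \<mu> \<notin> P" "ev \<mu> \<in> P" "degree \<mu> > 0"
    and low: "\<And>q k. q \<in> U \<Longrightarrow> degree q < degree \<mu> \<Longrightarrow> ev q \<in> P \<Longrightarrow> coeff q k \<in> P"
    using min_poly by blast
  have bC: "b \<in> Rn n" using b(1) by (rule yT_C)
  let ?M = "\<lambda>c. c \<in> U \<and> lead_coeff c \<notin> P \<and> ev c \<notin> P \<and> (\<exists>w\<in>PR (insert y T). b * w - ev c \<in> P)"
  have trimM: "\<exists>c. ?M c \<and> degree c \<le> degree q"
    if q: "q \<in> U" "ev q \<notin> P" "w \<in> PR (insert y T)" "b * w - ev q \<in> P" for q w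
  proof -
    have "\<exists>k. coeff q k \<notin> P"
    proof (rule ccontr)
      assume "\<nexists>k. coeff q k \<notin> P"
      then have "ev q \<in> P"
        unfolding poly_altdef using y(1)
        by (intro PR.idl_sum[OF idl_P] P_mult(2)) (simp_all add: var_PR)
      then show False using q(2) by simp
    qed
    then obtain c where c: "c \<in> U" "lead_coeff c \<notin> P" "degree c \<le> degree q" "ev q - ev c \<in> P"
      using trim[OF q(1)] by blast
    have "(b * w - ev q) + (ev q - ev c) \<in> P" using q(4) c(4) by (rule P_add)
    then have "b * w - ev c \<in> P" by simp
    moreover have "ev c \<notin> P" using P_cancel[OF c(4)] q(2) by simp
    ultimately show ?thesis using c q(3) by blast
  qed
  have "\<exists>c. ?M c \<and> degree c \<le> degree (uni y b)"
    using b P_0 by (intro trimM[of _ 1]) (simp_all add: uni_U poly_uni)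
  then obtain c0 where c0: "?M c0" by blast
  obtain c where c: "?M c" and min: "\<And>m. ?M m \<Longrightarrow> degree c \<le> degree m"
    using ex_has_least_nat[of ?M c0 degree] c0 by blast
  then obtain w where w: "w \<in> PR (insert y T)" "b * w - ev c \<in> P" by blast
  have wC: "w \<in> Rn n" using w(1) by (rule yT_C)
  have cC: "ev c \<in> Rn n" and cP: "ev c \<notin> P" and cU: "c \<in> U" and lcP: "lead_coeff c \<notin> P"
    using c ev_C by blast+
  have lc_mem: "lead_coeff c \<in> PR T" "lead_coeff \<mu> \<in> PR T"
    using PR.upolyD[OF cU] PR.upolyD[OF \<mu>(1)] by blast+
  have smaller: "degree c \<le> degree q"
    if q: "q \<in> U" "ev q \<notin> P" "v \<in> PR (insert y T)" "v * ev c - ev q \<in> P" for q v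
  proof -
    have vC: "v \<in> Rn n" using q(3) by (rule yT_C)
    have "v * (b * w - ev c) + (v * ev c - ev q) \<in> P"
      by (rule P_add[OF P_mult(1)[OF w(2) vC] q(4)])
    then have "b * (v * w) - ev q \<in> P" by (simp add: algebra_simps)
    moreover have "v * w \<in> PR (insert y T)" using q(3) w(1) by simp
    ultimately obtain m where m: "?M m" "degree m \<le> degree q"
      using trimM[of q "v * w"] q(1,2) by blast
    show ?thesis using min[OF m(1)] m(2) by simp
  qed
  have "degree c = 0"
  proof (rule ccontr)
    assume "degree c \<noteq> 0"
    have "degree c < degree \<mu>"
    proof (rule ccontr)
      assume "\<not> degree c < degree \<mu>"
      obtain N s r where d: "s \<in> U" "r \<in> U" "smult (lead_coeff \<mu> ^ N) c = s * \<mu> + r" "degree r < degree \<mu>"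
        using PR.pseudo_division[OF \<mu>(1,4) cU] by blast
      have e: "lead_coeff \<mu> ^ N * ev c - ev r = ev s * ev \<mu>"
        using arg_cong[OF d(3), of ev] by simp
      have "ev s * ev \<mu> \<in> P" using P_mult(1)[OF \<mu>(3) ev_C[OF d(1)]] .
      then have eP: "lead_coeff \<mu> ^ N * ev c - ev r \<in> P" by (simp add: e)
      have "lead_coeff \<mu> ^ N * ev c \<notin> P"
        using P_prime[of "lead_coeff \<mu> ^ N" "ev c"] P_power[of "lead_coeff \<mu>" N] TC[OF lc_mem(2)] \<mu>(2) cC cP
        by simp
      then have "ev r \<notin> P" using P_cancel[OF eP] by simp
      moreover have "lead_coeff \<mu> ^ N \<in> PR (insert y T)"
        using lc_mem(2) PR_mono[of T "insert y T"] by (intro PR.power_C) blast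
      ultimately have "degree c \<le> degree r" using smaller[OF d(2) _ _ eP] by simp
      then show False using d(4) \<open>\<not> degree c < degree \<mu>\<close> by simp
    qed
    obtain N s r where d: "s \<in> U" "r \<in> U" "smult (lead_coeff c ^ N) \<mu> = s * c + r" "degree r < degree c"
      using PR.pseudo_division[OF cU _ \<mu>(1)] \<open>degree c \<noteq> 0\<close> by blast
    have "lead_coeff c ^ N * ev \<mu> = ev s * ev c + ev r"
      using arg_cong[OF d(3), of ev] by simp
    moreover have "lead_coeff c ^ N * ev \<mu> \<in> P"
      using \<mu>(3) TC[OF lc_mem(1)] by (intro P_mult(1)) simp_all
    ultimately have eP: "ev s * ev c + ev r \<in> P" by simp
    have "ev r \<in> P"
    proof (rule ccontr)
      assume "ev r \<notin> P"
      have "0 - (ev s * ev c + ev r) \<in> P" using P_0 eP by (rule P_diff)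
      moreover have "0 - (ev s * ev c + ev r) = - ev s * ev c - ev r" by (simp add: algebra_simps)
      ultimately have "- ev s * ev c - ev r \<in> P" by (simp only:)
      moreover have "- ev s \<in> PR (insert y T)" using ev_mem[OF d(1)] by simp
      ultimately show False using smaller[OF d(2) \<open>ev r \<notin> P\<close>] d(4) by fastforce
    qed
    then have "ev s * ev c \<in> P" using P_diff[OF eP] by fastforce
    \<comment> \<open>Here \<open>c\<close> would divide \<open>\<mu>\<close> modulo
      \<open>P\<close>. The cofactor \<open>s\<close> has its value in \<open>P\<close> and degree
      below \<open>\<mu>\<close>, so its leading coefficient is in \<open>P\<close>, which
      \<open>lead\<close> contradicts.\<close>
    then have sP: "ev s \<in> P" using P_prime[OF ev_C[OF d(1)] cC] cP by blast
    have "lead_coeff c \<noteq> 0" "lead_coeff \<mu> \<noteq> 0" using lcP \<mu>(2) P_0 by auto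
    then have nz: "lead_coeff c ^ N \<noteq> 0" "\<mu> \<noteq> 0" "c \<noteq> 0" by auto
    have lead: "lead_coeff (s * c) = lead_coeff c ^ N * lead_coeff \<mu>" "degree (s * c) = degree \<mu>"
    proof -
      have "s * c = smult (lead_coeff c ^ N) \<mu> - r" by (simp add: d(3))
      moreover have "degree (smult (lead_coeff c ^ N) \<mu>) = degree \<mu>" using nz by simp
      moreover have "degree r < degree \<mu>" using d(4) \<open>degree c < degree \<mu>\<close> by simp
      ultimately show *: "degree (s * c) = degree \<mu>"
        by (metis degree_add_eq_right degree_minus diff_conv_add_uminus add.commute)
      show "lead_coeff (s * c) = lead_coeff c ^ N * lead_coeff \<mu>"
        unfolding * using \<open>s * c = _\<close> \<open>degree r < degree \<mu>\<close> by (simp add: coeff_eq_0)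
    qed
    then have "s \<noteq> 0" using nz by auto
    then have "degree s < degree \<mu>" using lead(2) nz(3) \<open>degree c \<noteq> 0\<close> by (simp add: degree_mult_eq)
    then have "lead_coeff s \<in> P" using low[OF d(1) _ sP] by blast
    moreover have "lead_coeff s * lead_coeff c = lead_coeff c ^ N * lead_coeff \<mu>"
      using lead(1) by (simp add: lead_coeff_mult)
    ultimately have "lead_coeff c ^ N * lead_coeff \<mu> \<in> P"
      using P_mult(2)[of "lead_coeff s" "lead_coeff c"] TC[OF lc_mem(1)] by simp
    then show False
      using P_prime[of "lead_coeff c ^ N" "lead_coeff \<mu>"] P_power[of "lead_coeff c" N] TC[OF lc_mem(1)] TC[OF lc_mem(2)] lcP \<mu>(2)
      by simp
  qed
  then obtain c' where c': "c = [:c':]" using degree_eq_zeroE by blast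
  have c'm: "c' \<in> PR T" "c' \<notin> P" using lc_mem(1) lcP c' by simp_all
  obtain w' l where l: "w' \<in> PR T" "l \<in> PR S" "l \<noteq> 0" "c' * w' - l \<in> P"
    using inv c'm unfolding invertible_def by blast
  have "w' * (b * w - c') + (c' * w' - l) \<in> P"
    using w(2) c' TC[OF l(1)] l(4) by (intro P_add P_mult(1)) simp_all
  then have "b * (w * w') - l \<in> P" by (simp add: algebra_simps)
  moreover have "w * w' \<in> PR (insert y T)"
    using w(1) l(1) PR_mono[of T "insert y T"] by (intro PR.mult_C) blast+
  ultimately show "\<exists>w\<in>PR (insert y T). \<exists>l\<in>PR S. l \<noteq> 0 \<and> b * w - l \<in> P"
    using l by blast
qed

text \<open>Up to a power of the leading coefficient of \<open>\<mu>\<close>, which \<open>v\<close>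
  converts into a power of \<open>l\<close> in \<open>PR S\<close>, division by \<open>\<mu>\<close>
  brings \<open>h\<close> below the degree of \<open>\<mu>\<close>. There a relation modulo
  \<open>P\<close> holds coefficientwise, and its constant coefficient is a relation over
  \<open>T\<close>; this is the origin of the denominator \<open>g * l\<close>.\<close>

lemma denominator_insert:
  assumes inv: "invertible T" and g: "denominator T g"
  shows "\<exists>g. denominator (insert y T) g"
proof -
  have gS: "g \<in> PR S" "g \<noteq> 0"
    and den: "\<And>u a h. u \<in> PR S \<Longrightarrow> a \<in> PR S \<Longrightarrow> h \<in> PR T \<Longrightarrow> u * h - a \<in> P \<Longrightarrow>
      \<exists>N. \<exists>w\<in>PR S. g ^ N * a = u * w"
    using g unfolding denominator_def by blast+
  obtain \<mu> where \<mu>: "\<mu> \<in> U" "lead_coeff \<mu> \<notin> P" "ev \<mu> \<in> P" "degree \<mu> > 0"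
    and low: "\<And>q k. q \<in> U \<Longrightarrow> degree q < degree \<mu> \<Longrightarrow> ev q \<in> P \<Longrightarrow> coeff q k \<in> P"
    using min_poly by blast
  have \<mu>T: "lead_coeff \<mu> \<in> PR T" using PR.upolyD[OF \<mu>(1)] by blast
  obtain v l where v: "v \<in> PR T" "l \<in> PR S" "l \<noteq> 0" "lead_coeff \<mu> * v - l \<in> P"
    using inv \<mu>T \<mu>(2) unfolding invertible_def by blast
  have "\<exists>N. \<exists>w\<in>PR S. (g * l) ^ N * a = u * w"
    if u: "u \<in> PR S" and a: "a \<in> PR S" and h: "h \<in> PR (insert y T)" and uh: "u * h - a \<in> P" for u a h
  proof -
    obtain N s r where d: "s \<in> U" "r \<in> U" "smult (lead_coeff \<mu> ^ N) (uni y h) = s * \<mu> + r" "degree r < degree \<mu>"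
      using PR.pseudo_division[OF \<mu>(1,4) uni_U[OF h]] by blast
    have e1: "lead_coeff \<mu> ^ N * h = ev s * ev \<mu> + ev r"
      using arg_cong[OF d(3), of ev] by (simp add: poly_uni)
    have powP: "(lead_coeff \<mu> * v) ^ N - l ^ N \<in> P"
    proof (induction N)
      case 0
      then show ?case using P_0 by simp
    next
      case (Suc N)
      have "(lead_coeff \<mu> * v) * ((lead_coeff \<mu> * v) ^ N - l ^ N) + l ^ N * (lead_coeff \<mu> * v - l) \<in> P"
        using Suc v(4) TC[OF \<mu>T] TC[OF v(1)] SC[OF v(2)] by (intro P_add P_mult(1)) simp_all
      then show ?case by (simp add: algebra_simps)
    qed
    define q where "q = smult (u * v ^ N) r - [:l ^ N * a:]"
    have qU: "q \<in> U"
      unfolding q_def using d(2) u v(1,2) a by (simp add: SiT)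
    have "degree q < degree \<mu>"
    proof -
      have "degree q \<le> max (degree r) 0"
        unfolding q_def by (intro degree_diff_le_max[THEN order_trans] max.mono) (simp_all add: degree_smult_le)
      then show ?thesis using d(4) by simp
    qed
    moreover have "ev q \<in> P"
    proof -
      have vC: "v ^ N \<in> Rn n" "u \<in> Rn n" "l ^ N \<in> Rn n" "h \<in> Rn n"
        using TC[OF v(1)] SC[OF u] SC[OF v(2)] yT_C[OF h] by simp_all
      have "ev q = u * v ^ N * ev r - l ^ N * a" by (simp add: q_def)
      also have "ev r = lead_coeff \<mu> ^ N * h - ev s * ev \<mu>" by (simp add: e1)
      also have "u * v ^ N * (lead_coeff \<mu> ^ N * h - ev s * ev \<mu>) - l ^ N * a =
          u * h * ((lead_coeff \<mu> * v) ^ N - l ^ N) + l ^ N * (u * h - a) - u * v ^ N * ev s * ev \<mu>"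
        by (simp add: algebra_simps power_mult_distrib)
      also have "\<dots> \<in> P"
        using vC ev_C[OF d(1)]
        by (intro P_diff[OF P_add[OF P_mult(1)[OF powP] P_mult(1)[OF uh]] P_mult(1)[OF \<mu>(3)]]) simp_all
      finally show ?thesis .
    qed
    ultimately have "coeff q 0 \<in> P" using low[OF qU] by blast
    moreover have "coeff q 0 = u * (v ^ N * coeff r 0) - l ^ N * a" by (simp add: q_def mult.assoc)
    ultimately have "u * (v ^ N * coeff r 0) - l ^ N * a \<in> P" by simp
    moreover have "v ^ N * coeff r 0 \<in> PR T" using v(1) PR.upolyD[OF d(2)] by simp
    moreover have "l ^ N * a \<in> PR S" using v(2) a by simp
    ultimately obtain M w where w: "w \<in> PR S" "g ^ M * (l ^ N * a) = u * w"
      using den[OF u] by blast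
    have "(g * l) ^ (M + N) * a = (g ^ N * l ^ M) * (g ^ M * (l ^ N * a))"
      by (simp add: power_mult_distrib power_add mult_ac)
    also have "\<dots> = u * (g ^ N * l ^ M * w)" unfolding w(2) by (simp only: mult_ac)
    finally show ?thesis using w(1) gS(1) v(2) by (intro exI[of _ "M + N"] bexI[of _ "g ^ N * l ^ M * w"]) simp_all
  qed
  then have "denominator (insert y T) (g * l)"
    using gS v(2,3) unfolding denominator_def by simp
  then show ?thesis ..
qed

end

lemma invertible_denominator_all: "invertible {1..n} \<and> (\<exists>g. denominator {1..n} g)"
proof -
  have "invertible (S \<union> A) \<and> (\<exists>g. denominator (S \<union> A) g)" if "finite A" "A \<subseteq> {1..n}" for A
    using that
  proof (induction A)
    case empty
    then show ?case using invertible_base denominator_base by auto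
  next
    case (insert y A)
    then have IH: "invertible (S \<union> A)" "\<exists>g. denominator (S \<union> A) g" by auto
    show ?case
    proof (cases "y \<in> S \<union> A")
      case True
      then have "S \<union> insert y A = S \<union> A" by auto
      then show ?thesis using IH by simp
    next
      case False
      have T: "S \<subseteq> S \<union> A" "S \<union> A \<subseteq> {1..n}" "y \<in> {1..n}" using insert.prems S_le by auto
      show ?thesis
        using invertible_insert[OF T False IH(1)] denominator_insert[OF T False IH(1)] IH(2) by auto
    qed
  qed
  from this[of "{1..n}"] show ?thesis using S_le by (simp add: Un_absorb1)
qed

lemma basis_inverse:
  "b \<in> Rn n \<Longrightarrow> b \<notin> P \<Longrightarrow> \<exists>w\<in>Rn n. \<exists>l\<in>PR S. l \<noteq> 0 \<and> b * w - l \<in> P"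
  using invertible_denominator_all unfolding invertible_def by blast

text \<open>
  The polynomial \<open>u = 1 + x g l\<close> below is coprime to \<open>g\<close>, so it cannot become a unit modulo \<open>P\<close>
  after inverting the nonzero polynomials in the variables \<open>S - {x}\<close>.
\<close>

lemma going_up:
  assumes x: "x \<in> S" and b: "b \<in> Rn n" "b \<notin> P"
  obtains P' where "prm n P'" "P \<subset> P'" "P' \<inter> PR (S - {x}) = {0}" "b \<notin> P'"
proof -
  have SC: "a \<in> Rn n" if "a \<in> PR S" for a :: "'k mpoly" using C_I[OF S_le that] .
  have S'S: "a \<in> PR S" if "a \<in> PR (S - {x})" for a :: "'k mpoly"
    using that PR_mono[of "S - {x}" S] by blast
  obtain w l where l: "w \<in> Rn n" "l \<in> PR S" "l \<noteq> 0" "b * w - l \<in> P"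
    using basis_inverse[OF b] by blast
  obtain g where g: "g \<in> PR S" "g \<noteq> 0"
    and den: "\<And>u a h. u \<in> PR S \<Longrightarrow> a \<in> PR S \<Longrightarrow> h \<in> Rn n \<Longrightarrow> u * h - a \<in> P \<Longrightarrow>
      \<exists>N. \<exists>w\<in>PR S. g ^ N * a = u * w"
    using invertible_denominator_all unfolding denominator_def by blast
  \<comment> \<open>The factor \<open>l\<close> keeps \<open>b\<close> out of the new prime:
    \<open>b \<in> P'\<close> would force \<open>l \<in> P'\<close>, and then
    \<open>1 = u - var x * g * l\<close> would be in \<open>P'\<close>.\<close>
  define u :: "'k mpoly" where "u = 1 + var x * (g * l)"
  have uS: "u \<in> PR S" unfolding u_def using g l x by (simp add: var_PR)
  have uni_u: "uni x u = 1 + pCons 0 (uni x (g * l))"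
    by (simp add: u_def uni_add uni_mult uni_var)
  have "uni x (g * l) \<noteq> 0" using g l by simp
  then have deg_u: "degree (uni x u) > 0"
    unfolding uni_u one_pCons add_pCons by simp
  have u_dvd: "a = 0" if a: "a \<in> PR (S - {x})" and w: "w \<in> PR S" "a = u * w" for a w
  proof (rule ccontr)
    assume "a \<noteq> 0"
    have "[:a:] = uni x u * uni x w"
      using uni_id[OF a, of x] w(2) by (simp add: uni_mult)
    moreover have "uni x u \<noteq> 0" "uni x w \<noteq> 0" using \<open>a \<noteq> 0\<close> w(2) by auto
    ultimately have "degree [:a:] = degree (uni x u) + degree (uni x w)"
      by (simp add: degree_mult_eq del: uni_eq_0_iff)
    then show False using deg_u by simp
  qed
  let ?M = "{a \<in> PR (S - {x}) :: 'k mpoly set. a \<noteq> 0}"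
  let ?J = "gen n (insert u P)"
  have J: "?J = {p + h * u | p h. p \<in> P \<and> h \<in> Rn n}"
    by (rule PR.gen_insert[OF idl_P SC[OF uS]])
  have idlJ: "idl n ?J"
    using PR.idlD(1)[OF idl_P] SC[OF uS] by (intro PR.idl_gen) auto
  have "a = 0" if a: "a \<in> PR (S - {x})" "a \<in> ?J" for a
  proof -
    obtain p h where ph: "a = p + h * u" "p \<in> P" "h \<in> Rn n" using a(2) unfolding J by blast
    have "0 - p \<in> P" using P_0 ph(2) by (rule P_diff)
    moreover have "0 - p = u * h - a" unfolding ph(1) by (simp add: mult.commute)
    ultimately have "u * h - a \<in> P" by (simp only:)
    then obtain N v where v: "v \<in> PR S" "g ^ N * a = u * v"
      using den[OF uS S'S[OF a(1)] ph(3)] by blast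
    \<comment> \<open>Modulo \<open>u\<close> the element \<open>- (var x * l) * g\<close> is 1, so
      divisibility of \<open>g ^ N * a\<close> by \<open>u\<close> passes to
      \<open>a\<close>.\<close>
    have "\<exists>q\<in>PR S. (- (var x * l) * g) ^ N = 1 + u * q"
    proof (induction N)
      case 0
      then show ?case by (intro bexI[of _ 0]) simp_all
    next
      case (Suc N)
      then obtain q where q: "q \<in> PR S" "(- (var x * l) * g) ^ N = 1 + u * q" by blast
      have eq: "- (var x * l) * g = 1 - u" by (simp add: u_def mult_ac)
      have "(- (var x * l) * g) ^ Suc N = (1 - u) * (1 + u * q)"
        using q(2) eq by simp
      also have "\<dots> = 1 + u * (q - 1 - u * q)" by (simp add: algebra_simps)
      finally show ?case using q(1) uS by (intro bexI[of _ "q - 1 - u * q"]) simp_all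
    qed
    then obtain q where q: "q \<in> PR S" "(- (var x * l) * g) ^ N = 1 + u * q" by blast
    have "a = (- (var x * l) * g) ^ N * a - u * (q * a)"
      unfolding q(2) by (simp add: algebra_simps)
    also have "\<dots> = (- (var x * l)) ^ N * (g ^ N * a) - u * (q * a)"
      by (simp only: power_mult_distrib mult.assoc)
    also have "\<dots> = u * ((- (var x * l)) ^ N * v - q * a)"
      unfolding v(2) by (simp add: algebra_simps)
    finally show ?thesis
      using q(1) v(1) x l(2) S'S[OF a(1)] by (intro u_dvd[OF a(1)]) (simp_all add: var_PR)
  qed
  then have disj: "?M \<inter> ?J = {}" by blast
  obtain P' where P': "prm n P'" "?J \<subseteq> P'" "P' \<inter> ?M = {}"
  proof (rule NR.prime_avoiding_elements[OF idlJ _ _ _ disj])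
    show "?M \<subseteq> Rn n" using S'S SC by auto
    show "1 \<in> ?M" by simp
  qed simp_all
  have sub: "P \<subseteq> P'" "u \<in> P'"
    using P'(2) PR.gen_superset[of "insert u P"] by auto
  have "u \<noteq> 0" using deg_u by auto
  then have "u \<notin> P" using S_notin[OF uS] by blast
  moreover have "b \<notin> P'"
  proof
    assume "b \<in> P'"
    then have "b * w \<in> P'" using PR.idlD(5)[OF PR.prmD(1)[OF P'(1)]] l(1) by blast
    then have "l \<in> P'"
      using PR.idl_add_cancel[OF PR.prmD(1)[OF P'(1)], of "b * w" l] l(4) sub(1) by blast
    then have "var x * g * l \<in> P'"
      using PR.idlD(4)[OF PR.prmD(1)[OF P'(1)]] SC[of "var x * g"] g x by (simp add: var_PR)
    then have "u - var x * g * l \<in> P'"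
      using PR.idlD(7)[OF PR.prmD(1)[OF P'(1)]] sub(2) by blast
    then show False using PR.prmD(2)[OF P'(1)] by (simp add: u_def mult.assoc)
  qed
  moreover have "P' \<inter> PR (S - {x}) = {0}"
    using P'(3) PR.idlD(2)[OF PR.prmD(1)[OF P'(1)]] by auto
  ultimately show thesis using that P'(1) sub by blast
qed

section \<open>A regular sequence at the prime from the dependent variables\<close>

lemma uni_upoly_Rn:
  assumes "(p :: 'k mpoly) \<in> Rn n" "y \<in> {1..n}"
  shows "uni y p \<in> PR.upoly {1..n}"
proof -
  have "PR ({1..n} - {y}) \<subseteq> (Rn n :: 'k mpoly set)" by (rule PR_mono) blast
  then show ?thesis
    using uni_upoly[of p y "{1..n}"] assms unfolding PR.upoly_def by (auto simp: insert_absorb)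
qed

text \<open>Generators that are free of \<open>y\<close> are constants in the univariate view, so
  the ideal is extended from the other variables and membership passes to coefficients.\<close>

lemma coeff_uni_gen:
  fixes A :: "'k mpoly set"
  assumes G: "\<And>g. g \<in> A \<Longrightarrow> g \<in> PR ({1..n} - {y})" and y: "y \<in> {1..n}" and p: "p \<in> gen n A"
  shows "coeff (uni y p) k \<in> gen n A"
proof -
  let ?I = "gen n A" and ?J = "{p \<in> Rn n. \<forall>k. coeff (uni y p) k \<in> gen n A}"
  have A: "A \<subseteq> Rn n" using G PR_mono[of "{1..n} - {y}" "{1..n}"] by blast
  note I = PR.idl_gen[OF A]
  have "idl n ?J"
  proof (rule PR.idlI)
    fix a b assume "a \<in> ?J" "b \<in> ?J"
    then show "a + b \<in> ?J" using PR.idlD(3)[OF I] by (simp add: uni_add)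
  next
    fix a r :: "'k mpoly" assume a: "a \<in> ?J" and r: "r \<in> Rn n"
    have "coeff (uni y (r * a)) k \<in> ?I" for k
      unfolding uni_mult coeff_mult
      using a by (intro PR.idl_sum[OF I] PR.idlD(4)[OF I] PR.upolyD[OF uni_upoly_Rn[OF r y]]) simp_all
    then show "r * a \<in> ?J" using a r by simp
  qed (use PR.idlD(2)[OF I] in auto)
  moreover have "A \<subseteq> ?J"
  proof
    fix g assume g: "g \<in> A"
    have "uni y g = [:g:]" using uni_id[OF G[OF g], of y] by simp
    then have "coeff (uni y g) k \<in> ?I" for k
      using g PR.gen_superset[of A] PR.idlD(2)[OF I] by (cases k) (auto simp: coeff_pCons)
    then show "g \<in> ?J" using g A by auto
  qed
  ultimately have "?I \<subseteq> ?J" by (rule PR.gen_minimal)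
  then show ?thesis using p by blast
qed

text \<open>The leading coefficient of \<open>G y\<close> in \<open>y\<close> is a nonzero
  polynomial in the basis variables and hence a unit at \<open>P\<close>, while the relations of the
  other variables are free of \<open>y\<close>. So \<open>coeffs_mult_cancel\<close> makes
  \<open>G y\<close> a nonzerodivisor modulo any of them.\<close>

lemma regular_sequence_exists:
  "\<exists>gs. length gs = n - card S \<and> PR.regular {1..n} P {0} gs"
proof -
  have "\<forall>y. \<exists>G. y \<in> {1..n} - S \<longrightarrow> G \<in> P \<inter> PR (insert y S) \<and> G \<noteq> 0"
    using dep by blast
  then have "\<exists>G. \<forall>y. y \<in> {1..n} - S \<longrightarrow> G y \<in> P \<inter> PR (insert y S) \<and> G y \<noteq> 0"
    by (rule choice)
  then obtain G where "\<forall>y. y \<in> {1..n} - S \<longrightarrow> G y \<in> P \<inter> PR (insert y S) \<and> G y \<noteq> 0" ..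
  then have G: "\<And>y. y \<in> {1..n} - S \<Longrightarrow> G y \<in> P" "\<And>y. y \<in> {1..n} - S \<Longrightarrow> G y \<in> PR (insert y S)"
    "\<And>y. y \<in> {1..n} - S \<Longrightarrow> G y \<noteq> 0"
    by simp_all
  have GC: "G y \<in> Rn n" if "y \<in> {1..n} - S" for y
    using PR.idlD(1)[OF idl_P G(1)[OF that]] .
  have nzd: "a \<in> loc n P (gen n (G ` A))"
    if A: "A \<subseteq> {1..n} - S" and y: "y \<in> {1..n} - S" "y \<notin> A" and a: "a \<in> Rn n" "a * G y \<in> gen n (G ` A)"
    for A y a
  proof -
    let ?I = "gen n (G ` A)"
    have I: "idl n ?I" using A GC by (intro PR.idl_gen) blast
    have GA: "g \<in> PR ({1..n} - {y})" if "g \<in> G ` A" for g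
    proof -
      obtain z where z: "z \<in> A" "g = G z" using \<open>g \<in> G ` A\<close> by blast
      have "insert z S \<subseteq> {1..n} - {y}" using z(1) A y S_le by blast
      moreover have "g \<in> PR (insert z S)" unfolding z(2) using A z(1) by (intro G(2)) blast
      ultimately show ?thesis using PR_mono by blast
    qed
    have qu: "coeff (uni y a * uni y (G y)) k \<in> ?I" for k
      using coeff_uni_gen[OF GA _ a(2), of k] y by (simp add: uni_mult)
    let ?l = "lead_coeff (uni y (G y))"
    obtain N where N: "\<And>k. ?l ^ N * coeff (uni y a) k \<in> ?I"
      using PR.coeffs_mult_cancel[OF I uni_upoly_Rn[OF GC[OF y(1)]] uni_upoly_Rn[OF a(1)] qu] y(1) by blast
    have "?l ^ N * a = (\<Sum>k\<le>degree (uni y a). ?l ^ N * coeff (uni y a) k * var y ^ k)"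
      by (subst poly_uni[of y a, symmetric]) (simp add: poly_altdef sum_distrib_left mult.assoc)
    also have "\<dots> \<in> ?I"
      by (intro PR.idl_sum[OF I] PR.idlD(5)[OF I N]) (use y(1) in \<open>simp add: var_PR\<close>)
    finally have "?l ^ N * a \<in> ?I" .
    moreover have lS: "?l \<in> PR S"
    proof -
      have "PR (S - {y}) \<subseteq> (PR S :: 'k mpoly set)" by (rule PR_mono) blast
      then show ?thesis using PR.upolyD[OF uni_upoly[OF G(2)[OF y(1)]]] by blast
    qed
    moreover have "?l \<notin> P" using S_notin[OF lS] G(3)[OF y(1)] by simp
    ultimately show ?thesis
      using a(1) C_I[OF S_le lS] P_power[of ?l N] by (intro PR.locI[of _ _ "?l ^ N"]) simp_all
  qed
  have reg: "PR.regular {1..n} P (gen n (G ` A)) (map G ys)"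
    if "distinct ys" "set ys \<subseteq> {1..n} - S" "A \<subseteq> {1..n} - S" "A \<inter> set ys = {}" for ys A
    using that
  proof (induction ys arbitrary: A)
    case (Cons y ys)
    have y: "y \<in> {1..n} - S" "y \<notin> A" and A: "A \<subseteq> {1..n} - S" using Cons.prems by auto
    have GA: "G ` A \<subseteq> Rn n" "{G y} \<subseteq> Rn n" using A y(1) GC by blast+
    have "gen n (insert (G y) (gen n (G ` A))) = gen n (G ` insert y A)"
      using PR.gen_gen_Un[OF GA] by simp
    moreover have "PR.regular {1..n} P (gen n (G ` insert y A)) (map G ys)"
      using Cons.prems by (intro Cons.IH) auto
    ultimately show ?case using G(1)[OF y(1)] nzd[OF A y] by simp
  qed simp
  obtain ys where ys: "set ys = {1..n} - S" "distinct ys"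
    using finite_distinct_list[of "{1..n} - S"] by auto
  have "gen n {} = {0 :: 'k mpoly}"
    using PR.gen_minimal[OF PR.idl_0, of "{}"] PR.idlD(2)[OF PR.idl_gen, of "{}"] by blast
  then have "PR.regular {1..n} P {0} (map G ys)"
    using reg[of ys "{}"] ys by simp
  moreover have "length (map G ys) = n - card S"
    using distinct_card[OF ys(2)] ys(1) S_le by (simp add: card_Diff_subset finite_subset)
  ultimately show ?thesis by blast
qed

end

text \<open>For a prime this is the transcendence degree of the residue field, computed from sets of
  variables only; \<open>K_dim_zero_set\<close> identifies it with the dimension.\<close>

definition trd :: "nat \<Rightarrow> 'k::field mpoly set \<Rightarrow> nat" where
  "trd n P = Max (card ` {S. S \<subseteq> {1..n} \<and> P \<inter> PR S = {0}})"

lemma indep_finite: "finite {S. S \<subseteq> {1..n} \<and> P \<inter> PR S = {0 :: 'k::field mpoly}}"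
  by (rule finite_subset[of _ "Pow {1..n}"]) auto

lemma card_le_trd: "S \<subseteq> {1..n} \<Longrightarrow> P \<inter> PR S = {0} \<Longrightarrow> card S \<le> trd n P"
  unfolding trd_def using indep_finite by (intro Max_ge) auto

lemma indep_empty:
  fixes P :: "'k::field mpoly set"
  assumes "prm n P"
  shows "P \<inter> PR {} = {0}"
proof -
  have "p = 0" if p: "p \<in> P" "p \<in> PR {}" for p
  proof (rule ccontr)
    assume "p \<noteq> 0"
    have "m = 0" if "m \<in> keys p" for m
      using p(2) that unfolding PR_def by auto
    then have "p = const (lookup p 0)"
      by (intro poly_mapping_eqI) (auto simp: const_def lookup_single when_def in_keys_iff)
    then have "const (inverse (lookup p 0)) * p = 1"
      using \<open>p \<noteq> 0\<close> by (metis const_1 const_eq_0_iff const_mult field_class.field_inverse)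
    moreover have "const (inverse (lookup p 0)) * p \<in> P"
      using PR.idlD(4)[OF PR.prmD(1)[OF assms] p(1)] by simp
    ultimately show False using PR.prmD(2)[OF assms] by simp
  qed
  then show ?thesis using PR.idlD(2)[OF PR.prmD(1)[OF assms]] by auto
qed

lemma prime_basisI:
  assumes P: "prm n P" and S: "S \<subseteq> {1..n}" "P \<inter> PR S = {0}" "card S = trd n P"
  shows "prime_basis n P S"
proof
  fix y assume y: "y \<in> {1..n} - S"
  have "card (insert y S) > trd n P"
    using y S finite_subset[OF S(1)] by simp
  then have "P \<inter> PR (insert y S) \<noteq> {0}"
    using card_le_trd[of "insert y S" n P] y S(1) by auto
  then show "\<exists>G\<in>P \<inter> PR (insert y S). G \<noteq> 0"
    using PR.idlD(2)[OF PR.prmD(1)[OF P]] by auto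
qed (use assms in auto)

lemma prime_basis_exists:
  assumes "prm n P"
  obtains S where "prime_basis n P S" "card S = trd n P"
proof -
  let ?F = "{S. S \<subseteq> {1..n} \<and> P \<inter> PR S = {0}}"
  have "trd n P \<in> card ` ?F"
    unfolding trd_def using indep_finite[of n P] indep_empty[OF assms] by (intro Max_in) auto
  then obtain S where "S \<subseteq> {1..n}" "P \<inter> PR S = {0}" "card S = trd n P" by auto
  then show thesis using that prime_basisI[OF assms] by blast
qed

lemma trd_le: "prm n P \<Longrightarrow> trd n P \<le> n"
  by (metis card_atLeastAtMost card_mono diff_Suc_1 finite_atLeastAtMost prime_basis.S_le prime_basis_exists)

text \<open>A basis for \<open>Q\<close> stays independent modulo \<open>P\<close>. Were it a basis
  for \<open>P\<close> too, an element of \<open>Q\<close> outside \<open>P\<close> would divide,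
  modulo \<open>P\<close>, a nonzero polynomial in the basis variables, and \<open>Q\<close>
  contains none.\<close>

lemma trd_strict:
  assumes P: "prm n P" and Q: "prm n Q" and PQ: "P \<subset> Q"
  shows "trd n Q < trd n P"
proof -
  obtain S where S: "prime_basis n Q S" "card S = trd n Q" using prime_basis_exists[OF Q] .
  interpret Q: prime_basis n Q S by fact
  have ind: "P \<inter> PR S = {0}"
    using Q.indep PQ PR.idlD(2)[OF PR.prmD(1)[OF P]] by auto
  then have le: "trd n Q \<le> trd n P" using card_le_trd[OF Q.S_le] S(2) by metis
  have "trd n Q \<noteq> trd n P"
  proof
    assume "trd n Q = trd n P"
    then interpret P: prime_basis n P S
      using prime_basisI[OF P Q.S_le ind] S(2) by simp
    obtain q where q: "q \<in> Q" "q \<notin> P" using PQ by blast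
    have qC: "q \<in> Rn n" using PR.idlD(1)[OF Q.idl_P q(1)] .
    obtain w l where l: "w \<in> Rn n" "l \<in> PR S" "l \<noteq> 0" "q * w - l \<in> P"
      using P.basis_inverse[OF qC q(2)] by blast
    have "q * w \<in> Q" using PR.idlD(5)[OF Q.idl_P q(1) l(1)] .
    then have "l \<in> Q" using PR.idl_add_cancel[OF Q.idl_P, of "q * w" l] l(4) PQ by blast
    then show False using Q.S_notin[OF l(2,3)] by simp
  qed
  then show ?thesis using le by simp
qed

text \<open>The remaining basis variables bound the new dimension from below,
  \<open>trd_strict\<close> bounds it from above. The element \<open>b\<close> is carried along for
  the Nullstellensatz.\<close>

lemma trd_going_up:
  assumes P: "prm n P" and d: "trd n P = Suc d" and b: "b \<in> Rn n" "b \<notin> P"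
  obtains P' where "prm n P'" "P \<subset> P'" "trd n P' = d" "b \<notin> P'"
proof -
  obtain S where S: "prime_basis n P S" "card S = Suc d" using prime_basis_exists[OF P] d by metis
  interpret P: prime_basis n P S by fact
  obtain x where x: "x \<in> S" using S(2) by fastforce
  obtain P' where P': "prm n P'" "P \<subset> P'" "P' \<inter> PR (S - {x}) = {0}" "b \<notin> P'"
    using P.going_up[OF x b] .
  have "d \<le> trd n P'"
    using card_le_trd[of "S - {x}" n P'] P'(3) P.S_le S(2) x by (auto simp: card_Diff_singleton)
  moreover have "trd n P' < Suc d" using trd_strict[OF P P'(1,2)] d by simp
  ultimately show thesis using that P' by simp
qed

lemma affine_height_theorem:
  fixes fs :: "'k::field mpoly list"
  assumes P: "minimal_over n (gen n (set fs)) P" and fs: "set fs \<subseteq> Rn n"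
  shows "n \<le> trd n P + length fs"
proof -
  have pP: "prm n P" and sub: "set fs \<subseteq> P"
    using P PR.gen_superset[of "set fs" "{1..n}"] by (auto simp: PR.minimal_over_def)
  obtain S where S: "prime_basis n P S" "card S = trd n P" using prime_basis_exists[OF pP] .
  obtain gs where gs: "length gs = n - trd n P" "PR.regular {1..n} P {0} gs"
    using prime_basis.regular_sequence_exists[OF S(1)] S(2) by auto
  have "length gs \<le> length fs"
  proof (rule NR.regular_length_le[OF pP sub PR.idl_0 _ gs(2)])
    show "{0} \<subseteq> P" using PR.idlD(2)[OF PR.prmD(1)[OF pP]] by simp
    show "\<exists>N. g ^ N \<in> loc n P (gen n ({0} \<union> set fs))" if "g \<in> P" for g
      unfolding PR.gen_Un_zero[OF fs] using NR.minimal_over_nilpotent[OF P PR.idl_gen[OF fs] that] .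
  qed
  then show ?thesis using gs(1) by simp
qed

lemma nonzerodivisor_of_complete_intersection:
  fixes f :: "'k::field mpoly"
  assumes P: "minimal_over n (gen n (set (xs @ f # ys))) P"
    and d: "trd n P = n - length (xs @ f # ys)" "length (xs @ f # ys) \<le> n"
    and a: "a \<in> Rn n" "a * f \<in> loc n P (gen n (set xs))"
  shows "a \<in> loc n P (gen n (set xs))"
proof -
  have pP: "prm n P" using P by (auto simp: PR.minimal_over_def)
  obtain S where S: "prime_basis n P S" "card S = trd n P" using prime_basis_exists[OF pP] .
  obtain gs where gs: "length gs = n - trd n P" "PR.regular {1..n} P {0} gs"
    using prime_basis.regular_sequence_exists[OF S(1)] S(2) by auto
  show ?thesis
    using d by (intro NR.regular_nonzerodivisor_prefix[OF P gs(2) _ a]) (simp add: gs(1))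
qed


section \<open>The Nullstellensatz\<close>

text \<open>Linear extension from the independent set consisting of 1. The projection plays the part
  of faithful flatness of the field extension when ideals are contracted.\<close>

lemma ac_retraction:
  obtains \<pi> :: "'k::field alg_closure \<Rightarrow> 'k"
  where "\<forall>x y. \<pi> (x + y) = \<pi> x + \<pi> y" "\<forall>c x. \<pi> (to_ac c * x) = c * \<pi> x" "\<pi> 1 = 1"
proof -
  interpret vs: vector_space_pair "\<lambda>c x. to_ac c * x :: 'k alg_closure" "(*) :: 'k \<Rightarrow> 'k \<Rightarrow> 'k"
    by (intro vector_space_pair.intro vector_space.intro) (simp_all add: distrib_left distrib_right)
  have "vs.vs1.independent {1}" by simp
  then have "\<exists>\<pi>. Vector_Spaces.linear (\<lambda>c x. to_ac c * x :: 'k alg_closure) (*) \<pi> \<and> (\<forall>x\<in>{1}. \<pi> x = (1 :: 'k))"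
    by (rule vs.linear_independent_extend)
  then obtain \<pi> where lin: "Vector_Spaces.linear (\<lambda>c x. to_ac c * x :: 'k alg_closure) (*) \<pi>" and 1: "\<pi> 1 = (1 :: 'k)"
    by auto
  interpret \<pi>: Vector_Spaces.linear "\<lambda>c x. to_ac c * x :: 'k alg_closure" "(*) :: 'k \<Rightarrow> 'k \<Rightarrow> 'k" \<pi> by (rule lin)
  show thesis using that[of \<pi>] \<pi>.add \<pi>.scale 1 by simp
qed

text \<open>A prime maximal among the ideals without a power of \<open>g\<close> has dimension 0,
  since otherwise \<open>trd_going_up\<close> would enlarge it and still avoid
  \<open>g\<close>.\<close>

lemma maximal_prime_avoiding_power:
  fixes I :: "'k::field mpoly set"
  assumes I: "idl n I" and g: "g \<in> Rn n" "\<And>N. g ^ N \<notin> I"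
  obtains M where "prm n M" "I \<subseteq> M" "g \<notin> M" "trd n M = 0"
proof -
  let ?G = "range (\<lambda>N. g ^ N)"
  have G: "?G \<subseteq> Rn n" "1 \<in> ?G" "?G \<inter> I = {}"
    using g by (auto intro: range_eqI[of _ _ 0])
  have "x * y \<in> ?G" if "x \<in> ?G" "y \<in> ?G" for x y
    using that by (auto simp flip: power_add)
  then obtain M where M: "prm n M" "I \<subseteq> M" "M \<inter> ?G = {}"
    and max: "\<And>Q. idl n Q \<Longrightarrow> M \<subset> Q \<Longrightarrow> Q \<inter> ?G \<noteq> {}"
    using NR.prime_avoiding_elements[OF I G(1,2) _ G(3)] by metis
  have "g ^ 1 \<in> ?G" by (rule rangeI)
  then have gM: "g \<notin> M" using M(3) by auto
  have "trd n M = 0"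
  proof (cases "trd n M")
    case (Suc d)
    obtain P' where P': "prm n P'" "M \<subset> P'" "g \<notin> P'"
      using trd_going_up[OF M(1) Suc g(1) gM] by metis
    obtain N where "g ^ N \<in> P'" using max[OF PR.prmD(1)[OF P'(1)] P'(2)] by auto
    then show ?thesis using PR.prm_power[OF P'(1) g(1)] P'(3) by blast
  qed
  then show thesis using that M(1,2) gM by blast
qed

lemma const_sum: "const (\<Sum>i\<in>A. f i) = (\<Sum>i\<in>A. const (f i))"
  by (induction A rule: infinite_finite_induct) (simp_all add: const_add)

lemma map_poly_const_mult: "map_poly const (p * q) = map_poly const p * map_poly const q"
  by (intro poly_eqI) (simp add: coeff_map_poly coeff_mult const_sum const_mult)

lemma prm_const_notin:
  assumes "PR.prm T M" "c \<noteq> 0"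
  shows "const c \<notin> M"
proof
  assume "const c \<in> M"
  then have "const (inverse c) * const c \<in> M"
    using PR.idlD(4)[OF PR.prmD(1)[OF assms(1)]] by simp
  then show False using PR.prmD(2)[OF assms(1)] assms(2) by (simp flip: const_mult)
qed

text \<open>Over an algebraically closed field \<open>q\<close> splits into linear factors, and the
  prime must contain one of them at \<open>var i\<close> because nonzero constants are
  units.\<close>

lemma prm_linear_factor:
  fixes M :: "'l::alg_closed_field mpoly set"
  assumes M: "prm n M" and i: "i \<in> {1..n}"
    and q: "q \<noteq> 0" "poly (map_poly const q) (var i) \<in> M"
  shows "\<exists>a. var i - const a \<in> M"
  using q
proof (induction "degree q" arbitrary: q)
  case 0
  then obtain c where c: "q = [:c:]" using degree_eq_zeroE by metis
  then have "const c \<in> M" "c \<noteq> 0" using 0 by (simp_all add: map_poly_pCons)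
  then show ?case using prm_const_notin[OF M] by blast
next
  case (Suc d)
  have evC: "poly (map_poly const p) (var i) \<in> Rn n" for p :: "'l poly"
    using i by (intro PR.poly_mem) (simp_all add: PR.upoly_def coeff_map_poly var_PR)
  obtain a where a: "poly q a = 0" using alg_closed_imp_poly_has_root[of q] Suc by auto
  then obtain q' where q': "q = [:- a, 1:] * q'" by (auto simp: poly_eq_0_iff_dvd)
  have nz: "q' \<noteq> 0" using Suc.prems(1) q' by auto
  have deg: "degree q = Suc (degree q')" unfolding q' using nz by (subst degree_mult_eq) simp_all
  have "poly (map_poly const q) (var i) = (var i - const a) * poly (map_poly const q') (var i)"
    unfolding q' map_poly_const_mult by (simp add: map_poly_pCons const.peval_uminus flip: const_add)
       (simp add: const_def algebra_simps single_uminus)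
  then have "var i - const a \<in> M \<or> poly (map_poly const q') (var i) \<in> M"
    using PR.prm_mult_iff[OF M, of "var i - const a" "poly (map_poly const q') (var i)"] Suc.prems(2) evC i
    by (simp add: var_PR)
  then show ?case using Suc.hyps(1)[of q'] Suc.hyps(2) nz deg by auto
qed

lemma PR_empty: "p \<in> PR {} \<Longrightarrow> p = const (lookup p 0)"
proof (rule poly_mapping_eqI)
  fix m assume p: "p \<in> PR {}"
  show "lookup p m = lookup (const (lookup p 0)) m"
  proof (cases "m = 0")
    case False
    have "m \<notin> keys p" using p False unfolding PR_def by auto
    then show ?thesis using False by (simp add: const_def lookup_single in_keys_iff)
  qed (simp add: const_def)
qed

lemma trd_0_point:
  fixes M :: "'l::alg_closed_field mpoly set"
  assumes M: "prm n M" "trd n M = 0"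
  shows "\<exists>a. \<forall>i\<in>{1..n}. var i - const (a i) \<in> M"
proof -
  obtain S where S: "prime_basis n M S" "card S = 0" using prime_basis_exists[OF M(1)] M(2) by metis
  interpret M: prime_basis n M S by fact
  have S0: "S = {}" using S(2) M.S_le by (simp add: finite_subset)
  have "\<exists>a. var i - const a \<in> M" if i: "i \<in> {1..n}" for i
  proof -
    obtain G where G: "G \<in> M" "G \<in> PR {i}" "G \<noteq> 0" using M.dep[of i] i S0 by auto
    have coeffs: "coeff (uni i G) k = const (lookup (coeff (uni i G) k) 0)" for k
    proof (rule PR_empty)
      have "uni i G \<in> PR.upoly ({} - {i})" by (rule uni_upoly) (use G in simp)
      then show "coeff (uni i G) k \<in> PR {}" using PR.upolyD[of "uni i G" "{}" k] by simp
    qed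
    define q where "q = map_poly (\<lambda>p. lookup p 0) (uni i G)"
    have uq: "uni i G = map_poly const q"
      using coeffs by (intro poly_eqI) (simp add: q_def coeff_map_poly)
    then have "q \<noteq> 0" using G(3) by (metis map_poly_0 uni_eq_0_iff)
    moreover have "poly (map_poly const q) (var i) \<in> M" using G(1) by (simp add: poly_uni flip: uq)
    ultimately show ?thesis using prm_linear_factor[OF M(1) i] by blast
  qed
  then have "\<forall>i. \<exists>a. i \<in> {1..n} \<longrightarrow> var i - const a \<in> M" by blast
  then have "\<exists>a. \<forall>i. i \<in> {1..n} \<longrightarrow> var i - const (a i) \<in> M" by (rule choice)
  then show ?thesis unfolding Ball_def .
qed

text \<open>Interpreting \<open>coeff_hom\<close> for the identity would declare the looping simp rule \<open>0 = 0\<close>.\<close>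

lemma coeff_hom_id: "coeff_hom (\<lambda>c. c)"
  by unfold_locales simp_all

lemmas peval_id = coeff_hom.peval_const[OF coeff_hom_id] coeff_hom.peval_var[OF coeff_hom_id]
  coeff_hom.peval_add[OF coeff_hom_id] coeff_hom.peval_mult[OF coeff_hom_id]

text \<open>Modulo \<open>M\<close> every polynomial is congruent to its value at \<open>a\<close>,
  and \<open>M\<close> contains no nonzero constant.\<close>

lemma point_ideal_mem_iff:
  assumes M: "prm n M" and a: "\<And>i. i \<in> {1..n} \<Longrightarrow> var i - const (a i) \<in> M"
    and p: "p \<in> Rn n"
  shows "p \<in> M \<longleftrightarrow> peval (\<lambda>c. c) a p = 0"
proof -
  note I = PR.prmD(1)[OF M]
  have "p \<in> Rn n \<and> p - const (peval (\<lambda>c. c) a p) \<in> M"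
    using p
  proof (induction rule: PR_induct)
    case (const c)
    then show ?case using PR.idlD(2)[OF I] by (simp add: peval_id)
  next
    case (var i)
    then show ?case using a by (simp add: var_PR peval_id)
  next
    case (add p q)
    then have "(p - const (peval (\<lambda>c. c) a p)) + (q - const (peval (\<lambda>c. c) a q)) \<in> M"
      using PR.idlD(3)[OF I] by blast
    then show ?case using add by (simp add: peval_id const_add algebra_simps)
  next
    case (mult p q)
    then have "p * (q - const (peval (\<lambda>c. c) a q)) + const (peval (\<lambda>c. c) a q) * (p - const (peval (\<lambda>c. c) a p)) \<in> M"
      using PR.idlD(3,4)[OF I] by simp
    then show ?case using mult by (simp add: peval_id const_mult algebra_simps)
  qed
  then have "p \<in> M \<longleftrightarrow> const (peval (\<lambda>c. c) a p) \<in> M"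
    using PR.idl_add_cancel[OF I] by blast
  then show ?thesis using prm_const_notin[OF M] PR.idlD(2)[OF I] by (metis const_0)
qed

section \<open>Base change to the algebraic closure and Hilbert's Nullstellensatz\<close>

definition acm :: "'k::field mpoly \<Rightarrow> 'k alg_closure mpoly" where
  "acm = peval (\<lambda>c. const (to_ac c)) var"

interpretation acc: coeff_hom "\<lambda>c::'k::field. const (to_ac c)"
  by unfold_locales (simp_all add: const_add const_mult)

lemma acm_simps: "acm (const c) = const (to_ac c)" "acm (var i) = var i"
  "acm (p + q) = acm p + acm q" "acm (p * q) = acm p * acm q" "acm (p ^ k) = acm p ^ k"
  by (simp_all add: acm_def acc.peval_add acc.peval_mult acc.peval_power)

lemma acm_PR: "p \<in> PR T \<Longrightarrow> acm p \<in> PR T"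
  by (induction rule: PR_induct) (simp_all add: acm_simps var_PR)

lemma peval_acm: "peval (\<lambda>c. c) a (acm p) = poly_eval p a"
  unfolding poly_eval_eq_peval using PR_UNIV[of p]
  by (induction rule: PR_induct)
     (simp_all add: acm_simps peval_id to_ac.peval_add to_ac.peval_mult)

text \<open>The retraction applied to coefficients, \<open>cpr\<close>, is linear over the
  polynomials with coefficients in the ground field. It therefore maps the extended ideal into
  \<open>J\<close>, and it takes \<open>acm g\<close> back to \<open>g\<close>.\<close>

lemma extension_contraction:
  fixes J :: "'k::field mpoly set"
  assumes J: "idl n J" and g: "acm g \<in> gen n (acm ` J)"
  shows "g \<in> J"
proof -
  obtain \<pi> :: "'k alg_closure \<Rightarrow> 'k" where "\<forall>x y. \<pi> (x + y) = \<pi> x + \<pi> y"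
    "\<forall>c x. \<pi> (to_ac c * x) = c * \<pi> x" "\<pi> 1 = 1"
    by (rule ac_retraction)
  note \<pi> = this[rule_format]
  have \<pi>0: "\<pi> 0 = 0" using \<pi>(2)[of 0 0] by simp
  define cpr :: "'k alg_closure mpoly \<Rightarrow> 'k mpoly" where "cpr = Poly_Mapping.map \<pi>"
  have lookup_cpr: "lookup (cpr p) m = \<pi> (lookup p m)" for p :: "'k alg_closure mpoly" and m
    by (simp add: cpr_def map.rep_eq when_def \<pi>0)
  have cpr_add: "cpr (p + q) = cpr p + cpr q" for p q :: "'k alg_closure mpoly"
    by (rule poly_mapping_eqI) (simp add: lookup_cpr lookup_add \<pi>(1))
  have cpr_0: "cpr 0 = (0 :: 'k mpoly)"
    by (rule poly_mapping_eqI) (simp add: lookup_cpr \<pi>0)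
  have cpr_PR: "cpr p \<in> PR T" if "p \<in> PR T" for p :: "'k alg_closure mpoly" and T
  proof -
    have "keys (cpr p) \<subseteq> keys p" by (auto simp: in_keys_iff lookup_cpr \<pi>0)
    then show ?thesis using that unfolding PR_def by blast
  qed
  have cpr_single: "cpr (single d (to_ac c) * r) = single d c * cpr r" for d c and r :: "'k alg_closure mpoly"
  proof (rule poly_mapping_eqI)
    fix m
    show "lookup (cpr (single d (to_ac c) * r)) m = lookup (single d c * cpr r) m"
    proof (cases "\<exists>k. m = d + k")
      case True
      then obtain k where "m = d + k" by blast
      then show ?thesis by (simp add: lookup_cpr lookup_single_mult \<pi>(2))
    next
      case False
      have "m \<notin> keys (single d (to_ac c) * r)" "m \<notin> keys (single d c * cpr r)"
        using False Poly_Mapping.keys_mult[of "single d (to_ac c)" r]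
          Poly_Mapping.keys_mult[of "single d c" "cpr r"] by (auto split: if_splits)
      then show ?thesis by (simp add: in_keys_iff lookup_cpr \<pi>0)
    qed
  qed
  have cpr_acm: "cpr (acm f * r) = f * cpr r" for f r
    using PR_UNIV[of f]
  proof (induction arbitrary: r rule: PR_induct)
    case (const c)
    show ?case unfolding acm_simps unfolding const_def by (rule cpr_single)
  next
    case (var i)
    show ?case unfolding acm_simps unfolding var_def using cpr_single[of "single i 1" 1 r] by simp
  qed (simp_all add: acm_simps cpr_add distrib_right mult.assoc)
  \<comment> \<open>Quantifying over all multipliers \<open>r\<close> makes this set an ideal,
    although \<open>cpr\<close> is linear only over the ground polynomials.\<close>
  let ?W = "{q \<in> Rn n. \<forall>r\<in>Rn n. cpr (q * r) \<in> J}"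
  have "idl n ?W"
  proof (rule PR.idlI)
    fix a r :: "'k alg_closure mpoly" assume a: "a \<in> ?W" and r: "r \<in> Rn n"
    have "cpr (a * (r * t)) \<in> J" if "t \<in> Rn n" for t
      using a r that by simp
    then show "r * a \<in> ?W" using a r by (simp add: mult_ac)
  next
    fix a b assume "a \<in> ?W" "b \<in> ?W"
    then show "a + b \<in> ?W" using PR.idlD(3)[OF J] by (simp add: cpr_add distrib_right)
  qed (use PR.idlD(2)[OF J] cpr_0 in auto)
  moreover have "acm ` J \<subseteq> ?W"
  proof
    fix q assume "q \<in> acm ` J"
    then obtain f where f: "f \<in> J" "q = acm f" by blast
    then show "q \<in> ?W"
      using PR.idlD(5)[OF J f(1)] acm_PR[OF PR.idlD(1)[OF J f(1)]] cpr_PR by (simp add: cpr_acm)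
  qed
  ultimately have "acm g \<in> ?W" using g PR.gen_minimal by blast
  then have "cpr (acm g * 1) \<in> J" by (simp only: mem_Collect_eq PR.one_C)
  moreover have "cpr 1 = (1 :: 'k mpoly)"
    by (rule poly_mapping_eqI) (simp add: lookup_cpr lookup_one when_def \<pi>(3) \<pi>0)
  ultimately show "g \<in> J" unfolding cpr_acm by simp
qed

text \<open>If no power of \<open>g\<close> lies in \<open>J\<close>, none lies in the extended
  ideal. A prime of dimension 0 over the latter that avoids \<open>g\<close> is the ideal of a
  point, which is a zero of \<open>J\<close> but not of \<open>g\<close>.\<close>

theorem nullstellensatz:
  fixes J :: "'k::field mpoly set"
  assumes J: "idl n J" and g: "g \<in> Rn n" "\<And>x. x \<in> zero_set n J \<Longrightarrow> poly_eval g x = 0"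
  shows "\<exists>N. g ^ N \<in> J"
proof (rule ccontr)
  assume no: "\<nexists>N. g ^ N \<in> J"
  let ?Je = "gen n (acm ` J)"
  have JC: "acm ` J \<subseteq> Rn n" using acm_PR PR.idlD(1)[OF J] by blast
  have "acm g ^ N \<notin> ?Je" for N
    using extension_contraction[OF J, of "g ^ N"] no by (auto simp: acm_simps)
  then obtain M where M: "prm n M" "?Je \<subseteq> M" "acm g \<notin> M" "trd n M = 0"
    using maximal_prime_avoiding_power[OF PR.idl_gen[OF JC] acm_PR[OF g(1)]] by metis
  obtain a where "\<forall>i\<in>{1..n}. var i - const (a i) \<in> M"
    using trd_0_point[OF M(1,4)] ..
  then have a: "\<And>i. i \<in> {1..n} \<Longrightarrow> var i - const (a i) \<in> M" ..
  \<comment> \<open>Points of \<open>affine_space\<close> are extensional functions; evaluation of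
    members of \<open>Rn n\<close> sees only the coordinates that are kept.\<close>
  define x where "x = restrict a {1..n}"
  have ev: "poly_eval p x = 0 \<longleftrightarrow> acm p \<in> M" if p: "p \<in> Rn n" for p
  proof -
    have "poly_eval p x = poly_eval p a"
      unfolding poly_eval_eq_peval
      by (rule peval_cong_PR[OF to_ac.coeff_hom_axioms p]) (simp add: x_def)
    then show ?thesis
      using point_ideal_mem_iff[OF M(1) a acm_PR[OF p]] by (simp add: peval_acm)
  qed
  have "poly_eval p x = 0" if "p \<in> J" for p
    using that ev[of p] PR.idlD(1)[OF J] M(2) PR.gen_superset[of "acm ` J"] by blast
  then have "x \<in> zero_set n J"
    unfolding zero_set_def affine_space_def x_def by simp
  then show False using g ev[OF g(1)] M(3) by simp
qed

section \<open>Prime ideals and irreducible closed sets\<close>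

lemma ideal_mpoly_ring_iff: "ideal J (mpoly_ring n) \<longleftrightarrow> idl n (J :: 'k::field mpoly set)"
proof
  interpret cring "mpoly_ring n :: 'k mpoly ring" by (rule cring_mpoly_ring)
  assume "ideal J (mpoly_ring n)"
  then interpret ideal J "mpoly_ring n :: 'k mpoly ring" .
  show "idl n J"
  proof (rule PR.idlI)
    show "J \<subseteq> Rn n" using a_subset by (simp add: carrier_mpoly_ring)
    show "0 \<in> J" using zero_closed by (simp add: mpoly_ring_def)
    show "a + b \<in> J" if "a \<in> J" "b \<in> J" for a b using a_closed[OF that] by (simp add: mpoly_ring_def)
    show "r * a \<in> J" if "a \<in> J" "r \<in> Rn n" for a r
      using I_l_closed[OF that(1), of r] that(2) by (simp add: carrier_mpoly_ring) (simp add: mpoly_ring_def)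
  qed
next
  interpret cring "mpoly_ring n :: 'k mpoly ring" by (rule cring_mpoly_ring)
  assume J: "idl n J"
  have ops: "x \<oplus>\<^bsub>mpoly_ring n\<^esub> y = x + y" "x \<otimes>\<^bsub>mpoly_ring n\<^esub> y = x * y" "\<zero>\<^bsub>mpoly_ring n\<^esub> = 0"
    for x y :: "'k mpoly"
    by (simp_all add: mpoly_ring_def)
  have inv: "\<ominus>\<^bsub>mpoly_ring n\<^esub> x = - x" if "x \<in> Rn n" for x :: "'k mpoly"
    using that by (intro minus_equality) (simp_all add: carrier_mpoly_ring ops)
  show "ideal J (mpoly_ring n)"
  proof (rule idealI)
    show "ring (mpoly_ring n :: 'k mpoly ring)" by (rule ring_axioms)
    show "subgroup J (add_monoid (mpoly_ring n))"
    proof (rule group.subgroupI[OF a_group])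
      show "J \<subseteq> carrier (add_monoid (mpoly_ring n))" using PR.idlD(1)[OF J] by (auto simp: carrier_mpoly_ring)
      show "J \<noteq> {}" using PR.idlD(2)[OF J] by blast
      show "inv\<^bsub>add_monoid (mpoly_ring n)\<^esub> a \<in> J" if "a \<in> J" for a
        using inv[OF PR.idlD(1)[OF J that]] PR.idlD(6)[OF J that] by (simp add: a_inv_def)
      show "a \<otimes>\<^bsub>add_monoid (mpoly_ring n)\<^esub> b \<in> J" if "a \<in> J" "b \<in> J" for a b
        using PR.idlD(3)[OF J that] by (simp add: ops)
    qed
  qed (use PR.idlD(4,5)[OF J] in \<open>simp_all add: carrier_mpoly_ring ops\<close>)
qed

lemma genideal_mpoly_ring:
  "genideal (mpoly_ring n) A = gen n (A :: 'k::field mpoly set)"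
  unfolding genideal_def ideal_mpoly_ring_iff PR.gen_def by auto

lemma zero_set_anti: "I \<subseteq> J \<Longrightarrow> zero_set n J \<subseteq> zero_set n I"
  unfolding zero_set_def by blast

section \<open>Vanishing ideals and the correspondence of primes with irreducible sets\<close>

definition VI :: "nat \<Rightarrow> (nat \<Rightarrow> 'k::field alg_closure) set \<Rightarrow> 'k mpoly set" where
  "VI n Z = {p \<in> Rn n. \<forall>x\<in>Z. poly_eval p x = 0}"

lemma poly_eval_simps:
  "poly_eval 0 x = 0" "poly_eval 1 x = 1" "poly_eval (p + q) x = poly_eval p x + poly_eval q x"
  "poly_eval (p * q) x = poly_eval p x * poly_eval q x" "poly_eval (p ^ k) x = poly_eval p x ^ k"
  by (simp_all add: poly_eval_eq_peval to_ac.peval_add to_ac.peval_mult to_ac.peval_power)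

lemma idl_VI: "idl n (VI n Z)"
  by (rule PR.idlI) (auto simp: VI_def poly_eval_simps)

lemma prm_VI_point: "prm n (VI n {x})"
  unfolding PR.prm_def
proof (intro conjI)
  show "idl n (VI n {x})" by (rule idl_VI)
qed (auto simp: VI_def poly_eval_simps)

lemma VI_zero_set:
  assumes P: "prm n P"
  shows "VI n (zero_set n P) = P"
proof
  show "P \<subseteq> VI n (zero_set n P)"
    using PR.idlD(1)[OF PR.prmD(1)[OF P]] by (auto simp: VI_def zero_set_def)
  show "VI n (zero_set n P) \<subseteq> P"
  proof
    fix g assume g: "g \<in> VI n (zero_set n P)"
    then obtain N where "g ^ N \<in> P"
      using nullstellensatz[OF PR.prmD(1)[OF P], of g] by (auto simp: VI_def)
    then show "g \<in> P" using PR.prm_power[OF P] g by (auto simp: VI_def)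
  qed
qed

lemma zero_set_subset_iff:
  assumes P: "prm n P" and J: "idl n J"
  shows "zero_set n P \<subseteq> zero_set n J \<longleftrightarrow> J \<subseteq> P"
proof
  assume "zero_set n P \<subseteq> zero_set n J"
  then have "J \<subseteq> VI n (zero_set n P)"
    using PR.idlD(1)[OF J] unfolding VI_def zero_set_def by blast
  then show "J \<subseteq> P" using VI_zero_set[OF P] by simp
qed (rule zero_set_anti)

lemma zero_set_VI:
  assumes "K_closed n Z"
  shows "zero_set n (VI n Z) = Z"
proof -
  obtain J where J: "idl n J" "Z = zero_set n J"
    using assms by (auto simp: K_closed_def ideal_mpoly_ring_iff)
  have "J \<subseteq> VI n Z" using PR.idlD(1)[OF J(1)] unfolding J(2) VI_def zero_set_def by blast
  then have "zero_set n (VI n Z) \<subseteq> Z" unfolding J(2) by (rule zero_set_anti)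
  moreover have "Z \<subseteq> zero_set n (VI n Z)" unfolding J(2) by (auto simp: zero_set_def VI_def)
  ultimately show ?thesis by blast
qed

lemma zero_set_VI_irreducible: "K_irreducible n Z \<Longrightarrow> zero_set n (VI n Z) = Z"
  by (rule zero_set_VI) (simp add: K_irreducible_def)

lemma K_closed_zero_set: "idl n J \<Longrightarrow> K_closed n (zero_set n J)"
  by (auto simp: K_closed_def ideal_mpoly_ring_iff)

lemma K_irreducible_zero_set:
  assumes P: "prm n P"
  shows "K_irreducible n (zero_set n P)"
  unfolding K_irreducible_def
proof (intro conjI allI impI)
  show "K_closed n (zero_set n P)" by (rule K_closed_zero_set[OF PR.prmD(1)[OF P]])
  show "zero_set n P \<noteq> {}"
  proof
    assume "zero_set n P = {}"
    then have "1 \<in> VI n (zero_set n P)" by (simp add: VI_def)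
    then show False using PR.prmD(2)[OF P] VI_zero_set[OF P] by simp
  qed
  fix A B assume AB: "K_closed n A \<and> K_closed n B \<and> zero_set n P = A \<union> B"
  show "zero_set n P = A \<or> zero_set n P = B"
  proof (rule ccontr)
    assume "\<not> ?thesis"
    then have "\<not> zero_set n P \<subseteq> zero_set n (VI n A)" "\<not> zero_set n P \<subseteq> zero_set n (VI n B)"
      using AB zero_set_VI[of n A] zero_set_VI[of n B] by auto
    then have "\<not> VI n A \<subseteq> P" "\<not> VI n B \<subseteq> P"
      using zero_set_subset_iff[OF P idl_VI] by blast+
    then obtain f g where fg: "f \<in> VI n A" "f \<notin> P" "g \<in> VI n B" "g \<notin> P" by blast
    then have "f * g \<in> VI n (zero_set n P)"
      using AB by (auto simp: VI_def poly_eval_simps)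
    then have "f * g \<in> P" using VI_zero_set[OF P] by simp
    then show False using PR.prmD(3)[OF P, of f g] fg by (auto simp: VI_def)
  qed
qed

text \<open>If \<open>f * g\<close> vanishes on \<open>Z\<close>, the zero loci of \<open>f\<close>
  and \<open>g\<close> in \<open>Z\<close> are closed and cover \<open>Z\<close>, so one of them is
  all of \<open>Z\<close>.\<close>

lemma prm_VI:
  assumes Z: "K_irreducible n Z"
  shows "prm n (VI n Z)"
  unfolding PR.prm_def
proof (intro conjI ballI impI)
  have cl: "K_closed n Z" using Z by (simp add: K_irreducible_def)
  show "idl n (VI n Z)" by (rule idl_VI)
  obtain x where "x \<in> Z" using Z by (auto simp: K_irreducible_def)
  then show "1 \<notin> VI n Z" by (auto simp: VI_def poly_eval_simps)
  fix f g assume f: "f \<in> Rn n" and g: "g \<in> Rn n" and fg: "f * g \<in> VI n Z"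
  define A where "A h = zero_set n (gen n (insert h (VI n Z)))" for h
  have idl: "idl n (gen n (insert h (VI n Z)))" if "h \<in> Rn n" for h
    using that PR.idlD(1)[OF idl_VI] by (intro PR.idl_gen) blast
  have A: "A h = {x \<in> Z. poly_eval h x = 0}" if h: "h \<in> Rn n" for h
  proof
    have "insert h (VI n Z) \<subseteq> gen n (insert h (VI n Z))" by (rule PR.gen_superset)
    then have "A h \<subseteq> zero_set n (VI n Z)" "\<And>x. x \<in> A h \<Longrightarrow> poly_eval h x = 0"
      unfolding A_def zero_set_def by blast+
    then show "A h \<subseteq> {x \<in> Z. poly_eval h x = 0}" using zero_set_VI[OF cl] by blast
    show "{x \<in> Z. poly_eval h x = 0} \<subseteq> A h"
    proof
      fix x assume x: "x \<in> {x \<in> Z. poly_eval h x = 0}"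
      have "insert h (VI n Z) \<subseteq> VI n {x}" using x h by (auto simp: VI_def)
      then have "gen n (insert h (VI n Z)) \<subseteq> VI n {x}" by (intro PR.gen_minimal idl_VI)
      moreover have "x \<in> affine_space n" using x zero_set_VI[OF cl] by (auto simp: zero_set_def)
      ultimately show "x \<in> A h" unfolding A_def zero_set_def VI_def by auto
    qed
  qed
  have "Z = A f \<union> A g" using fg A[OF f] A[OF g] by (auto simp: VI_def poly_eval_simps)
  moreover have "K_closed n (A f)" "K_closed n (A g)"
    unfolding A_def using idl[OF f] idl[OF g] K_closed_zero_set by blast+
  ultimately have "Z = A f \<or> Z = A g" using Z by (simp add: K_irreducible_def)
  then show "f \<in> VI n Z \<or> g \<in> VI n Z" using A[OF f] A[OF g] f g by (auto simp: VI_def)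
qed

lemma K_irreducible_iff: "K_irreducible n Z \<longleftrightarrow> (\<exists>P. prm n P \<and> Z = zero_set n P)"
proof
  assume Z: "K_irreducible n Z"
  have "Z = zero_set n (VI n Z)" using zero_set_VI_irreducible[OF Z] by simp
  then show "\<exists>P. prm n P \<and> Z = zero_set n P" using prm_VI[OF Z] by blast
qed (use K_irreducible_zero_set in blast)

lemma K_irreducible_component_iff:
  assumes J: "idl n J"
  shows "K_irreducible_component n (zero_set n J) Z \<longleftrightarrow>
    (\<exists>P. minimal_over n J P \<and> Z = zero_set n P)"
proof
  assume Z: "K_irreducible_component n (zero_set n J) Z"
  then obtain P where P: "prm n P" "Z = zero_set n P"
    by (auto simp: K_irreducible_component_def K_irreducible_iff)
  have JP: "J \<subseteq> P" using Z zero_set_subset_iff[OF P(1) J] P(2) by (simp add: K_irreducible_component_def)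
  have "Q = P" if Q: "prm n Q" "J \<subseteq> Q" "Q \<subseteq> P" for Q
  proof -
    have "K_irreducible n (zero_set n Q)" "Z \<subseteq> zero_set n Q" "zero_set n Q \<subseteq> zero_set n J"
      using K_irreducible_zero_set[OF Q(1)] zero_set_anti[OF Q(3)] zero_set_anti[OF Q(2)] P(2) by auto
    then have "zero_set n Q = Z" using Z unfolding K_irreducible_component_def by metis
    then show ?thesis using VI_zero_set[OF Q(1)] VI_zero_set[OF P(1)] P(2) by metis
  qed
  then show "\<exists>P. minimal_over n J P \<and> Z = zero_set n P"
    using P JP unfolding PR.minimal_over_def by blast
next
  assume "\<exists>P. minimal_over n J P \<and> Z = zero_set n P"
  then obtain P where P: "prm n P" "J \<subseteq> P" "Z = zero_set n P"
    and min: "\<And>Q. prm n Q \<Longrightarrow> J \<subseteq> Q \<Longrightarrow> Q \<subseteq> P \<Longrightarrow> Q = P"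
    by (auto simp: PR.minimal_over_def)
  show "K_irreducible_component n (zero_set n J) Z"
    unfolding K_irreducible_component_def
  proof (intro conjI allI impI)
    show "K_irreducible n Z" unfolding P(3) by (rule K_irreducible_zero_set[OF P(1)])
    show "Z \<subseteq> zero_set n J" unfolding P(3) by (rule zero_set_anti[OF P(2)])
    fix Y assume Y: "K_irreducible n Y \<and> Z \<subseteq> Y \<and> Y \<subseteq> zero_set n J"
    then obtain Q where Q: "prm n Q" "Y = zero_set n Q" by (auto simp: K_irreducible_iff)
    have "Q \<subseteq> P" using Y Q P(3) zero_set_subset_iff[OF P(1) PR.prmD(1)[OF Q(1)]] by simp
    moreover have "J \<subseteq> Q" using Y Q zero_set_subset_iff[OF Q(1) J] by simp
    ultimately show "Y = Z" using min[OF Q(1)] Q(2) P(3) by simp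
  qed
qed

section \<open>Krull dimension, minimal primes and components\<close>

lemma prime_chain:
  fixes P :: "'k::field mpoly set"
  assumes "prm n P" "trd n P = d"
  shows "\<exists>Q. Q d = P \<and> (\<forall>i\<le>d. prm n (Q i)) \<and> (\<forall>i<d. Q (Suc i) \<subset> Q i)"
  using assms
proof (induction d arbitrary: P)
  case 0
  then show ?case by (intro exI[of _ "\<lambda>_. P"]) simp
next
  case (Suc d)
  obtain P' where P': "prm n P'" "P \<subset> P'" "trd n P' = d"
    by (rule trd_going_up[OF Suc.prems PR.one_C PR.prmD(2)[OF Suc.prems(1)]])
  obtain Q where Q: "Q d = P'" "\<forall>i\<le>d. prm n (Q i)" "\<forall>i<d. Q (Suc i) \<subset> Q i"
    using Suc.IH[OF P'(1,3)] by blast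
  have "\<forall>i\<le>Suc d. prm n ((Q(Suc d := P)) i)" using Q(2) Suc.prems(1) by (simp add: le_Suc_eq)
  moreover have "\<forall>i<Suc d. (Q(Suc d := P)) (Suc i) \<subset> (Q(Suc d := P)) i"
    using Q(1,3) P'(2) by (auto simp: less_Suc_eq)
  ultimately show ?case by (intro exI[of _ "Q(Suc d := P)"]) simp
qed

lemma trd_anti: "prm n P \<Longrightarrow> prm n Q \<Longrightarrow> P \<subseteq> Q \<Longrightarrow> trd n Q \<le> trd n P"
  using trd_strict[of n P Q] by (cases "P = Q") (simp, simp add: psubset_eq)

text \<open>Along an ascending chain of irreducible sets the vanishing ideals shrink and
  \<open>trd\<close> rises strictly, which bounds the length. Iterated going up produces a chain
  that attains the bound.\<close>

lemma K_dim_zero_set: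
  assumes P: "prm n P"
  shows "K_dim n (zero_set n P) = enat (trd n P)"
proof -
  let ?A = "{enat m | m. \<exists>C. (\<forall>i\<le>m. K_irreducible n (C i) \<and> C i \<subseteq> zero_set n P) \<and> (\<forall>i<m. C i \<subset> C (Suc i))}"
  show ?thesis unfolding K_dim_def
  proof (rule antisym)
    show "Sup ?A \<le> enat (trd n P)"
    proof (rule Sup_least)
      fix d assume "d \<in> ?A"
      then obtain m C where d: "d = enat m" and C: "\<forall>i\<le>m. K_irreducible n (C i) \<and> C i \<subseteq> zero_set n P"
        and str: "\<forall>i<m. C i \<subset> C (Suc i)" by blast
      have prm: "prm n (VI n (C i))" if "i \<le> m" for i using C that prm_VI by blast
      have VIC: "zero_set n (VI n (C i)) = C i" if "i \<le> m" for i
        using C that zero_set_VI_irreducible by blast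
      have "i \<le> m \<Longrightarrow> i \<le> trd n (VI n (C i))" for i
      proof (induction i)
        case (Suc i)
        have "C i \<subset> C (Suc i)" using str Suc.prems by simp
        then have "VI n (C (Suc i)) \<subseteq> VI n (C i)" "VI n (C (Suc i)) \<noteq> VI n (C i)"
          using VIC[of i] VIC[of "Suc i"] Suc.prems by (auto simp: VI_def)
        then have "trd n (VI n (C i)) < trd n (VI n (C (Suc i)))"
          using prm Suc.prems by (intro trd_strict) auto
        then show ?case using Suc by simp
      qed simp
      then have "m \<le> trd n (VI n (C m))" by simp
      also have "\<dots> \<le> trd n P"
      proof (rule trd_anti[OF P prm])
        show "P \<subseteq> VI n (C m)"
          using C zero_set_subset_iff[OF prm PR.prmD(1)[OF P], of m] VIC[of m] by simp
      qed simp
      finally show "d \<le> enat (trd n P)" by (simp add: d)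
    qed
  next
    obtain Q where Q: "Q (trd n P) = P" "\<forall>i\<le>trd n P. prm n (Q i)" "\<forall>i<trd n P. Q (Suc i) \<subset> Q i"
      using prime_chain[OF P refl] by blast
    have QP: "i \<le> trd n P \<Longrightarrow> P \<subseteq> Q i" for i
      by (induction rule: inc_induct) (use Q(1,3) in auto)
    have str: "zero_set n (Q i) \<subset> zero_set n (Q (Suc i))" if "i < trd n P" for i
    proof -
      have "prm n (Q i)" "prm n (Q (Suc i))" "Q (Suc i) \<subset> Q i" using Q that by auto
      then show ?thesis
        using zero_set_subset_iff[of n "Q (Suc i)" "Q i"] zero_set_anti[of "Q (Suc i)" "Q i" n] PR.prmD(1) by blast
    qed
    have *: "(\<forall>i\<le>trd n P. K_irreducible n (zero_set n (Q i)) \<and> zero_set n (Q i) \<subseteq> zero_set n P) \<and>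
        (\<forall>i<trd n P. zero_set n (Q i) \<subset> zero_set n (Q (Suc i)))"
    proof (intro conjI allI impI)
      fix i assume i: "i \<le> trd n P"
      show "K_irreducible n (zero_set n (Q i))" using Q(2) i by (intro K_irreducible_zero_set) simp
      show "zero_set n (Q i) \<subseteq> zero_set n P" by (rule zero_set_anti[OF QP[OF i]])
    qed (rule str)
    show "enat (trd n P) \<le> Sup ?A"
      by (rule Sup_upper, rule CollectI, rule exI[of _ "trd n P"], rule conjI[OF refl],
          rule exI[of _ "\<lambda>i. zero_set n (Q i)"], rule *)
  qed
qed

text \<open>Since \<open>trd\<close> is bounded by \<open>n\<close> and strictly reverses
  inclusions, a prime of largest \<open>trd\<close> between \<open>J\<close> and \<open>Q\<close> is
  minimal.\<close>

lemma minimal_over_exists: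
  assumes Q: "prm n Q" "J \<subseteq> Q"
  obtains P where "minimal_over n J P" "P \<subseteq> Q"
proof -
  let ?F = "\<lambda>P. prm n P \<and> J \<subseteq> P \<and> P \<subseteq> Q"
  have "\<exists>P. ?F P \<and> (\<forall>P'. ?F P' \<longrightarrow> trd n P' \<le> trd n P)"
    by (rule ex_has_greatest_nat[of ?F Q "trd n" "Suc n"]) (use Q trd_le in \<open>auto simp: less_Suc_eq_le\<close>)
  then obtain P where P: "?F P" and max: "\<And>P'. ?F P' \<Longrightarrow> trd n P' \<le> trd n P" by blast
  have "P' = P" if "prm n P'" "J \<subseteq> P'" "P' \<subseteq> P" for P'
  proof (rule ccontr)
    assume "P' \<noteq> P"
    then have "trd n P < trd n P'" using trd_strict[of n P' P] P that by auto
    moreover have "P' \<subseteq> Q" using that P by blast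
    ultimately show False using max[of P'] that by simp
  qed
  then show thesis using that[of P] P unfolding PR.minimal_over_def by blast
qed

lemma zero_set_eq_Union_minimal:
  "x \<in> zero_set n J \<Longrightarrow> J \<subseteq> Rn n \<Longrightarrow> \<exists>P. minimal_over n J P \<and> x \<in> zero_set n P"
proof -
  assume x: "x \<in> zero_set n J" and J: "J \<subseteq> Rn n"
  have "J \<subseteq> VI n {x}" using x J by (auto simp: VI_def zero_set_def)
  then obtain P where P: "minimal_over n J P" "P \<subseteq> VI n {x}"
    using minimal_over_exists[OF prm_VI_point] by blast
  then have "x \<in> zero_set n P" using x by (auto simp: zero_set_def VI_def)
  then show ?thesis using P by blast
qed

text \<open>Both subtractions are truncated; the bounds \<open>trd n P \<le> n\<close> and
  \<open>c \<le> n\<close> make the conditions on codimension and on \<open>trd\<close>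
  equivalent.\<close>

lemma nondegenerate_locus_eq:
  assumes c: "c \<le> n" and f: "f ` {1..c} \<subseteq> Rn n"
  shows "nondegenerate_locus n c f =
    \<Union> {zero_set n P | P. minimal_over n (gen n (f ` {1..c})) P \<and> trd n P = n - c}"
proof -
  have "K_codim n (zero_set n P) = enat c \<longleftrightarrow> trd n P = n - c" if P: "prm n P" for P
    unfolding K_codim_def K_dim_zero_set[OF P] using trd_le[OF P] c by auto
  then show ?thesis
    unfolding nondegenerate_locus_def genideal_mpoly_ring K_irreducible_component_iff[OF PR.idl_gen[OF f]]
      PR.minimal_over_def by auto
qed


section \<open>Ideal quotients, saturation and primes\<close>

abbreviation quot :: "nat \<Rightarrow> 'k::field mpoly set \<Rightarrow> 'k mpoly set \<Rightarrow> 'k mpoly set" where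
  "quot n \<equiv> ideal_quotient (mpoly_ring n)"
abbreviation sat :: "nat \<Rightarrow> 'k::field mpoly set \<Rightarrow> 'k mpoly set \<Rightarrow> 'k mpoly set" where
  "sat n \<equiv> saturation (mpoly_ring n)"
abbreviation ipow :: "nat \<Rightarrow> 'k::field mpoly set \<Rightarrow> nat \<Rightarrow> 'k mpoly set" where
  "ipow n K N \<equiv> K [^]\<^bsub>ideals_set (mpoly_ring n)\<^esub> N"

lemma mpoly_ring_ops: "x \<otimes>\<^bsub>mpoly_ring n\<^esub> y = x * y" "\<zero>\<^bsub>mpoly_ring n\<^esub> = 0"
  by (simp_all add: mpoly_ring_def)

text \<open>Plain \<open>N\<close>-fold products. They generate the ideal power, so saturation and
  avoidance by primes can be tested on them.\<close>

primrec prods :: "'a::comm_ring_1 set \<Rightarrow> nat \<Rightarrow> 'a set" where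
  "prods K 0 = {1}"
| "prods K (Suc N) = {a * b | a b. a \<in> prods K N \<and> b \<in> K}"

lemma prods_add: "q \<in> prods K (N + M) \<Longrightarrow> \<exists>a\<in>prods K N. \<exists>b\<in>prods K M. q = a * b"
proof (induction M arbitrary: q)
  case (Suc M)
  then obtain r k where rk: "q = r * k" "r \<in> prods K (N + M)" "k \<in> K" by auto
  obtain a b where ab: "a \<in> prods K N" "b \<in> prods K M" "r = a * b" using Suc.IH[OF rk(2)] by blast
  have "b * k \<in> prods K (Suc M)" using ab(2) rk(3) by auto
  then show ?case using ab rk(1) by (metis mult.assoc)
qed simp

lemma power_prods: "k \<in> K \<Longrightarrow> k ^ N \<in> prods K N"
  by (induction N) (auto, metis mult.commute)

lemma prods_PR: "K \<subseteq> PR T \<Longrightarrow> prods K N \<subseteq> PR T"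
proof (induction N)
  case (Suc N)
  then show ?case using PR.mult_C[of _ T] by auto
qed simp

lemma prods_idl: "idl n K \<Longrightarrow> q \<in> prods K N \<Longrightarrow> q \<in> Rn n"
  using prods_PR[of K "{1..n}" N] PR.idlD(1) by blast

lemma ideal_pow_mpoly_ring:
  assumes K: "idl n (K :: 'k::field mpoly set)"
  shows "idl n (ipow n K N) \<and>
    prods K N \<subseteq> ipow n K N \<and>
    (\<forall>W. idl n W \<and> prods K N \<subseteq> W \<longrightarrow> ipow n K N \<subseteq> W)"
proof (induction N)
  case 0
  have "W = Rn n" if "idl n W" "1 \<in> W" for W :: "'k mpoly set"
    using PR.idlD(1,4)[OF that(1)] that(2) by (metis mult_1_right subsetI subset_antisym)
  then show ?case
    using PR.idl_C by (auto simp: nat_pow_def ideals_set_def carrier_mpoly_ring)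
next
  case (Suc N)
  let ?KN = "ipow n K N"
  have eq: "ipow n K (Suc N) = ideal_prod (mpoly_ring n) ?KN K"
    by (simp add: nat_pow_def ideals_set_def)
  interpret R: cring "mpoly_ring n :: 'k mpoly ring" by (rule cring_mpoly_ring)
  have idlKN: "idl n ?KN" using Suc.IH by blast
  have "idl n (ideal_prod (mpoly_ring n) ?KN K)"
    using R.ideal_prod_is_ideal[of ?KN K] idlKN K by (simp add: ideal_mpoly_ring_iff)
  moreover have "prods K (Suc N) \<subseteq> ideal_prod (mpoly_ring n) ?KN K"
  proof
    fix q assume "q \<in> prods K (Suc N)"
    then obtain a b where "q = a * b" "a \<in> ?KN" "b \<in> K" using Suc.IH by auto
    then show "q \<in> ideal_prod (mpoly_ring n) ?KN K"
      using ideal_prod.prod[of a ?KN b K "mpoly_ring n"] by (simp add: mpoly_ring_ops)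
  qed
  moreover have "ideal_prod (mpoly_ring n) ?KN K \<subseteq> W"
    if W: "idl n W" "prods K (Suc N) \<subseteq> W" for W
  proof
    have ab: "a * b \<in> W" if "a \<in> ?KN" "b \<in> K" for a b
    proof -
      let ?V = "{a \<in> Rn n. a * b \<in> W}"
      have "idl n ?V"
        using PR.idl_colon[OF W(1) PR.idlD(1)[OF K \<open>b \<in> K\<close>]] by (simp add: mult.commute)
      moreover have "prods K N \<subseteq> ?V"
        using W(2) prods_idl[OF K] \<open>b \<in> K\<close> by auto
      ultimately have "?KN \<subseteq> ?V" using Suc.IH by blast
      then show ?thesis using \<open>a \<in> ?KN\<close> by blast
    qed
    fix q assume "q \<in> ideal_prod (mpoly_ring n) ?KN K"
    then show "q \<in> W"
    proof induction
      case (prod i j)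
      then show ?case using ab by (simp add: mpoly_ring_ops)
    next
      case (sum s1 s2)
      then show ?case using PR.idlD(3)[OF W(1)] by (simp add: mpoly_ring_def)
    qed
  qed
  ultimately show ?case unfolding eq by blast
qed

lemma saturation_mem_iff:
  assumes I: "idl n (I :: 'k::field mpoly set)" and K: "idl n K"
  shows "p \<in> sat n I K \<longleftrightarrow> p \<in> Rn n \<and> (\<exists>N. \<forall>q\<in>prods K N. p * q \<in> I)"
proof -
  have "(\<forall>q\<in>ipow n K N. p * q \<in> I) \<longleftrightarrow> (\<forall>q\<in>prods K N. p * q \<in> I)"
    if p: "p \<in> Rn n" for N :: nat
  proof
    let ?V = "{q \<in> Rn n. p * q \<in> I}"
    have V: "idl n ?V" by (rule PR.idl_colon[OF I p])
    assume "\<forall>q\<in>prods K N. p * q \<in> I"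
    then have "prods K N \<subseteq> ?V" using prods_idl[OF K] by blast
    then have "ipow n K N \<subseteq> ?V"
      using ideal_pow_mpoly_ring[OF K, of N] V by blast
    then show "\<forall>q\<in>ipow n K N. p * q \<in> I" by blast
  qed (use ideal_pow_mpoly_ring[OF K, of N] in blast)
  then show ?thesis
    by (auto simp: saturation_def ideal_quotient_def carrier_mpoly_ring mpoly_ring_ops)
qed

lemma ideal_quotient_mpoly_ring:
  "quot n I J = {p \<in> Rn n. \<forall>q\<in>J. p * q \<in> I}"
  by (simp add: ideal_quotient_def carrier_mpoly_ring mpoly_ring_ops)

lemma idl_ideal_quotient:
  assumes I: "idl n (I :: 'k::field mpoly set)"
  shows "idl n (quot n I J)"
  unfolding ideal_quotient_mpoly_ring
proof (rule PR.idlI)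
  fix a r :: "'k mpoly" assume "a \<in> {p \<in> Rn n. \<forall>q\<in>J. p * q \<in> I}" "r \<in> Rn n"
  then show "r * a \<in> {p \<in> Rn n. \<forall>q\<in>J. p * q \<in> I}"
    using PR.idlD(4)[OF I] by (simp add: mult.assoc)
qed (use PR.idlD(2,3)[OF I] in \<open>auto simp: distrib_right\<close>)

lemma saturation_superset:
  "idl n I \<Longrightarrow> idl n K \<Longrightarrow> I \<subseteq> sat n I K"
  using PR.idlD(1) by (auto simp: saturation_mem_iff intro!: exI[of _ 0])

lemma idl_saturation:
  assumes I: "idl n (I :: 'k::field mpoly set)" and K: "idl n K"
  shows "idl n (sat n I K)"
proof (rule PR.idlI)
  show "sat n I K \<subseteq> Rn n" using saturation_mem_iff[OF I K] by blast
  show "0 \<in> sat n I K" using saturation_superset[OF I K] PR.idlD(2)[OF I] by blast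
next
  note prodsC = prods_idl[OF K]
  fix a b :: "'k mpoly" assume "a \<in> sat n I K" "b \<in> sat n I K"
  then obtain N M where *: "a \<in> Rn n" "b \<in> Rn n" "\<forall>q\<in>prods K N. a * q \<in> I" "\<forall>q\<in>prods K M. b * q \<in> I"
    unfolding saturation_mem_iff[OF I K] by blast
  have "(a + b) * q \<in> I" if q: "q \<in> prods K (N + M)" for q
  proof -
    obtain r t where rt: "r \<in> prods K N" "t \<in> prods K M" "q = r * t" using prods_add[OF q] by blast
    have "t * (a * r) + r * (b * t) \<in> I"
      using PR.idlD(3)[OF I PR.idlD(4)[OF I bspec[OF *(3) rt(1)] prodsC[OF rt(2)]]
        PR.idlD(4)[OF I bspec[OF *(4) rt(2)] prodsC[OF rt(1)]]] .
    then show ?thesis by (simp add: rt(3) algebra_simps)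
  qed
  then show "a + b \<in> sat n I K"
    unfolding saturation_mem_iff[OF I K] using *(1,2) by auto
next
  fix a r :: "'k mpoly" assume "a \<in> sat n I K" and r: "r \<in> Rn n"
  then obtain N where *: "a \<in> Rn n" "\<forall>q\<in>prods K N. a * q \<in> I"
    unfolding saturation_mem_iff[OF I K] by blast
  have "r * a * q \<in> I" if "q \<in> prods K N" for q
    using PR.idlD(4)[OF I, of "a * q" r] *(2) r that by (simp add: mult.assoc)
  then show "r * a \<in> sat n I K"
    unfolding saturation_mem_iff[OF I K] using *(1) r by auto
qed

text \<open>An element of \<open>K\<close> outside \<open>P\<close> is a unit at \<open>P\<close>,
  so saturating by \<open>K\<close> adds nothing locally.\<close>

lemma saturation_loc_subset:
  assumes I: "idl n (I :: 'k::field mpoly set)" and K: "idl n K" and P: "prm n P"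
    and sub: "I \<subseteq> loc n P B" "\<not> K \<subseteq> P"
  shows "sat n I K \<subseteq> loc n P B"
proof
  fix p assume "p \<in> sat n I K"
  then obtain N where p: "p \<in> Rn n" "\<And>q. q \<in> prods K N \<Longrightarrow> p * q \<in> I"
    unfolding saturation_mem_iff[OF I K] by blast
  obtain k where k: "k \<in> K" "k \<notin> P" using sub(2) by blast
  have kC: "k \<in> Rn n" using PR.idlD(1)[OF K k(1)] .
  have "k ^ N * p \<in> loc n P B"
    using p(2)[OF power_prods[OF k(1)]] sub(1) by (auto simp: mult.commute)
  moreover have "k ^ N \<notin> P" using PR.prm_power[OF P kC] k(2) by blast
  ultimately show "p \<in> loc n P B"
    using PR.loc_cancel[OF P p(1), of "k ^ N"] kC by simp
qed

lemma saturation_subset_prime: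
  assumes I: "idl n (I :: 'k::field mpoly set)" and K: "idl n K" and P: "prm n P"
    and sub: "I \<subseteq> P" "\<not> K \<subseteq> P"
  shows "sat n I K \<subseteq> P"
proof -
  have "P \<subseteq> loc n P P" by (rule PR.loc_superset[OF P PR.prmD(1)[OF P]])
  then have "sat n I K \<subseteq> loc n P P"
    using sub by (intro saturation_loc_subset[OF I K P]) auto
  then show ?thesis using PR.loc_subset_prm[OF P, of P] by blast
qed

text \<open>The products of \<open>s\<close> outside \<open>P\<close> with the members of
  \<open>prods K N\<close> form a multiplicative family of sets; if one of them lay in
  \<open>I\<close>, then \<open>s\<close> would be in the saturation and thus in \<open>P\<close>. A
  prime avoiding the family lies in \<open>P\<close> by the case \<open>N = 0\<close> and does not
  contain \<open>K\<close> by the case \<open>s = 1\<close>, \<open>N = 1\<close>.\<close>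

lemma prime_below_saturation:
  assumes I: "idl n (I :: 'k::field mpoly set)" and K: "idl n K" and P: "prm n P"
    and sub: "sat n I K \<subseteq> P"
  obtains P' where "prm n P'" "I \<subseteq> P'" "P' \<subseteq> P" "\<not> K \<subseteq> P'"
proof -
  note prodsC = prods_idl[OF K]
  define \<M> where "\<M> = {(*) s ` prods K N | s N. s \<in> Rn n \<and> s \<notin> P}"
  have in_\<M>: "(*) s ` prods K N \<in> \<M>" if "s \<in> Rn n" "s \<notin> P" for s N
    using that unfolding \<M>_def by blast
  have ne: "\<M> \<noteq> {}" using in_\<M>[of 1] PR.prmD(2)[OF P] by auto
  have C: "U \<subseteq> Rn n" if "U \<in> \<M>" for U using that prodsC unfolding \<M>_def by auto
  have mul: "\<exists>Z\<in>\<M>. Z \<subseteq> {x * y | x y. x \<in> U \<and> y \<in> Y}" if UY: "U \<in> \<M>" "Y \<in> \<M>" for U Y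
  proof -
    obtain s N t M where *: "U = (*) s ` prods K N" "s \<in> Rn n" "s \<notin> P"
      "Y = (*) t ` prods K M" "t \<in> Rn n" "t \<notin> P"
      using UY unfolding \<M>_def by blast
    have "(*) (s * t) ` prods K (N + M) \<in> \<M>"
      using * by (intro in_\<M>) (simp_all add: PR.prm_mult_iff[OF P])
    moreover have "(*) (s * t) ` prods K (N + M) \<subseteq> {x * y | x y. x \<in> U \<and> y \<in> Y}"
    proof
      fix z assume "z \<in> (*) (s * t) ` prods K (N + M)"
      then obtain q where q: "q \<in> prods K (N + M)" "z = s * t * q" by blast
      obtain a b where ab: "a \<in> prods K N" "b \<in> prods K M" "q = a * b" using prods_add[OF q(1)] by blast
      have "z = (s * a) * (t * b)" by (simp add: q(2) ab(3) mult_ac)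
      then show "z \<in> {x * y | x y. x \<in> U \<and> y \<in> Y}" using ab *(1,4) by blast
    qed
    ultimately show ?thesis by blast
  qed
  have nI: "\<not> U \<subseteq> I" if UM: "U \<in> \<M>" for U
  proof
    assume "U \<subseteq> I"
    obtain s N where s: "U = (*) s ` prods K N" "s \<in> Rn n" "s \<notin> P" using UM unfolding \<M>_def by blast
    then have "s \<in> sat n I K"
      unfolding saturation_mem_iff[OF I K] using \<open>U \<subseteq> I\<close> by blast
    then show False using sub s(3) by blast
  qed
  obtain P' where P': "prm n P'" "I \<subseteq> P'" "\<And>U. U \<in> \<M> \<Longrightarrow> \<not> U \<subseteq> P'"
    using NR.prime_avoiding[OF I ne C mul nI] by metis
  have "P' \<subseteq> P"
  proof
    fix s assume "s \<in> P'"
    then have "(*) s ` prods K 0 \<subseteq> P'" by simp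
    then show "s \<in> P" using in_\<M>[of s 0] P'(3) PR.idlD(1)[OF PR.prmD(1)[OF P'(1)] \<open>s \<in> P'\<close>] by blast
  qed
  moreover have "\<not> K \<subseteq> P'"
  proof
    assume "K \<subseteq> P'"
    then have "(*) 1 ` prods K 1 \<subseteq> P'" by auto
    then show False using in_\<M>[of 1 1] P'(3) PR.prmD(2)[OF P] by simp
  qed
  ultimately show thesis using that P'(1,2) by blast
qed

text \<open>A prime without \<open>K\<close> contains \<open>I\<close> exactly when it contains the
  saturation, so minimality transfers once \<open>prime_below_saturation\<close> has excluded
  \<open>K \<subseteq> P\<close>.\<close>

lemma minimal_over_saturation:
  assumes I: "idl n (I :: 'k::field mpoly set)" and K: "idl n K"
    and P: "minimal_over n (sat n I K) P"
  shows "\<not> K \<subseteq> P \<and> minimal_over n I P"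
proof -
  have pP: "prm n P" and sub: "sat n I K \<subseteq> P"
    and min: "\<And>Q. prm n Q \<Longrightarrow> sat n I K \<subseteq> Q \<Longrightarrow> Q \<subseteq> P \<Longrightarrow> Q = P"
    using P unfolding PR.minimal_over_def by auto
  obtain P' where P': "prm n P'" "I \<subseteq> P'" "P' \<subseteq> P" "\<not> K \<subseteq> P'"
    using prime_below_saturation[OF I K pP sub] .
  have "P' = P" using min[OF P'(1) _ P'(3)] saturation_subset_prime[OF I K P'(1,2,4)] by blast
  then have KP: "\<not> K \<subseteq> P" using P'(4) by simp
  have "Q = P" if Q: "prm n Q" "I \<subseteq> Q" "Q \<subseteq> P" for Q
  proof -
    have "\<not> K \<subseteq> Q" using KP Q(3) by blast
    then show ?thesis using min[OF Q(1) _ Q(3)] saturation_subset_prime[OF I K Q(1,2)] by blast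
  qed
  then show ?thesis
    using KP pP sub saturation_superset[OF I K] unfolding PR.minimal_over_def by blast
qed


section \<open>The invariant of the algorithm\<close>

locale nondegenerate_algorithm =
  fixes n c :: nat and f :: "nat \<Rightarrow> 'k::field mpoly"
  assumes c: "c \<le> n" and f: "\<And>i. i \<in> {1..c} \<Longrightarrow> f i \<in> Rn n"
begin

abbreviation R :: "'k mpoly ring" where "R \<equiv> mpoly_ring n"

definition G :: "nat \<Rightarrow> 'k mpoly set" where
  "G k = gen n (f ` {1..k})"

text \<open>The ideals of the nondegenerate components of the full system, in every round, not of
  its first \<open>k\<close> equations.\<close>

definition good :: "'k mpoly set \<Rightarrow> bool" where
  "good P \<longleftrightarrow> minimal_over n (G c) P \<and> trd n P = n - c"

text \<open>
  \<open>k\<close> rounds have been started, and \<open>\<D>\<close> contains the members of \<open>\<K>\<close> by which the current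
  ideal is already saturated.
\<close>

definition alg_inv :: "nat \<Rightarrow> 'k mpoly set \<Rightarrow> 'k mpoly set set \<Rightarrow> 'k mpoly set set \<Rightarrow> bool" where
  "alg_inv k J \<K> \<D> \<longleftrightarrow> idl n J \<and> finite \<K> \<and> (\<forall>K\<in>\<K>. idl n K) \<and> f ` {1..k} \<subseteq> J \<and>
    (\<forall>P. prm n P \<and> J \<subseteq> P \<longrightarrow> trd n P \<le> n - k) \<and>
    (\<forall>P. prm n P \<and> f ` {1..k} \<subseteq> P \<longrightarrow> J \<subseteq> P \<or> (\<exists>K\<in>\<K>. K \<subseteq> P)) \<and>
    (\<forall>P. minimal_over n J P \<longrightarrow> (\<forall>K\<in>\<D>. \<not> K \<subseteq> P)) \<and>
    (\<forall>P. good P \<longrightarrow> J \<subseteq> loc n P (G k) \<and> (\<forall>K\<in>\<K>. \<not> K \<subseteq> P))"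

lemma invD:
  assumes "alg_inv k J \<K> \<D>"
  shows "idl n J" "finite \<K>" "\<And>K. K \<in> \<K> \<Longrightarrow> idl n K" "f ` {1..k} \<subseteq> J"
    "\<And>P. prm n P \<Longrightarrow> J \<subseteq> P \<Longrightarrow> trd n P \<le> n - k"
    "\<And>P. prm n P \<Longrightarrow> f ` {1..k} \<subseteq> P \<Longrightarrow> J \<subseteq> P \<or> (\<exists>K\<in>\<K>. K \<subseteq> P)"
    "\<And>P K. minimal_over n J P \<Longrightarrow> K \<in> \<D> \<Longrightarrow> \<not> K \<subseteq> P"
    "\<And>P. good P \<Longrightarrow> J \<subseteq> loc n P (G k)"
    "\<And>P K. good P \<Longrightarrow> K \<in> \<K> \<Longrightarrow> \<not> K \<subseteq> P"
  using assms unfolding alg_inv_def by simp_all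

lemma f_image: "k \<le> c \<Longrightarrow> f ` {1..k} \<subseteq> Rn n"
  using f by auto

lemma idl_G: "k \<le> c \<Longrightarrow> idl n (G k)"
  unfolding G_def by (intro PR.idl_gen f_image)

lemma G_mono: "j \<le> k \<Longrightarrow> G j \<subseteq> G k"
  unfolding G_def by (intro PR.gen_mono image_mono) simp

lemma good_prm: "good P \<Longrightarrow> prm n P"
  unfolding good_def PR.minimal_over_def by simp

lemma inv_initial: "alg_inv 0 (genideal R {\<zero>\<^bsub>R\<^esub>}) {} {}"
proof -
  have J: "genideal R {\<zero>\<^bsub>R\<^esub>} = {0}"
    unfolding genideal_mpoly_ring mpoly_ring_ops by (rule PR.gen_idl[OF PR.idl_0])
  have "{0} \<subseteq> loc n P (G 0)" if "good P" for P
    using PR.idlD(2)[OF PR.idl_loc[OF good_prm[OF that] idl_G[of 0]]] by simp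
  then show ?thesis
    unfolding J alg_inv_def by (simp add: PR.idl_0 trd_le PR.idlD(2)[OF PR.prmD(1)])
qed

lemma nonzerodivisor:
  assumes P: "good P" and k: "1 \<le> k" "k \<le> c"
    and a: "a \<in> Rn n" "a * f k \<in> loc n P (G (k - 1))"
  shows "a \<in> loc n P (G (k - 1))"
proof -
  define xs where "xs = map f [1..<k]"
  define ys where "ys = map f [Suc k..<Suc c]"
  have len: "length (xs @ f k # ys) = c" using k by (simp add: xs_def ys_def)
  have "{1..k - 1} = set [1..<k]" using k by auto
  then have xs: "f ` {1..k - 1} = set xs" by (simp add: xs_def)
  have "{1..c} = set [1..<k] \<union> {k} \<union> set [Suc k..<Suc c]" using k by auto
  then have all: "f ` {1..c} = set (xs @ f k # ys)" by (auto simp: xs_def ys_def)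
  show ?thesis
    using P a c unfolding good_def G_def xs all
    by (intro nonzerodivisor_of_complete_intersection[of n xs "f k" ys P a]) (simp_all only: len)
qed

text \<open>Afterwards no member of \<open>\<K>\<close> counts as processed, because adding
  \<open>f k\<close> creates new minimal primes.\<close>

lemma inv_round:
  assumes J_inv: "alg_inv (k - 1) J \<K> \<D>" and k: "1 \<le> k" "k \<le> c"
    and H: "H = sat n J (genideal R {f k})"
  shows "alg_inv k (H <+>\<^bsub>R\<^esub> genideal R {f k}) (insert (quot n J H) \<K>) {}"
proof -
  interpret R: cring R by (rule cring_mpoly_ring)
  note I = invD[OF J_inv]
  have fk: "f k \<in> Rn n" using f k by simp
  let ?F = "gen n {f k}" and ?K = "quot n J H"
  have idlF: "idl n ?F" using fk by (intro PR.idl_gen) simp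
  have fkF: "f k \<in> ?F" using PR.gen_superset[of "{f k}"] by blast
  have H: "H = sat n J ?F" using H by (simp add: genideal_mpoly_ring)
  have idlH: "idl n H" unfolding H by (rule idl_saturation[OF I(1) idlF])
  have HC: "H \<subseteq> Rn n" using PR.idlD(1)[OF idlH] by blast
  define J' where "J' = gen n (insert (f k) H)"
  have J': "H <+>\<^bsub>R\<^esub> genideal R {f k} = J'"
  proof -
    have "H <+>\<^bsub>R\<^esub> ?F = gen n (H \<union> ?F)"
      using R.union_genideal[of H ?F] idlH idlF by (simp add: ideal_mpoly_ring_iff genideal_mpoly_ring)
    also have "\<dots> = J'"
      using PR.gen_gen_Un[of "{f k}" "{1..n}" H] fk HC by (simp add: J'_def Un_commute)
    finally show ?thesis by (simp add: genideal_mpoly_ring)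
  qed
  have idlJ': "idl n J'" unfolding J'_def using fk HC by (intro PR.idl_gen) simp
  have J'_sub: "f k \<in> J'" "H \<subseteq> J'" using PR.gen_superset[of "insert (f k) H"] unfolding J'_def by auto
  have JH: "J \<subseteq> H" unfolding H by (rule saturation_superset[OF I(1) idlF])
  have idlK: "idl n ?K" by (rule idl_ideal_quotient[OF I(1)])
  have "{1..k} = insert k {1..k - 1}" using k by auto
  then have img: "f ` {1..k} = insert (f k) (f ` {1..k - 1})" by simp
  show ?thesis
    unfolding alg_inv_def J'
  proof (intro conjI allI impI ballI)
    show "idl n J'" by (rule idlJ')
    show "finite (insert ?K \<K>)" using I(2) by simp
    show "idl n K" if "K \<in> insert ?K \<K>" for K using that I(3) idlK by blast
    show "f ` {1..k} \<subseteq> J'" unfolding img using I(4) JH J'_sub by blast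
  next
    fix P assume P: "prm n P \<and> J' \<subseteq> P"
    then have pP: "prm n P" and "H \<subseteq> P" "f k \<in> P" using J'_sub by auto
    obtain P' where P': "prm n P'" "J \<subseteq> P'" "P' \<subseteq> P" "\<not> ?F \<subseteq> P'"
      using prime_below_saturation[OF I(1) idlF pP] \<open>H \<subseteq> P\<close> unfolding H by blast
    have "f k \<notin> P'"
      using P'(4) PR.gen_minimal[OF PR.prmD(1)[OF P'(1)], of "{f k}"] by blast
    then have "P' \<subset> P" using P'(3) \<open>f k \<in> P\<close> by blast
    then have "trd n P < trd n P'" by (rule trd_strict[OF P'(1) pP])
    also have "\<dots> \<le> n - (k - 1)" by (rule I(5)[OF P'(1,2)])
    finally show "trd n P \<le> n - k" using k by simp
  next
    fix P assume P: "prm n P \<and> f ` {1..k} \<subseteq> P"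
    then have pP: "prm n P" and fP: "f k \<in> P" "f ` {1..k - 1} \<subseteq> P" unfolding img by auto
    show "J' \<subseteq> P \<or> (\<exists>K\<in>insert ?K \<K>. K \<subseteq> P)"
    proof (cases "\<exists>K\<in>insert ?K \<K>. K \<subseteq> P")
      case False
      then have JP: "J \<subseteq> P" using I(6)[OF pP fP(2)] by blast
      \<comment> \<open>An element of \<open>J : H\<close> multiplies \<open>H\<close> into
        \<open>J\<close>; since this one lies outside \<open>P\<close>, all of \<open>H\<close> lies
        in \<open>P\<close>.\<close>
      obtain u where u: "u \<in> ?K" "u \<notin> P" using False by blast
      have "H \<subseteq> P"
      proof
        fix v assume v: "v \<in> H"
        have "u * v \<in> P" using u(1) v JP unfolding ideal_quotient_mpoly_ring by blast
        then show "v \<in> P"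
          using PR.prmD(3)[OF pP, of u v] u v PR.idlD(1)[OF idlK u(1)] PR.idlD(1)[OF idlH v] by blast
      qed
      then have "J' \<subseteq> P"
        unfolding J'_def using fP(1) by (intro PR.gen_minimal PR.prmD(1)[OF pP]) simp
      then show ?thesis by blast
    qed blast
  next
    fix P assume P: "good P"
    have pP: "prm n P" by (rule good_prm[OF P])
    have k1: "k - 1 \<le> c" using k by simp
    \<comment> \<open>At \<open>P\<close> the element \<open>f k\<close> cancels modulo
      \<open>G (k - 1)\<close>, so saturating by it adds nothing there, not even embedded
      parts.\<close>
    have HL: "H \<subseteq> loc n P (G (k - 1))"
    proof
      fix a assume "a \<in> H"
      then obtain N where a: "a \<in> Rn n" "\<forall>q\<in>prods ?F N. a * q \<in> J"
        unfolding H saturation_mem_iff[OF I(1) idlF] by blast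
      have "a * f k ^ N \<in> J" using a(2) power_prods[OF fkF] by blast
      then have "a * f k ^ N \<in> loc n P (G (k - 1))" using I(8)[OF P] by blast
      then show "a \<in> loc n P (G (k - 1))"
      proof (induction N)
        case (Suc N)
        have "a * f k ^ N * f k \<in> loc n P (G (k - 1))"
          using Suc.prems by (simp add: mult_ac)
        from nonzerodivisor[OF P k _ this] have "a * f k ^ N \<in> loc n P (G (k - 1))"
          using a(1) fk by simp
        then show ?case by (rule Suc.IH)
      qed simp
    qed
    show "J' \<subseteq> loc n P (G k)"
      unfolding J'_def
    proof (intro PR.gen_minimal PR.idl_loc pP idl_G k insert_subsetI)
      show "f k \<in> loc n P (G k)"
        using PR.loc_superset[OF pP idl_G[OF k(2)]] PR.gen_superset[of "f ` {1..k}" "{1..n}"] img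
        unfolding G_def by blast
      show "H \<subseteq> loc n P (G k)"
        using HL PR.loc_mono[OF G_mono[of "k - 1" k]] by (meson diff_le_self subset_trans)
    qed
    fix K assume "K \<in> insert ?K \<K>"
    then consider "K = ?K" | "K \<in> \<K>" by blast
    then show "\<not> K \<subseteq> P"
    proof cases
      case 1
      \<comment> \<open>A denominator for the whole local ideal multiplies \<open>H\<close> into
        \<open>G (k - 1)\<close> and hence into \<open>J\<close>, which makes it an element of
        \<open>J : H\<close> outside \<open>P\<close>.\<close>
      obtain s where s: "s \<in> Rn n" "s \<notin> P" "\<And>a. a \<in> loc n P (G (k - 1)) \<Longrightarrow> s * a \<in> G (k - 1)"
        using NR.loc_eq_colon[OF pP idl_G[OF k1]] by metis
      have "G (k - 1) \<subseteq> J" unfolding G_def by (rule PR.gen_minimal[OF I(1,4)])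
      then have "s \<in> ?K" unfolding ideal_quotient_mpoly_ring using s(1,3) HL by blast
      then show ?thesis using s(2) 1 by blast
    next
      case 2
      then show ?thesis by (rule I(9)[OF P])
    qed
  qed simp
qed

text \<open>Minimal primes of the saturation are minimal primes of \<open>J\<close>, so saturating
  by \<open>K\<close> does not undo what earlier saturations achieved.\<close>

lemma inv_saturate:
  assumes J_inv: "alg_inv k J \<K> \<D>" and K: "K \<in> \<K>"
  shows "alg_inv k (sat n J K) \<K> (insert K \<D>)"
proof -
  note I = invD[OF J_inv]
  note idlK = I(3)[OF K]
  have JS: "J \<subseteq> sat n J K" by (rule saturation_superset[OF I(1) idlK])
  show ?thesis
    unfolding alg_inv_def
  proof (intro conjI allI impI ballI)
    show "idl n (sat n J K)" by (rule idl_saturation[OF I(1) idlK])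
    show "finite \<K>" by (rule I(2))
    show "idl n L" if "L \<in> \<K>" for L by (rule I(3)[OF that])
    show "f ` {1..k} \<subseteq> sat n J K" using I(4) JS by blast
  next
    fix P assume "prm n P \<and> sat n J K \<subseteq> P"
    then show "trd n P \<le> n - k" using JS by (intro I(5)) auto
  next
    fix P assume "prm n P \<and> f ` {1..k} \<subseteq> P"
    then have pP: "prm n P" and fP: "f ` {1..k} \<subseteq> P" by simp_all
    show "sat n J K \<subseteq> P \<or> (\<exists>K\<in>\<K>. K \<subseteq> P)"
    proof (cases "\<exists>K\<in>\<K>. K \<subseteq> P")
      case False
      then have "J \<subseteq> P" using I(6)[OF pP fP] by simp
      moreover have "\<not> K \<subseteq> P" using False K by simp
      ultimately show ?thesis using saturation_subset_prime[OF I(1) idlK pP] by simp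
    qed simp
  next
    fix P L assume P: "minimal_over n (sat n J K) P" and "L \<in> insert K \<D>"
    then show "\<not> L \<subseteq> P"
      using minimal_over_saturation[OF I(1) idlK P] I(7)[of P L] by auto
  next
    fix P assume P: "good P"
    show "sat n J K \<subseteq> loc n P (G k)"
      by (rule saturation_loc_subset[OF I(1) idlK good_prm[OF P] I(8)[OF P] I(9)[OF P K]])
    show "\<not> L \<subseteq> P" if "L \<in> \<K>" for L by (rule I(9)[OF P that])
  qed
qed

text \<open>A prime \<open>Q\<close> between \<open>G c\<close> and a minimal prime \<open>P\<close>
  of \<open>J\<close> contains no member of \<open>\<K>\<close>, because \<open>P\<close> contains
  none. The covering clause of the invariant then puts \<open>J\<close> into \<open>Q\<close>, so
  \<open>P\<close> is also minimal over \<open>G c\<close>.\<close>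

lemma inv_final:
  assumes J_inv: "alg_inv c J \<K> \<K>"
  shows "zero_set n J = nondegenerate_locus n c f"
proof -
  note I = invD[OF J_inv]
  have locus: "nondegenerate_locus n c f = \<Union> {zero_set n P | P. good P}"
    unfolding good_def G_def by (rule nondegenerate_locus_eq[OF c f_image[OF order_refl]])
  have min_good: "good P" if P: "minimal_over n J P" for P
  proof -
    have pP: "prm n P" and JP: "J \<subseteq> P"
      and min: "\<And>Q. prm n Q \<Longrightarrow> J \<subseteq> Q \<Longrightarrow> Q \<subseteq> P \<Longrightarrow> Q = P"
      using P unfolding PR.minimal_over_def by auto
    have "G c \<subseteq> P" unfolding G_def using I(4) JP by (intro PR.gen_minimal PR.prmD(1)[OF pP]) blast
    moreover have "Q = P" if Q: "prm n Q" "G c \<subseteq> Q" "Q \<subseteq> P" for Q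
    proof -
      have "f ` {1..c} \<subseteq> Q" using Q(2) PR.gen_superset unfolding G_def by blast
      moreover have "\<not> K \<subseteq> Q" if "K \<in> \<K>" for K using I(7)[OF P that] Q(3) by blast
      ultimately have "J \<subseteq> Q" using I(6)[OF Q(1)] by blast
      then show ?thesis using min Q by blast
    qed
    ultimately have m: "minimal_over n (G c) P"
      using pP unfolding PR.minimal_over_def by blast
    have "f ` {1..c} = set (map f [1..<Suc c])" by auto
    then have "n \<le> trd n P + length (map f [1..<Suc c])"
      using m f_image[OF order_refl] unfolding G_def by (intro affine_height_theorem) simp_all
    then have "n \<le> trd n P + c" by (simp del: upt_Suc)
    then show ?thesis using m I(5)[OF pP JP] c unfolding good_def by simp
  qed
  have good_sub: "J \<subseteq> P" if "good P" for P
  proof -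
    have "G c \<subseteq> P" using that unfolding good_def PR.minimal_over_def by simp
    then show ?thesis using I(8)[OF that] PR.loc_subset_prm[OF good_prm[OF that]] by blast
  qed
  show ?thesis
  proof
    show "zero_set n J \<subseteq> nondegenerate_locus n c f"
    proof
      fix x assume "x \<in> zero_set n J"
      moreover have "J \<subseteq> Rn n" using PR.idlD(1)[OF I(1)] by (rule subsetI)
      ultimately obtain P where "minimal_over n J P" "x \<in> zero_set n P"
        using zero_set_eq_Union_minimal by meson
      then show "x \<in> nondegenerate_locus n c f" unfolding locus using min_good by auto
    qed
    show "nondegenerate_locus n c f \<subseteq> zero_set n J"
      unfolding locus using zero_set_anti[OF good_sub] by auto
  qed
qed

text \<open>At the head of round \<open>k\<close> only \<open>k - 1\<close> rounds are complete;
  \<open>Suc c\<close> is the index with which the loop is left.\<close>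

fun state_inv :: "'k mpoly state \<Rightarrow> bool" where
  "state_inv (Outer k J \<K>) \<longleftrightarrow> 1 \<le> k \<and> k \<le> Suc c \<and> alg_inv (k - 1) J \<K> \<K>"
| "state_inv (Inner k J \<K> \<P>) \<longleftrightarrow> 1 \<le> k \<and> k \<le> c \<and> \<P> \<subseteq> \<K> \<and> alg_inv k J \<K> (\<K> - \<P>)"
| "state_inv (Returned J) \<longleftrightarrow> idl n J \<and> zero_set n J = nondegenerate_locus n c f"

lemma state_inv_initial: "state_inv (initial_state R)"
  unfolding initial_state_def using inv_initial by simp

lemma state_inv_step: "step R c f s t \<Longrightarrow> state_inv s \<Longrightarrow> state_inv t"
proof (induction rule: step.induct)
  case (round k H J \<K>' \<K>)
  then show ?case using inv_round[of k J \<K> \<K> H] by simp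
next
  case (saturate K \<P> k J \<K>)
  then have "\<K> - (\<P> - {K}) = insert K (\<K> - \<P>)" by auto
  then show ?case using saturate inv_saturate[of k J \<K> "\<K> - \<P>" K] by auto
next
  case (return k J \<K>)
  then have "k = Suc c" by simp
  then have "alg_inv c J \<K> \<K>" using return.prems by simp
  then show ?case using inv_final invD(1) by simp
qed simp

lemma state_inv_reachable: "(step R c f)\<^sup>*\<^sup>* (initial_state R) s \<Longrightarrow> state_inv s"
  by (induction rule: rtranclp_induct) (use state_inv_initial state_inv_step in blast)+

text \<open>With \<open>c + 2\<close> the last outer state, of index \<open>Suc c\<close>, still has
  a positive first component, so returning decreases it. The second component pays for entering the
  inner loop.\<close>

fun state_measure :: "'k mpoly state \<Rightarrow> nat \<times> nat \<times> nat" where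
  "state_measure (Outer k J \<K>) = (c + 2 - k, 1, 0)"
| "state_measure (Inner k J \<K> \<P>) = (c + 2 - k, 0, card \<P>)"
| "state_measure (Returned J) = (0, 0, 0)"

lemma state_measure_step:
  "step R c f s t \<Longrightarrow> state_inv s \<Longrightarrow> (state_measure t, state_measure s) \<in> less_than <*lex*> less_than <*lex*> less_than"
proof (induction rule: step.induct)
  case (saturate K \<P> k J \<K>)
  then have "finite \<K>" "\<P> \<subseteq> \<K>" using invD(2)[of k J \<K> "\<K> - \<P>"] by simp_all
  then have "finite \<P>" by (rule finite_subset[rotated])
  then show ?case using saturate.hyps card_Diff1_less[of \<P> K] by simp
qed auto

lemma algorithm_terminates: "terminates (step R c f) (initial_state R)"
  unfolding terminates_def
proof
  assume "\<exists>S. S 0 = initial_state R \<and> (\<forall>i. step R c f (S i) (S (Suc i)))"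
  then obtain S where S: "S 0 = initial_state R" "\<And>i. step R c f (S i) (S (Suc i))" by blast
  have S_inv: "state_inv (S i)" for i
    by (induction i) (use S state_inv_initial state_inv_step in auto)
  have "wf (less_than <*lex*> less_than <*lex*> less_than)" by auto
  moreover have "\<exists>g. \<forall>i. (g (Suc i), g i) \<in> less_than <*lex*> less_than <*lex*> less_than"
    by (intro exI[of _ "\<lambda>i. state_measure (S i)"] allI state_measure_step S(2) S_inv)
  ultimately show False unfolding wf_iff_no_infinite_down_chain by blast
qed

text \<open>Progress: every state other than a returned one has a successor, so a terminating run
  can end only with an output.\<close>

lemma stuck_state: "(\<nexists>t. step R c f s t) \<Longrightarrow> \<exists>J. s = Returned J"
proof (cases s)
  case (Outer k J \<K>)
  assume "\<nexists>t. step R c f s t"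
  then show ?thesis
    using step.round[of k c _ R J f, OF _ refl refl] step.return[of c k R f J \<K>] Outer by (metis not_le)
next
  case (Inner k J \<K> \<P>)
  assume "\<nexists>t. step R c f s t"
  then show ?thesis
    using step.saturate[of _ \<P> R c f k J \<K>] step.next_round[of R c f k J \<K>] Inner by (metis ex_in_conv)
qed simp

end

theorem theorem2p4:
  fixes f :: "nat \<Rightarrow> 'k::field mpoly" and n c :: nat
  assumes "c \<le> n"
    and "\<And>i. i \<in> {1..c} \<Longrightarrow> f i \<in> carrier (mpoly_ring n)"
  shows "terminates (step (mpoly_ring n) c f) (initial_state (mpoly_ring n)) \<and>
         (\<forall>s. (step (mpoly_ring n) c f)\<^sup>*\<^sup>* (initial_state (mpoly_ring n)) s \<and>
              (\<nexists>s'. step (mpoly_ring n) c f s s') \<longrightarrow>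
              (\<exists>J. s = Returned J \<and> ideal J (mpoly_ring n) \<and>
                   zero_set n J = nondegenerate_locus n c f))"
proof -
  interpret nondegenerate_algorithm n c f
    using assms by unfold_locales (simp_all add: carrier_mpoly_ring)
  show ?thesis
  proof (intro conjI allI impI)
    show "terminates (step (mpoly_ring n) c f) (initial_state (mpoly_ring n))"
      by (rule algorithm_terminates)
    fix s
    assume s: "(step (mpoly_ring n) c f)\<^sup>*\<^sup>* (initial_state (mpoly_ring n)) s \<and>
      (\<nexists>s'. step (mpoly_ring n) c f s s')"
    then obtain J where J: "s = Returned J" using stuck_state by blast
    then show "\<exists>J. s = Returned J \<and> ideal J (mpoly_ring n) \<and> zero_set n J = nondegenerate_locus n c f"
      using state_inv_reachable[of s] s by (simp add: ideal_mpoly_ring_iff)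
  qed
qed

end
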